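(* Assume that: (i) $K$ is a bounded nonnegative function on $\mathbb{R}^d$ with $\int_{\mathbb{R}^d}K(z)\,dz=1$, $\int_{\mathbb{R}^d}z_jK(z)\,dz=0$ for all $j\in\{1,\dots,d\}$, and $\int_{\mathbb{R}^d}\|z\|^2|K(z)|\,dz<\infty$; (ii) $K$ is Hölder-continuous on $\mathbb{R}^d$ and satisfies the covering number condition; (iii) $f$ is twice differentiable on $\mathbb{R}^d$, $\sup_{x\in\mathbb{R}^d}\|\nabla f(x)\|<\infty$ and $\sup_{x\in\mathbb{R}^d}\|D^2f(x)\|<\infty$; (iv) either $C\subset\mathbb{R}^d$ is a compact set containing a point $x$ with $f(x)\neq 0$, or $C=\mathbb{R}^d$ and there exists $q>0$ such that $z\mapsto\|z\|^qf(z)$ is bounded on $\mathbb{R}^d$. For $n\geq 3$ let $$h_n=n^{-a}\ \text{ with } a\in\left(\frac{1}{d+4},\frac{d+4}{d(d+8)}\right),\qquad h_n^*=n^{-(1-ad)/4},\qquad \epsilon_n=(\log n)^{-e}\ \text{ with } e\in(0,1),$$ let $T_n(x)=f_n(x)$ if $f_n(x)\geq\epsilon_n\left[\sup_{y\in C}f_n(y)\right]$ and $T_n(x)=\epsilon_n\left[\sup_{y\in C}f_n(y)\right]$ otherwise, and set, for each $x\in C$, $$I_n^{***}(x)=\left[f_n^*(x)-\frac{\sqrt{T_n(x)\kappa}}{\sqrt{nh_n^d}}\sqrt{\log(1/h_n)}\sqrt2\,;\,f_n^*(x)+\frac{\sqrt{T_n(x)\kappa}}{\sqrt{nh_n^d}}\sqrt{\log(1/h_n)}\sqrt2\right].$$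 Then the logarithmic asymptotic level of the confidence band $B_n^{***}=\cup_{x\in C}I_n^{***}(x)$ is $1$ with speed $h_n^{*d}\log(1/h_n)/h_n^d$, that is, $$\lim_{n\to\infty}\frac{h_n^d}{h_n^{*d}\log(1/h_n)}\log\mathbb{P}\left(\exists x\in C,\ f(x)\notin I_n^{***}(x)\right)=-1 .$$
   Context: Setting: $d\geq 1$ is an integer and $X_1,X_2,\dots$ are independent identically distributed $\mathbb{R}^d$-valued random vectors with bounded probability density $f$. The kernel $K$ also satisfies $\lim_{\|z\|\to\infty}K(z)=0$. The kernel density estimators are $$f_n(x)=\frac{1}{nh_n^d}\sum_{j=1}^nK\left(\frac{x-X_j}{h_n}\right),\qquad f_n^*(x)=\frac{1}{nh_n^{*d}}\sum_{j=1}^nK\left(\frac{x-X_j}{h_n^*}\right),$$ and $\kappa=\int_{\mathbb{R}^d}K^2(z)\,dz$. In the definition of $B_n^{***}$, $I_n^{***}(x)$ is identified with $\{x\}\times I_n^{***}(x)$. Covering number condition: for a probability $Q$ on $\mathbb{R}^d$ and a class $\mathcal{F}\subset\mathcal{L}_2(Q)$, the covering number $N_2(\epsilon,Q,\mathcal{F})$ is the smallest $m$ for which there exist $g_1,\dots,g_m\in\mathcal{L}_2(Q)$ with $\min_{1\leq i\leq m}\|g-g_i\|_{\mathcal{L}_2(Q)}\leq\epsilon$ for all $g\in\mathcal{F}$ ($N_2=\infty$ if no such $m$ exists). For a bounded integrable function $\Lambda$ on $\mathbb{R}^d$ let $\mathcal{F}(\Lambda)=\{z\mapsto\Lambda(\frac{x-z}{h}):\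 h>0,\ x\in\mathbb{R}^d\}$. $\Lambda$ satisfies the covering number condition if there exist $A>0$ and $v>0$ such that, for any probability $Q$ on $\mathbb{R}^d$ and any $\epsilon\in(0,1)$, $N_2(\epsilon\|\Lambda\|_\infty,Q,\mathcal{F}(\Lambda))\leq(A/\epsilon)^v$. *)

theory Defs
  imports "HOL-Probability.Probability"
begin

definition holder_continuous :: "('a::metric_space \<Rightarrow> real) \<Rightarrow> bool" where
  "holder_continuous g \<longleftrightarrow>
     (\<exists>\<alpha> L. 0 < \<alpha> \<and> \<alpha> \<le> 1 \<and> (\<forall>x y. \<bar>g x - g y\<bar> \<le> L * dist x y powr \<alpha>))"

definition L2_space :: "'a measure \<Rightarrow> ('a \<Rightarrow> real) set" where
  "L2_space Q = {g. g \<in> borel_measurable Q \<and> integrable Q (\<lambda>z. (g z)\<^sup>2)}"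

(* Only meaningful on L2_space Q: the Bochner integral of a non-integrable function is 0. *)
definition L2_norm :: "'a measure \<Rightarrow> ('a \<Rightarrow> real) \<Rightarrow> real" where
  "L2_norm Q g = sqrt (LINT z|Q. (g z)\<^sup>2)"

(* On enat, Inf is the least element of a nonempty set, and Inf {} = \<infinity>. *)
definition covering_number :: "real \<Rightarrow> 'a measure \<Rightarrow> ('a \<Rightarrow> real) set \<Rightarrow> enat" where
  "covering_number \<epsilon> Q F =
     Inf {enat m | m. \<exists>g :: nat \<Rightarrow> 'a \<Rightarrow> real. (\<forall>i\<in>{1..m}. g i \<in> L2_space Q) \<and>
            (\<forall>\<phi>\<in>F. \<exists>i\<in>{1..m}. L2_norm Q (\<lambda>z. \<phi> z - g i z) \<le> \<epsilon>)}"

definition kernel_class :: "('a::real_vector \<Rightarrow> real) \<Rightarrow> ('a \<Rightarrow> real) set" where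
  "kernel_class \<Lambda> = {\<lambda>z. \<Lambda> ((x - z) /\<^sub>R h) | h x. h > 0}"

definition covering_number_condition :: "('a::euclidean_space \<Rightarrow> real) \<Rightarrow> bool" where
  "covering_number_condition \<Lambda> \<longleftrightarrow>
     (\<exists>A>0. \<exists>v>0. \<forall>Q::'a measure. prob_space Q \<and> sets Q = sets borel \<longrightarrow>
        (\<forall>\<epsilon>\<in>{0<..<1}.
           ereal_of_enat (covering_number (\<epsilon> * (SUP z. \<bar>\<Lambda> z\<bar>)) Q (kernel_class \<Lambda>))
             \<le> ereal ((A / \<epsilon>) powr v)))"

(* The data are X 1, X 2, ...; the value X 0 is never used. *)
definition kde ::
  "('a::euclidean_space \<Rightarrow> real) \<Rightarrow> (nat \<Rightarrow> 'b \<Rightarrow> 'a) \<Rightarrow> (nat \<Rightarrow> real) \<Rightarrow> nat \<Rightarrow> 'b \<Rightarrow> 'a \<Rightarrow> real" where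
  "kde K X h n \<omega> x =
     1 / (real n * h n ^ DIM('a)) * (\<Sum>j=1..n. K ((x - X j \<omega>) /\<^sub>R h n))"

definition truncate_below :: "real \<Rightarrow> 'a set \<Rightarrow> ('a \<Rightarrow> real) \<Rightarrow> 'a \<Rightarrow> real" where
  "truncate_below \<epsilon> C g x =
     (if g x \<ge> \<epsilon> * (SUP y\<in>C. g y) then g x else \<epsilon> * (SUP y\<in>C. g y))"

definition conf_interval ::
  "('a::euclidean_space \<Rightarrow> real) \<Rightarrow> (nat \<Rightarrow> 'b \<Rightarrow> 'a) \<Rightarrow> 'a set \<Rightarrow>
   (nat \<Rightarrow> real) \<Rightarrow> (nat \<Rightarrow> real) \<Rightarrow> (nat \<Rightarrow> real) \<Rightarrow> nat \<Rightarrow> 'b \<Rightarrow> 'a \<Rightarrow> real set" where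
  "conf_interval K X C h hs \<epsilon> n \<omega> x =
     (let \<kappa> = (LINT z|lborel. (K z)\<^sup>2);
          T = truncate_below (\<epsilon> n) C (kde K X h n \<omega>) x;
          r = sqrt (T * \<kappa>) / sqrt (real n * h n ^ DIM('a)) * sqrt (ln (1 / h n)) * sqrt 2
      in {kde K X hs n \<omega> x - r .. kde K X hs n \<omega> x + r})"

end

theory Submission
  imports Defs "HOL-Real_Asymp.Real_Asymp"
begin

text \<open>
  Write $b$ for the larger bandwidth $h_n^*$, $\rho^2 = 2\kappa\log(1/h)/(nh^d)$ and
  $V = nb^d\rho^2/(2\kappa) = b^d\log(1/h)/h^d$.  For a fixed point, $f_n^*(x) - f(x)$ exceeds
  $\rho\sqrt{f(x)}$ with probability $e^{-(1+o(1))V}$: the upper bound is Chernoff's inequality with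
  a second order expansion of the moment generating function, the lower bound follows from the same
  expansion at nearby parameters.  The choice of $b$ makes the bias, of order $b^2$, negligible
  against $\rho\sqrt{\epsilon_n}$, and the upper restriction on $a$ makes $V$ negligible against
  $nh^d\epsilon_n$, so that replacing $T_n(x)$ by $\max(f(x), \epsilon_n\sup_C f)$ costs only
  super-exponentially small probabilities on the scale $V$.

  Uniformity in $x$ needs no empirical process theory.  By Hoelder continuity of $K$, a bad point
  forces a whole ball of polynomially small radius of slightly less bad points, so the probability
  of a bad point is at most the integral over $y$ of the pointwise tail bounds, divided by the
  volume of that ball.  The tail bounds carry a factor whose integral over the whole space is
  finite, which covers $C = \mathbb{R}^d$ as well.
\<close>

section \<open>Exponential moments of kernel sums\<close>

text \<open>The half-width of the band at x is \<rho> times the root of an estimate of f(x), hence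
  proportional to the standard deviation of the estimator that centres it. This is why V does not
  depend on x: all points fail at the same exponential rate, the supremum over C changes only
  polynomial factors, and a single point with f > 0 suffices for the lower bound.

  The obstacle is the region where f is small or zero. The errors of the second order expansion are
  not small relative to f there, so the floor \<epsilon> sup f takes the place of f in the variance,
  and every error term is compared with that floor.

  Bias and half-width have the same power of n; only logarithms separate them. Their ratio at the
  floor is of order (log n)^((e - 1) / 2), whence the condition e < 1. The lower restriction on a
  makes V grow faster than log n, so that the volumes of the small balls vanish from the limit.

  All bounds hold at finite n with a fixed relative error \<delta> or \<gamma>, which is made small
  only in the final limit.\<close>

lemma exp_le_quadratic:
  fixes x :: real
  assumes "0 \<le> x" "x \<le> 1"
  shows "exp x \<le> 1 + x + x\<^sup>2 / 2 * (1 + x)"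
proof -
  \<comment> \<open>The remainder factor 1 + x tends to 1 with x to 0, so the second order
    coefficient stays 1/2 in the limit, as the exact rate requires. Weighting by
    \<open>exp (- x)\<close> turns the comparison into monotonicity of a function whose derivative
    has a visible sign.\<close>
  define p where "p = (\<lambda>x::real. 1 + x + x\<^sup>2 / 2 * (1 + x))"
  have "p 0 * exp (- 0) \<le> p x * exp (- x)"
  proof (rule DERIV_nonneg_imp_nondecreasing[OF assms(1)])
    fix y assume y: "0 \<le> y" "y \<le> x"
    have "((\<lambda>x. p x * exp (- x)) has_real_derivative (y\<^sup>2 * (1 - y / 2) * exp (- y))) (at y)"
      unfolding p_def
      by (auto intro!: derivative_eq_intros simp: field_simps power2_eq_square)
    moreover have "0 \<le> y\<^sup>2 * (1 - y / 2) * exp (- y)"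
      using y assms by auto
    ultimately show "\<exists>z. ((\<lambda>x. p x * exp (- x)) has_real_derivative z) (at y) \<and> 0 \<le> z" by blast
  qed
  then have "exp x * 1 \<le> exp x * (p x * exp (- x))"
    by (intro mult_left_mono) (auto simp: p_def)
  also have "\<dots> = p x" by (simp add: exp_minus)
  finally show ?thesis by (simp add: p_def)
qed

lemma exp_minus_le_quadratic:
  fixes x :: real
  assumes "0 \<le> x"
  shows "exp (- x) \<le> 1 - x + x\<^sup>2 / 2"
proof -
  define p where "p = (\<lambda>x::real. 1 - x + x\<^sup>2 / 2 - exp (- x))"
  have "p 0 \<le> p x"
  proof (rule DERIV_nonneg_imp_nondecreasing[OF assms(1)])
    fix y assume y: "0 \<le> y" "y \<le> x"
    have "(p has_real_derivative (- 1 + y + exp (-y))) (at y)"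
      unfolding p_def
      by (auto intro!: derivative_eq_intros simp: field_simps power2_eq_square)
    moreover have "0 \<le> - 1 + y + exp (-y)"
      using exp_ge_add_one_self[of "-y"] by simp
    ultimately show "\<exists>z. (p has_real_derivative z) (at y) \<and> 0 \<le> z" by blast
  qed
  then show ?thesis by (simp add: p_def)
qed

text \<open>Markov's inequality will be applied to exp(\<theta> S) - 1, whose mean has this form.
  Unlike the plain bound by \<open>exp (real n * m)\<close>, the right-hand side keeps a factor m,
  and that factor can be integrated over all points.\<close>

lemma one_plus_power_minus_one_le:
  fixes m :: real
  assumes "0 \<le> m"
  shows "(1 + m) ^ n - 1 \<le> real n * m * exp (real n * m)"
proof (induction n)
  case (Suc n)
  have e: "exp (real n * m) \<le> exp (real (Suc n) * m)"
    using assms by (simp add: mult_right_mono)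
  have "(1 + m) ^ Suc n - 1 = (1 + m) ^ n - 1 + m * (1 + m) ^ n"
    by (simp add: algebra_simps)
  also have "(1 + m) ^ n \<le> exp (real n * m)"
    unfolding exp_of_nat_mult using assms by (intro power_mono) auto
  then have "(1 + m) ^ n - 1 + m * (1 + m) ^ n \<le> real n * m * exp (real n * m) + m * exp (real n * m)"
    using assms Suc by (intro add_mono mult_left_mono) auto
  also have "\<dots> = real (Suc n) * m * exp (real n * m)" by (simp add: algebra_simps)
  also have "\<dots> \<le> real (Suc n) * m * exp (real (Suc n) * m)"
    using e assms by (intro mult_left_mono) auto
  finally show ?case .
qed simp

text \<open>The derivatives of f and the moments of K enter only through \<open>f_lip\<close>,
  \<open>bias\<close> and \<open>second_moment\<close>. The mean needs second order accuracy,
  because the bias competes with the half-width itself; for the second moment an error of order b is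
  enough, since it only perturbs the rate by a factor close to 1.\<close>

locale kde_model = prob_space M for M :: "'b measure" +
  fixes X :: "nat \<Rightarrow> 'b \<Rightarrow> 'a::euclidean_space" and f K :: "'a \<Rightarrow> real"
    and F G B A1 A2 \<kappa> L \<alpha> :: real
  assumes indep: "indep_vars (\<lambda>_. borel) X {1..}"
    and distr: "\<And>j. j \<ge> 1 \<Longrightarrow> distributed M lborel (X j) (\<lambda>x. ennreal (f x))"
    and f_nonneg: "\<And>x. 0 \<le> f x" and f_le: "\<And>x. f x \<le> F"
    and f_lip: "\<And>x y. \<bar>f x - f y\<bar> \<le> G * dist x y"
    and K_nonneg: "\<And>z. 0 \<le> K z" and K_le: "\<And>z. K z \<le> B" and B_pos: "0 < B"
    and K_holder: "\<And>x y. \<bar>K x - K y\<bar> \<le> L * dist x y powr \<alpha>" and alpha_pos: "0 < \<alpha>"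
    and K_int: "integrable lborel K" and K_one: "(LINT z|lborel. K z) = 1"
    and kappa_pos: "0 < \<kappa>" and nonneg: "0 \<le> G" "0 \<le> A1" "0 \<le> A2" "0 \<le> L"
    and bias: "\<And>b x. 0 < b \<Longrightarrow> \<bar>(LINT z|lborel. K z * f (x - b *\<^sub>R z)) - f x\<bar> \<le> A2 * b\<^sup>2"
    and second_moment:
      "\<And>b x. 0 < b \<Longrightarrow> \<bar>(LINT z|lborel. (K z)\<^sup>2 * f (x - b *\<^sub>R z)) - \<kappa> * f x\<bar> \<le> A1 * b"
begin

lemma continuous_f: "continuous_on UNIV f"
proof (rule continuous_on_iff[THEN iffD2], intro ballI allI impI)
  fix x :: 'a and e :: real assume "0 < e"
  have "dist (f y) (f x) < e" if "dist y x < e / (G + 1)" for y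
  proof -
    have "dist (f y) (f x) \<le> G * dist y x" using f_lip[of y x] by (simp add: dist_real_def)
    also have "\<dots> \<le> (G + 1) * dist y x" by (simp add: mult_right_mono)
    also have "\<dots> < e" using that nonneg by (simp add: field_simps)
    finally show ?thesis .
  qed
  moreover have "0 < e / (G + 1)" using \<open>0 < e\<close> nonneg by auto
  ultimately show "\<exists>d>0. \<forall>y\<in>UNIV. dist y x < d \<longrightarrow> dist (f y) (f x) < e" by blast
qed

lemma continuous_K: "continuous_on UNIV K"
proof (rule continuous_on_iff[THEN iffD2], intro ballI allI impI)
  fix x :: 'a and e :: real assume e: "0 < e"
  define r where "r = (e / (L + 1)) powr (1 / \<alpha>)"
  have "dist (K y) (K x) < e" if "dist y x < r" for y
  proof -
    have "dist y x powr \<alpha> < r powr \<alpha>"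
      using that alpha_pos by (intro powr_less_mono2) auto
    also have "r powr \<alpha> = e / (L + 1)"
      using e nonneg alpha_pos by (simp add: r_def powr_powr)
    finally have *: "dist y x powr \<alpha> < e / (L + 1)" .
    have "dist (K y) (K x) \<le> L * dist y x powr \<alpha>" using K_holder[of y x] by (simp add: dist_real_def)
    also have "\<dots> \<le> (L + 1) * dist y x powr \<alpha>" by (simp add: mult_right_mono)
    also have "\<dots> < e" using * nonneg by (simp add: field_simps)
    finally show ?thesis .
  qed
  moreover have "0 < r" using \<open>0 < e\<close> nonneg by (auto simp: r_def)
  ultimately show "\<exists>d>0. \<forall>y\<in>UNIV. dist y x < d \<longrightarrow> dist (K y) (K x) < e" by blast
qed

lemma f_borel [measurable]: "f \<in> borel_measurable borel"
  using continuous_f by (rule borel_measurable_continuous_onI)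

lemma K_borel [measurable]: "K \<in> borel_measurable borel"
  using continuous_K by (rule borel_measurable_continuous_onI)

lemma X_borel: "j \<ge> 1 \<Longrightarrow> X j \<in> borel_measurable M"
  using distributed_measurable[OF distr] by simp

lemma expectation_kernel:
  assumes b: "0 < b" and j: "1 \<le> j" and [measurable]: "g \<in> borel_measurable borel"
  shows "expectation (\<lambda>\<omega>. g ((x - X j \<omega>) /\<^sub>R b)) =
    b ^ DIM('a) * (LINT z|lborel. g z * f (x - b *\<^sub>R z))"
proof -
  have "expectation (\<lambda>\<omega>. g ((x - X j \<omega>) /\<^sub>R b)) = (LINT y|lborel. f y * g ((x - y) /\<^sub>R b))"
    by (rule distributed_integral[OF distr[OF j], symmetric]) (auto simp: f_nonneg)
  also have "\<dots> = (LINT y|density (distr lborel borel (\<lambda>z. x + (- b) *\<^sub>R z)) (\<lambda>_. \<bar>- b\<bar>^DIM('a)).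
      f y * g ((x - y) /\<^sub>R b))"
    by (subst lborel_affine[of "- b" x]) (use b in auto)
  also have "\<dots> = (LINT z|lborel. \<bar>- b\<bar>^DIM('a) * (f (x + (- b) *\<^sub>R z) * g ((x - (x + (- b) *\<^sub>R z)) /\<^sub>R b)))"
    using b by (subst integral_density) (auto simp: integral_distr)
  also have "\<dots> = b ^ DIM('a) * (LINT z|lborel. g z * f (x - b *\<^sub>R z))"
    using b by (simp add: mult.left_commute[of _ "b ^ DIM('a)"] mult.commute[of "f _"])
  finally show ?thesis .
qed

section \<open>Moment generating function of the kernel sum\<close>

definition sumK :: "nat \<Rightarrow> real \<Rightarrow> 'a \<Rightarrow> 'b \<Rightarrow> real" where
  "sumK n b x \<omega> = (\<Sum>j=1..n. K ((x - X j \<omega>) /\<^sub>R b))"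

text \<open>For b > 0, one less than the moment generating function at t of a single summand K((x -
  X) / b), after the substitution y = x - b z. Without the 1, a quantity of order b^d remains, and
  the integrand is dominated by a multiple of K.\<close>

definition mg :: "real \<Rightarrow> real \<Rightarrow> 'a \<Rightarrow> real" where
  "mg t b x = b ^ DIM('a) * (LINT z|lborel. (exp (t * K z) - 1) * f (x - b *\<^sub>R z))"

text \<open>For b > 0, the mean of the estimator at x, that is, the convolution of f with the
  rescaled kernel.\<close>

definition meanK :: "real \<Rightarrow> 'a \<Rightarrow> real" where
  "meanK b x = (LINT z|lborel. K z * f (x - b *\<^sub>R z))"

lemma sumK_pair_borel [measurable]:
  "(\<lambda>(\<omega>, y). sumK n b y \<omega>) \<in> borel_measurable (M \<Otimes>\<^sub>M lborel)"
proof -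
  have [measurable]: "j \<in> {1..n} \<Longrightarrow> X j \<in> borel_measurable M" for j
    using X_borel by auto
  show ?thesis unfolding sumK_def by measurable
qed

lemma sumK_borel [measurable]: "sumK n b y \<in> borel_measurable M"
proof -
  have [measurable]: "j \<in> {1..n} \<Longrightarrow> X j \<in> borel_measurable M" for j
    using X_borel by auto
  show ?thesis unfolding sumK_def[abs_def] by measurable
qed

lemma sumK_nonneg: "0 \<le> sumK n b x \<omega>"
  unfolding sumK_def by (intro sum_nonneg K_nonneg)

lemma sumK_le: "sumK n b x \<omega> \<le> real n * B"
  unfolding sumK_def using sum_bounded_above[of "{1..n}" "\<lambda>j. K ((x - X j \<omega>) /\<^sub>R b)" B] K_le by simp

lemma integrable_exp_sumK: "integrable M (\<lambda>\<omega>. exp (t * sumK n b x \<omega>))"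
proof (rule integrable_const_bound[where B="exp (\<bar>t\<bar> * (real n * B))"])
  show "AE \<omega> in M. norm (exp (t * sumK n b x \<omega>)) \<le> exp (\<bar>t\<bar> * (real n * B))"
  proof (intro AE_I2)
    fix \<omega>
    have "t * sumK n b x \<omega> \<le> \<bar>t\<bar> * sumK n b x \<omega>"
      by (intro mult_right_mono sumK_nonneg) auto
    also have "\<dots> \<le> \<bar>t\<bar> * (real n * B)" by (intro mult_left_mono sumK_le) auto
    finally show "norm (exp (t * sumK n b x \<omega>)) \<le> exp (\<bar>t\<bar> * (real n * B))" by simp
  qed
qed simp

lemma mgf_sumK:
  assumes b: "0 < b"
  shows "expectation (\<lambda>\<omega>. exp (t * sumK n b x \<omega>)) = (1 + mg t b x) ^ n"
proof -
  define g where "g z = exp (t * K z) - 1" for z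
  define Y where "Y j \<omega> = exp (t * K ((x - X j \<omega>) /\<^sub>R b))" for j \<omega>
  have [measurable]: "g \<in> borel_measurable borel" unfolding g_def by measurable
  have Yb: "\<bar>Y j \<omega>\<bar> \<le> exp (\<bar>t\<bar> * B)" for j \<omega>
  proof -
    let ?k = "K ((x - X j \<omega>) /\<^sub>R b)"
    have "t * ?k \<le> \<bar>t\<bar> * ?k" by (intro mult_right_mono K_nonneg) auto
    also have "\<dots> \<le> \<bar>t\<bar> * B" by (intro mult_left_mono K_le) auto
    finally show ?thesis by (simp add: Y_def)
  qed
  have iv: "indep_vars (\<lambda>_. borel) Y {1..n}"
    unfolding Y_def
    by (rule indep_vars_compose2[where Y="\<lambda>_ y. exp (t * K ((x - y) /\<^sub>R b))", OF indep_vars_subset[OF indep]]) auto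
  have Yi: "integrable M (Y j)" if "j \<in> {1..n}" for j
  proof -
    have [measurable]: "X j \<in> borel_measurable M" using that X_borel by auto
    show ?thesis
      by (rule integrable_const_bound[where B="exp (\<bar>t\<bar> * B)"]) (use Yb in \<open>auto simp: Y_def[abs_def]\<close>)
  qed
  have "expectation (Y j) = 1 + mg t b x" if "j \<in> {1..n}" for j
  proof -
    have [measurable]: "X j \<in> borel_measurable M" using that X_borel by auto
    have "expectation (\<lambda>\<omega>. g ((x - X j \<omega>) /\<^sub>R b)) = mg t b x"
      using that b by (subst expectation_kernel) (auto simp: mg_def g_def)
    moreover have "expectation (\<lambda>\<omega>. g ((x - X j \<omega>) /\<^sub>R b)) = expectation (\<lambda>\<omega>. Y j \<omega> - 1)"
      by (simp add: g_def Y_def)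
    moreover have "\<dots> = expectation (Y j) - 1"
      using Yi[OF that] by (simp add: prob_space)
    ultimately show ?thesis by simp
  qed
  then have "(\<Prod>j\<in>{1..n}. expectation (Y j)) = (1 + mg t b x) ^ n" by simp
  moreover have "expectation (\<lambda>\<omega>. \<Prod>j\<in>{1..n}. Y j \<omega>) = (\<Prod>j\<in>{1..n}. expectation (Y j))"
    using iv Yi by (intro indep_vars_lebesgue_integral) auto
  moreover have "(\<Prod>j\<in>{1..n}. Y j \<omega>) = exp (t * sumK n b x \<omega>)" for \<omega>
    by (simp add: Y_def sumK_def exp_sum sum_distrib_left)
  ultimately show ?thesis by simp
qed

lemma integrable_K_mult:
  assumes [measurable]: "g \<in> borel_measurable borel" and "\<And>z. \<bar>g z\<bar> \<le> c * K z"
  shows "integrable lborel (\<lambda>z. g z * f (x - b *\<^sub>R z))"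
proof (rule Bochner_Integration.integrable_bound)
  show "integrable lborel (\<lambda>z. c * F * K z)" using K_int by simp
  show "AE z in lborel. norm (g z * f (x - b *\<^sub>R z)) \<le> norm (c * F * K z)"
  proof (intro AE_I2)
    fix z
    have "norm (g z * f (x - b *\<^sub>R z)) = \<bar>g z\<bar> * f (x - b *\<^sub>R z)"
      using f_nonneg by (simp add: abs_mult)
    also have "\<dots> \<le> c * K z * F"
      using assms(2)[of z] f_nonneg f_le by (intro mult_mono) (auto intro: order_trans)
    also have "\<dots> \<le> norm (c * F * K z)" by (simp add: mult_ac)
    finally show "norm (g z * f (x - b *\<^sub>R z)) \<le> norm (c * F * K z)" .
  qed
qed simp

lemma integrable_Kf: "integrable lborel (\<lambda>z. K z * f (x - b *\<^sub>R z))"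
  by (rule integrable_K_mult[where c=1]) (auto simp: K_nonneg)

lemma K2_le: "(K z)\<^sup>2 \<le> B * K z"
  using mult_right_mono[OF K_le K_nonneg, of z z] by (simp add: power2_eq_square)

lemma integrable_K2f: "integrable lborel (\<lambda>z. (K z)\<^sup>2 * f (x - b *\<^sub>R z))"
  by (rule integrable_K_mult[where c=B]) (auto simp: K2_le)

lemma tK_le:
  assumes "0 \<le> t" "t * B \<le> 1" shows "0 \<le> t * K z" "t * K z \<le> t * B" "t * K z \<le> 1"
proof -
  show "0 \<le> t * K z" "t * K z \<le> t * B" using assms K_nonneg K_le by (auto intro: mult_left_mono)
  then show "t * K z \<le> 1" using assms by simp
qed

lemma exp_tK_le:
  assumes "0 \<le> t" "t * B \<le> 1"
  shows "exp (t * K z) - 1 \<le> t * K z + t\<^sup>2 / 2 * (1 + t * B) * (K z)\<^sup>2"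
    and "exp (t * K z) - 1 \<le> 2 * t * K z"
proof -
  note tK = tK_le[OF assms, of z]
  have "exp (t * K z) - 1 \<le> t * K z + (t * K z)\<^sup>2 / 2 * (1 + t * K z)"
    using exp_le_quadratic[OF tK(1,3)] by simp
  also have "(t * K z)\<^sup>2 / 2 * (1 + t * K z) \<le> (t * K z)\<^sup>2 / 2 * (1 + t * B)"
    using tK by (intro mult_left_mono) auto
  finally show "exp (t * K z) - 1 \<le> t * K z + t\<^sup>2 / 2 * (1 + t * B) * (K z)\<^sup>2"
    by (simp add: power_mult_distrib mult_ac)
  have "exp (t * K z) \<le> 1 + t * K z + (t * K z)\<^sup>2"
    using tK by (intro exp_bound) auto
  also have "(t * K z)\<^sup>2 \<le> t * K z" using tK by (simp add: power2_eq_square mult_left_le)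
  finally show "exp (t * K z) - 1 \<le> 2 * t * K z" by simp
qed

lemma integrable_exp_tK:
  assumes "0 \<le> t" "t * B \<le> 1"
  shows "integrable lborel (\<lambda>z. (exp (t * K z) - 1) * f (x - b *\<^sub>R z))"
proof (rule integrable_K_mult[where c="2 * t"])
  fix z
  show "\<bar>exp (t * K z) - 1\<bar> \<le> 2 * t * K z"
    using exp_tK_le(2)[OF assms, of z] tK_le[OF assms, of z] by simp
qed simp

text \<open>The first and third bounds agree to second order and fix the exponent from both sides.
  The second loses a factor 2 but is proportional to \<open>meanK b x\<close>; it supplies the
  integrable prefactor of \<open>upper_tail\<close>.\<close>

lemma mg_le:
  assumes "0 < b" "0 \<le> t" "t * B \<le> 1"
  shows "mg t b x \<le> b ^ DIM('a) * (t * (f x + A2 * b\<^sup>2) + t\<^sup>2 / 2 * (1 + t * B) * (\<kappa> * f x + A1 * b))"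
    and "mg t b x \<le> 2 * t * b ^ DIM('a) * meanK b x"
    and "b ^ DIM('a) * (t * (f x - A2 * b\<^sup>2) + t\<^sup>2 / 2 * (\<kappa> * f x - A1 * b)) \<le> mg t b x"
    and "0 \<le> mg t b x"
proof -
  define c where "c = t\<^sup>2 / 2 * (1 + t * B)"
  have c0: "0 \<le> c" using assms B_pos by (auto simp: c_def)
  let ?I = "LINT z|lborel. (exp (t * K z) - 1) * f (x - b *\<^sub>R z)"
  let ?I2 = "LINT z|lborel. (K z)\<^sup>2 * f (x - b *\<^sub>R z)"
  have b1: "\<bar>meanK b x - f x\<bar> \<le> A2 * b\<^sup>2" using bias[OF assms(1)] by (simp add: meanK_def)
  note b2 = second_moment[OF assms(1), of x]
  have "?I \<le> (LINT z|lborel. t * (K z * f (x - b *\<^sub>R z)) + c * ((K z)\<^sup>2 * f (x - b *\<^sub>R z)))"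
  proof (rule integral_mono)
    fix z
    show "(exp (t * K z) - 1) * f (x - b *\<^sub>R z) \<le> t * (K z * f (x - b *\<^sub>R z)) + c * ((K z)\<^sup>2 * f (x - b *\<^sub>R z))"
      using mult_right_mono[OF exp_tK_le(1)[OF assms(2,3), of z] f_nonneg[of "x - b *\<^sub>R z"]]
      by (simp add: c_def algebra_simps)
  qed (auto intro!: integrable_exp_tK assms integrable_Kf integrable_K2f)
  also have "\<dots> = t * meanK b x + c * ?I2"
    using integrable_Kf integrable_K2f by (simp add: meanK_def)
  also have "\<dots> \<le> t * (f x + A2 * b\<^sup>2) + c * (\<kappa> * f x + A1 * b)"
    using b1 b2 c0 assms by (intro add_mono mult_left_mono) auto
  finally show "mg t b x \<le> b ^ DIM('a) * (t * (f x + A2 * b\<^sup>2) + t\<^sup>2 / 2 * (1 + t * B) * (\<kappa> * f x + A1 * b))"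
    unfolding mg_def c_def using assms by (intro mult_left_mono) auto
  have "?I \<le> (LINT z|lborel. 2 * t * (K z * f (x - b *\<^sub>R z)))"
  proof (rule integral_mono)
    fix z
    show "(exp (t * K z) - 1) * f (x - b *\<^sub>R z) \<le> 2 * t * (K z * f (x - b *\<^sub>R z))"
      using mult_right_mono[OF exp_tK_le(2)[OF assms(2,3), of z] f_nonneg[of "x - b *\<^sub>R z"]]
      by (simp add: algebra_simps)
  qed (auto intro!: integrable_exp_tK assms integrable_Kf)
  then have "?I \<le> 2 * t * meanK b x" using integrable_Kf by (simp add: meanK_def)
  then show "mg t b x \<le> 2 * t * b ^ DIM('a) * meanK b x"
    unfolding mg_def using assms mult_left_mono[of ?I "2 * t * meanK b x" "b ^ DIM('a)"] by (simp add: mult_ac)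
  have "t * (f x - A2 * b\<^sup>2) + t\<^sup>2 / 2 * (\<kappa> * f x - A1 * b) \<le> t * meanK b x + t\<^sup>2 / 2 * ?I2"
    using b1 b2 assms by (intro add_mono mult_left_mono) auto
  also have "\<dots> = (LINT z|lborel. t * (K z * f (x - b *\<^sub>R z)) + t\<^sup>2 / 2 * ((K z)\<^sup>2 * f (x - b *\<^sub>R z)))"
    using integrable_Kf integrable_K2f by (simp add: meanK_def)
  also have "\<dots> \<le> ?I"
  proof (rule integral_mono)
    fix z
    have "t * K z + t\<^sup>2 / 2 * (K z)\<^sup>2 \<le> exp (t * K z) - 1"
      using exp_lower_Taylor_quadratic[OF tK_le(1)[OF assms(2,3), of z]] by (simp add: power_mult_distrib)
    from mult_right_mono[OF this f_nonneg[of "x - b *\<^sub>R z"]]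
    show "t * (K z * f (x - b *\<^sub>R z)) + t\<^sup>2 / 2 * ((K z)\<^sup>2 * f (x - b *\<^sub>R z)) \<le> (exp (t * K z) - 1) * f (x - b *\<^sub>R z)"
      by (simp add: algebra_simps)
  qed (intro Bochner_Integration.integrable_add integrable_mult_right integrable_exp_tK assms integrable_Kf integrable_K2f)+
  finally show "b ^ DIM('a) * (t * (f x - A2 * b\<^sup>2) + t\<^sup>2 / 2 * (\<kappa> * f x - A1 * b)) \<le> mg t b x"
    unfolding mg_def using assms by (intro mult_left_mono) auto
  show "0 \<le> mg t b x"
    unfolding mg_def using assms f_nonneg tK_le[OF assms(2,3)] by (intro mult_nonneg_nonneg integral_nonneg) auto
qed

text \<open>The quadratic bound for exp(- x) holds for all x \<ge> 0, so t is not restricted by B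
  here. Deviations below f proportional to f itself depend on this: the corresponding t does not
  tend to 0.\<close>

lemma mg_neg_le:
  assumes "0 < b" "0 \<le> t"
  shows "mg (- t) b x \<le> b ^ DIM('a) * (- t * (f x - A2 * b\<^sup>2) + t\<^sup>2 / 2 * (\<kappa> * f x + A1 * b))"
proof -
  let ?I = "LINT z|lborel. (exp (- t * K z) - 1) * f (x - b *\<^sub>R z)"
  let ?I2 = "LINT z|lborel. (K z)\<^sup>2 * f (x - b *\<^sub>R z)"
  have b1: "\<bar>meanK b x - f x\<bar> \<le> A2 * b\<^sup>2" using bias[OF assms(1)] by (simp add: meanK_def)
  note b2 = second_moment[OF assms(1), of x]
  have bd: "\<bar>exp (- t * K z) - 1\<bar> \<le> t * K z" for z
    using exp_ge_add_one_self[of "- t * K z"] assms(2) K_nonneg[of z] by auto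
  have "?I \<le> (LINT z|lborel. (- t) * (K z * f (x - b *\<^sub>R z)) + t\<^sup>2 / 2 * ((K z)\<^sup>2 * f (x - b *\<^sub>R z)))"
  proof (rule integral_mono)
    fix z
    have "exp (- t * K z) - 1 \<le> - t * K z + t\<^sup>2 / 2 * (K z)\<^sup>2"
      using exp_minus_le_quadratic[of "t * K z"] assms(2) K_nonneg[of z] by (simp add: power_mult_distrib)
    from mult_right_mono[OF this f_nonneg[of "x - b *\<^sub>R z"]]
    show "(exp (- t * K z) - 1) * f (x - b *\<^sub>R z) \<le> (- t) * (K z * f (x - b *\<^sub>R z)) + t\<^sup>2 / 2 * ((K z)\<^sup>2 * f (x - b *\<^sub>R z))"
      by (simp add: algebra_simps)
  next
    show "integrable lborel (\<lambda>z. (exp (- t * K z) - 1) * f (x - b *\<^sub>R z))"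
      by (rule integrable_K_mult[OF _ bd]) simp
  qed (intro Bochner_Integration.integrable_add integrable_mult_right integrable_Kf integrable_K2f)
  also have "\<dots> = (- t) * meanK b x + t\<^sup>2 / 2 * ?I2"
    using integrable_Kf integrable_K2f by (simp add: meanK_def)
  also have "\<dots> \<le> (- t) * (f x - A2 * b\<^sup>2) + t\<^sup>2 / 2 * (\<kappa> * f x + A1 * b)"
    using b1 b2 assms by (intro add_mono mult_left_mono mult_left_mono_neg) auto
  finally show ?thesis
    unfolding mg_def using assms by (intro mult_left_mono) auto
qed

end

section \<open>Tail bounds at a fixed point\<close>

text \<open>No change of measure is needed: bounding $e^{tS}$ by $e^{\gamma N}e^{(t-\gamma)S}$ where $S \le N$ and by
  $e^{-\gamma uN}e^{(t+\gamma)S}$ where $S > uN$ shows that the expectation of $e^{tS}$ is concentrated on $N < S \le uN$.\<close>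

lemma (in prob_space) mgf_lower_bound:
  fixes S :: "'a \<Rightarrow> real"
  assumes [measurable]: "S \<in> borel_measurable M"
    and N: "8 \<le> N * \<gamma>\<^sup>2" and \<gamma>: "0 < \<gamma>" "\<gamma> \<le> 1"
    and int: "\<And>t. integrable M (\<lambda>\<omega>. exp (t * S \<omega>))"
    and upper: "\<And>t. 1 \<le> t \<Longrightarrow> t \<le> 3 \<Longrightarrow> expectation (\<lambda>\<omega>. exp (t * S \<omega>)) \<le> exp (N * (t\<^sup>2 / 2 + \<gamma>\<^sup>2 / 8))"
    and lower: "\<And>t. 1 \<le> t \<Longrightarrow> t \<le> 3 \<Longrightarrow> exp (N * (t\<^sup>2 / 2 - \<gamma>\<^sup>2 / 8)) \<le> expectation (\<lambda>\<omega>. exp (t * S \<omega>))"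
  shows "exp (- (1 / 2 + 5 * \<gamma>) * N) \<le> prob {\<omega> \<in> space M. N < S \<omega>}"
proof -
  \<comment> \<open>The cumulant function of S is close to N t^2 / 2, so under tilting by t the mass
    of S sits near N t. This t is the middle of the window from N to u N, and t - \<gamma> = 1 and t
    + \<gamma> = u are the parameters that control the mass below and above it.\<close>
  define t where "t = 1 + \<gamma>"
  define u where "u = 1 + 2 * \<gamma>"
  define P where "P = prob {\<omega> \<in> space M. N < S \<omega>}"
  have N0: "0 < N"
  proof (rule ccontr)
    assume "\<not> 0 < N"
    then have "N * \<gamma>\<^sup>2 \<le> 0" by (simp add: mult_nonpos_nonneg)
    with N show False by simp
  qed
  have [simp]: "{\<omega> \<in> space M. N < S \<omega>} \<in> events" by measurable
  have pt: "exp (t * s) \<le> exp (\<gamma> * N) * exp (1 * s) + (if N < s then exp (t * (u * N)) else 0)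
      + exp (- \<gamma> * (u * N)) * exp (u * s)" for s :: real
  proof -
    consider "s \<le> N" | "N < s" "s \<le> u * N" | "u * N < s" by linarith
    then show ?thesis
    proof cases
      case 1
      have "t * s \<le> \<gamma> * N + 1 * s" using 1 \<gamma> by (auto simp: t_def algebra_simps)
      then have "exp (t * s) \<le> exp (\<gamma> * N) * exp (1 * s)" by (simp flip: exp_add)
      then show ?thesis by (auto intro!: add_increasing2)
    next
      case 2
      have "exp (t * s) \<le> exp (t * (u * N))" using 2 \<gamma> by (auto simp: t_def)
      moreover have "(if N < s then exp (t * (u * N)) else 0) = exp (t * (u * N))" using 2 by simp
      moreover have "0 \<le> exp (\<gamma> * N) * exp (1 * s)" "0 \<le> exp (- \<gamma> * (u * N)) * exp (u * s)" by simp_all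
      ultimately show ?thesis by linarith
    next
      case 3
      have "\<gamma> * (u * N) \<le> \<gamma> * s" using 3 \<gamma> by auto
      then have "t * s \<le> - \<gamma> * (u * N) + u * s" by (auto simp: t_def u_def algebra_simps)
      then have "exp (t * s) \<le> exp (- \<gamma> * (u * N)) * exp (u * s)" by (simp flip: exp_add)
      then show ?thesis by (auto intro!: add_increasing)
    qed
  qed
  have i1: "integrable M (\<lambda>\<omega>. if N < S \<omega> then exp (t * (u * N)) else 0)"
    by (rule integrable_const_bound[where B="exp (t * (u * N))"]) auto
  have e1: "expectation (\<lambda>\<omega>. if N < S \<omega> then exp (t * (u * N)) else 0) = exp (t * (u * N)) * P"
  proof -
    have "expectation (\<lambda>\<omega>. if N < S \<omega> then exp (t * (u * N)) else 0)
        = expectation (\<lambda>\<omega>. exp (t * (u * N)) * indicator {\<omega> \<in> space M. N < S \<omega>} \<omega>)"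
      by (intro Bochner_Integration.integral_cong) (auto simp: indicator_def)
    then show ?thesis by (simp add: P_def)
  qed
  have "expectation (\<lambda>\<omega>. exp (t * S \<omega>)) \<le> expectation (\<lambda>\<omega>. exp (\<gamma> * N) * exp (1 * S \<omega>)
      + (if N < S \<omega> then exp (t * (u * N)) else 0) + exp (- \<gamma> * (u * N)) * exp (u * S \<omega>))"
    by (intro integral_mono pt Bochner_Integration.integrable_add integrable_mult_right int i1)
  also have "\<dots> = exp (\<gamma> * N) * expectation (\<lambda>\<omega>. exp (1 * S \<omega>)) + exp (t * (u * N)) * P
      + exp (- \<gamma> * (u * N)) * expectation (\<lambda>\<omega>. exp (u * S \<omega>))"
    using i1 int int[of 1] by (simp add: e1)
  finally have 1: "expectation (\<lambda>\<omega>. exp (t * S \<omega>)) \<le> \<dots>" .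
  define A where "A = exp (N * (t\<^sup>2 / 2 - \<gamma>\<^sup>2 / 8))"
  \<comment> \<open>Moving the parameter by \<gamma> costs N \<gamma>^2 / 2 in the exponent; the two
    errors N \<gamma>^2 / 8 of the hypotheses leave half of it as the gain of each tail over the
    main term A.\<close>
  define q where "q = exp (- (N * \<gamma>\<^sup>2 / 4))"
  have "exp (\<gamma> * N) * expectation (\<lambda>\<omega>. exp (1 * S \<omega>)) \<le> exp (\<gamma> * N) * exp (N * (1\<^sup>2 / 2 + \<gamma>\<^sup>2 / 8))"
    by (intro mult_left_mono upper) auto
  also have "\<dots> = A * q"
    unfolding A_def q_def exp_add[symmetric] by (rule arg_cong[where f=exp])
      (simp add: t_def power2_eq_square field_simps)
  finally have 2: "exp (\<gamma> * N) * expectation (\<lambda>\<omega>. exp (1 * S \<omega>)) \<le> A * q" .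
  have "exp (- \<gamma> * (u * N)) * expectation (\<lambda>\<omega>. exp (u * S \<omega>)) \<le> exp (- \<gamma> * (u * N)) * exp (N * (u\<^sup>2 / 2 + \<gamma>\<^sup>2 / 8))"
    using \<gamma> by (intro mult_left_mono upper) (auto simp: u_def)
  also have "\<dots> = A * q"
    unfolding A_def q_def exp_add[symmetric] by (rule arg_cong[where f=exp])
      (simp add: t_def u_def power2_eq_square field_simps)
  finally have 3: "exp (- \<gamma> * (u * N)) * expectation (\<lambda>\<omega>. exp (u * S \<omega>)) \<le> A * q" .
  have "A \<le> expectation (\<lambda>\<omega>. exp (t * S \<omega>))"
    unfolding A_def using \<gamma> by (intro lower) (auto simp: t_def)
  with 1 2 3 have 4: "A - 2 * (A * q) \<le> exp (t * (u * N)) * P" by linarith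
  \<comment> \<open>The threshold 8 makes q at most exp(-2), hence at most 1/4, so that the two
    tails together take no more than half of A.\<close>
  have "exp (2::real) * q \<le> 1"
    unfolding q_def exp_add[symmetric] using N by simp
  moreover have "4 * q \<le> exp 2 * q"
    using exp_lower_Taylor_quadratic[of 2] by (intro mult_right_mono) (auto simp: q_def)
  ultimately have "4 * q \<le> 1" by linarith
  then have "A * (4 * q) \<le> A * 1" by (intro mult_left_mono) (auto simp: A_def)
  with 4 have 5: "A / 2 \<le> exp (t * (u * N)) * P" by simp
  have g2: "N * \<gamma>\<^sup>2 \<le> N * \<gamma>"
    using \<gamma> N0 by (simp add: power2_eq_square mult_left_le)
  have "2 \<le> exp (1::real)" using exp_ge_add_one_self[of 1] by simp
  also have "exp (1::real) \<le> exp (N * \<gamma>)" using g2 N by simp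
  finally have "exp (- (N * \<gamma>)) \<le> 1 / 2" by (simp add: exp_minus field_simps)
  then have "A * exp (- (N * \<gamma>)) \<le> A / 2"
    using mult_left_mono[of "exp (- (N * \<gamma>))" "1/2" A] by (simp add: A_def)
  with 5 have "exp (- (t * (u * N))) * (A * exp (- (N * \<gamma>))) \<le> exp (- (t * (u * N))) * (exp (t * (u * N)) * P)"
    by (intro mult_left_mono) auto
  then have "exp (- (t * (u * N))) * (A * exp (- (N * \<gamma>))) \<le> P"
    by (simp add: exp_minus field_simps)
  \<comment> \<open>The exact loss beyond N / 2 is N (3 \<gamma> + 13 \<gamma>^2 / 8), rounded up to
    5 \<gamma> N; it includes N \<gamma> for the factor 1/2.\<close>
  moreover have "- (1 / 2 + 5 * \<gamma>) * N \<le> - (t * (u * N)) + (N * (t\<^sup>2 / 2 - \<gamma>\<^sup>2 / 8) + (- (N * \<gamma>)))"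
    using g2 \<gamma> N0 by (simp add: t_def u_def power2_eq_square field_simps)
  then have "exp (- (1 / 2 + 5 * \<gamma>) * N) \<le> exp (- (t * (u * N))) * (A * exp (- (N * \<gamma>)))"
    unfolding A_def exp_add[symmetric] by simp
  ultimately show ?thesis by (simp add: P_def)
qed

context kde_model
begin

text \<open>Takes a number as bandwidth where \<open>kde\<close> takes a sequence, so that the same
  bounds serve the pilot bandwidth h, which sets the width of the band, and the bandwidth b, which
  centres it.\<close>

definition est :: "nat \<Rightarrow> real \<Rightarrow> 'a \<Rightarrow> 'b \<Rightarrow> real" where
  "est n b x \<omega> = 1 / (real n * b ^ DIM('a)) * sumK n b x \<omega>"

lemma est_pair_borel [measurable]: "(\<lambda>(\<omega>, y). est n b y \<omega>) \<in> borel_measurable (M \<Otimes>\<^sub>M lborel)"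
  unfolding est_def using sumK_pair_borel by (auto simp: case_prod_beta')

lemma est_borel [measurable]: "est n b y \<in> borel_measurable M"
  unfolding est_def[abs_def] by measurable

text \<open>Applying Markov's inequality to $e^{\theta S} - 1$ rather than to $e^{\theta S}$ gains the factor
  \<open>meanK b y\<close>, which makes the bound integrable in \<open>y\<close> over the whole space.\<close>

lemma upper_tail:
  assumes b: "0 < b" and w: "0 < w" and \<tau>: "0 < \<tau>" "f y \<le> \<tau>" and \<delta>: "0 \<le> \<delta>" "\<delta> \<le> 1"
    and wB: "w * B \<le> \<delta> * (\<kappa> * \<tau>)" and A1: "A1 * b \<le> \<delta> * (\<kappa> * \<tau>)" and A2: "A2 * b\<^sup>2 \<le> \<delta> * w"
    and big: "\<kappa> * \<tau> \<le> real n * b ^ DIM('a) * w\<^sup>2"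
  shows "prob {\<omega> \<in> space M. f y + w \<le> est n b y \<omega>} \<le>
    4 * real n / B * b ^ DIM('a) * meanK b y *
    exp (- (1 - 5 * \<delta>) * (real n * b ^ DIM('a) * w\<^sup>2 / (2 * \<kappa> * \<tau>)))"
proof -
  let ?bd = "b ^ DIM('a)"
  \<comment> \<open>The minimiser of - \<theta> w + \<theta>^2 \<kappa> \<tau> / 2, the leading part
    of the Chernoff exponent per n b^d. Having \<tau> \<ge> f y here instead of f y keeps it usable
    where f vanishes.\<close>
  define \<theta> where "\<theta> = w / (\<kappa> * \<tau>)"
  have \<kappa>\<tau>: "0 < \<kappa> * \<tau>" using kappa_pos \<tau> by simp
  have \<theta>: "0 < \<theta>" using w \<kappa>\<tau> by (simp add: \<theta>_def)
  have \<theta>B: "\<theta> * B \<le> \<delta>" using wB \<kappa>\<tau> by (simp add: \<theta>_def field_simps)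
  have \<theta>\<kappa>: "\<theta> * (\<kappa> * \<tau>) = w" using \<kappa>\<tau> by (auto simp: \<theta>_def)
  have n: "0 < n" using big \<kappa>\<tau> by (cases n) auto
  have nb: "0 < real n * ?bd" using n b by simp
  define u where "u = real n * ?bd * (f y + w)"
  define m where "m = mg \<theta> b y"
  have \<theta>1: "\<theta> * B \<le> 1" using \<theta>B \<delta> by simp
  note mgl = mg_le[OF b less_imp_le[OF \<theta>] \<theta>1, of y, folded m_def]
  have exponent: "real n * m - \<theta> * u \<le> - (1 - 5 * \<delta>) * (real n * ?bd * w\<^sup>2 / (2 * \<kappa> * \<tau>))"
  proof -
    have "\<kappa> * f y + A1 * b \<le> (1 + \<delta>) * (\<kappa> * \<tau>)"
      using A1 mult_left_mono[OF \<tau>(2) less_imp_le[OF kappa_pos]] by (simp add: algebra_simps)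
    then have "\<theta>\<^sup>2 / 2 * (1 + \<theta> * B) * (\<kappa> * f y + A1 * b) \<le> \<theta>\<^sup>2 / 2 * (1 + \<delta>) * ((1 + \<delta>) * (\<kappa> * \<tau>))"
      using \<theta>B \<theta> B_pos \<delta> kappa_pos f_nonneg b nonneg by (intro mult_mono mult_left_mono) auto
    also have "\<dots> = \<theta> * w * ((1 + \<delta>)\<^sup>2 / 2)"
      unfolding \<theta>\<kappa>[symmetric] by (simp add: power2_eq_square)
    also have "\<dots> \<le> \<theta> * w * ((1 + 3 * \<delta>) / 2)"
      using \<delta> \<theta> w mult_left_mono[of \<delta> 1 \<delta>] by (intro mult_left_mono) (auto simp: power2_eq_square algebra_simps)
    finally have q: "\<theta>\<^sup>2 / 2 * (1 + \<theta> * B) * (\<kappa> * f y + A1 * b) \<le> \<theta> * w * ((1 + 3 * \<delta>) / 2)" .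
    have "\<theta> * (f y + A2 * b\<^sup>2) \<le> \<theta> * (f y + \<delta> * w)" using A2 \<theta> by auto
    with q have "\<theta> * (f y + A2 * b\<^sup>2) + \<theta>\<^sup>2 / 2 * (1 + \<theta> * B) * (\<kappa> * f y + A1 * b)
        \<le> \<theta> * (f y + \<delta> * w) + \<theta> * w * ((1 + 3 * \<delta>) / 2)" by linarith
    then have "?bd * (\<theta> * (f y + A2 * b\<^sup>2) + \<theta>\<^sup>2 / 2 * (1 + \<theta> * B) * (\<kappa> * f y + A1 * b))
        \<le> ?bd * (\<theta> * (f y + \<delta> * w) + \<theta> * w * ((1 + 3 * \<delta>) / 2))"
      using b by (intro mult_left_mono) auto
    with mgl(1) have "m \<le> ?bd * (\<theta> * (f y + \<delta> * w) + \<theta> * w * ((1 + 3 * \<delta>) / 2))" by linarith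
    then have "real n * m \<le> real n * (?bd * (\<theta> * (f y + \<delta> * w) + \<theta> * w * ((1 + 3 * \<delta>) / 2)))"
      by (intro mult_left_mono) auto
    \<comment> \<open>The bias contributes \<delta> and the quadratic term (1 + 3 \<delta>) / 2
      against the 1 gained from the threshold, which leaves -(1 - 5 \<delta>) / 2.\<close>
    then have "real n * m - \<theta> * u \<le> - (1 - 5 * \<delta>) * (real n * ?bd * (\<theta> * w) / 2)"
      unfolding u_def by (simp add: field_simps)
    moreover have "real n * ?bd * (\<theta> * w) / 2 = real n * ?bd * w\<^sup>2 / (2 * \<kappa> * \<tau>)"
      by (simp add: \<theta>_def power2_eq_square)
    ultimately show ?thesis by simp
  qed
  \<comment> \<open>This makes exp(\<theta> u) - 1 at least half of exp(\<theta> u), so subtracting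
    1 in Markov's inequality costs only a factor 2.\<close>
  have "1 \<le> \<theta> * u"
  proof -
    have "real n * ?bd * w\<^sup>2 \<le> real n * ?bd * (w * (f y + w))"
      using nb f_nonneg[of y] w by (intro mult_left_mono) (auto simp: power2_eq_square)
    with big have "\<kappa> * \<tau> * 1 \<le> real n * ?bd * (w * (f y + w))" by simp
    then show ?thesis using \<kappa>\<tau> by (simp add: \<theta>_def u_def field_simps)
  qed
  then have "exp 1 \<le> exp (\<theta> * u)" by simp
  then have e2: "2 \<le> exp (\<theta> * u)" using exp_ge_add_one_self[of 1] by linarith
  have den: "exp (\<theta> * u) / 2 \<le> exp (\<theta> * u) - 1" "0 < exp (\<theta> * u) - 1" using e2 by linarith+
  have ev: "{\<omega> \<in> space M. f y + w \<le> est n b y \<omega>} = {\<omega> \<in> space M. exp (\<theta> * u) - 1 \<le> exp (\<theta> * sumK n b y \<omega>) - 1}"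
  proof -
    have "f y + w \<le> est n b y \<omega> \<longleftrightarrow> u \<le> sumK n b y \<omega>" for \<omega>
      using nb by (simp add: est_def u_def pos_le_divide_eq mult.commute)
    then show ?thesis using \<theta> by simp
  qed
  have "prob {\<omega> \<in> space M. f y + w \<le> est n b y \<omega>} \<le> expectation (\<lambda>\<omega>. exp (\<theta> * sumK n b y \<omega>) - 1) / (exp (\<theta> * u) - 1)"
    unfolding ev
    by (rule integral_Markov_inequality_measure[where A="space M"])
       (use \<theta> sumK_nonneg[of n b y] den in \<open>auto intro!: integrable_exp_sumK\<close>)
  also have "expectation (\<lambda>\<omega>. exp (\<theta> * sumK n b y \<omega>) - 1) = (1 + m) ^ n - 1"
    using mgf_sumK[OF b] by (simp add: integrable_exp_sumK prob_space m_def)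
  also have "((1 + m) ^ n - 1) / (exp (\<theta> * u) - 1) \<le> (real n * m * exp (real n * m)) / (exp (\<theta> * u) / 2)"
    using mgl(4) den by (intro frac_le one_plus_power_minus_one_le) auto
  also have "\<dots> = 2 * real n * m * exp (real n * m - \<theta> * u)" by (simp add: exp_diff)
  also have "\<dots> \<le> 2 * real n * m * exp (- (1 - 5 * \<delta>) * (real n * ?bd * w\<^sup>2 / (2 * \<kappa> * \<tau>)))"
    using exponent mgl(4) by (intro mult_left_mono) auto
  also have "\<dots> \<le> 4 * real n / B * ?bd * meanK b y * exp (- (1 - 5 * \<delta>) * (real n * ?bd * w\<^sup>2 / (2 * \<kappa> * \<tau>)))"
  proof (rule mult_right_mono)
    have "0 \<le> meanK b y" unfolding meanK_def by (intro Bochner_Integration.integral_nonneg mult_nonneg_nonneg K_nonneg f_nonneg)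
    have "\<theta> \<le> 1 / B" using \<theta>1 B_pos by (simp add: field_simps)
    then have "2 * \<theta> * ?bd * meanK b y \<le> 2 * (1 / B) * ?bd * meanK b y"
      using b \<open>0 \<le> meanK b y\<close> by (intro mult_right_mono mult_left_mono) auto
    with mgl(2) have "m \<le> 2 * (1 / B) * ?bd * meanK b y" by linarith
    then have "2 * real n * m \<le> 2 * real n * (2 * (1 / B) * ?bd * meanK b y)" by (intro mult_left_mono) auto
    then show "2 * real n * m \<le> 4 * real n / B * ?bd * meanK b y" by simp
  qed simp
  finally show ?thesis .
qed

text \<open>Plain Chernoff bound, with no integrable prefactor: undershoots of f by a given amount
  are possible only where f is at least that large, and the application obtains a factor f y from
  this.\<close>

lemma lower_tail:
  assumes b: "0 < b" and n: "0 < n" and w: "0 < w" and \<tau>: "0 < \<tau>" "f y \<le> \<tau>" and \<delta>: "0 \<le> \<delta>" "\<delta> \<le> 1"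
    and A1: "A1 * b \<le> \<delta> * (\<kappa> * \<tau>)" and A2: "A2 * b\<^sup>2 \<le> \<delta> * w"
  shows "prob {\<omega> \<in> space M. est n b y \<omega> \<le> f y - w} \<le>
    exp (- (1 - 5 * \<delta>) * (real n * b ^ DIM('a) * w\<^sup>2 / (2 * \<kappa> * \<tau>)))"
proof -
  let ?bd = "b ^ DIM('a)"
  define \<theta> where "\<theta> = w / (\<kappa> * \<tau>)"
  have \<kappa>\<tau>: "0 < \<kappa> * \<tau>" using kappa_pos \<tau> by simp
  have \<theta>: "0 < \<theta>" using w \<kappa>\<tau> by (simp add: \<theta>_def)
  have \<theta>\<kappa>: "\<theta> * (\<kappa> * \<tau>) = w" using \<kappa>\<tau> by (auto simp: \<theta>_def)
  have nb: "0 < real n * ?bd" using n b by simp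
  define u where "u = real n * ?bd * (f y - w)"
  define m where "m = mg (- \<theta>) b y"
  note mgl = mg_neg_le[OF b less_imp_le[OF \<theta>], of y, folded m_def]
  have exponent: "real n * m + \<theta> * u \<le> - (1 - 5 * \<delta>) * (real n * ?bd * w\<^sup>2 / (2 * \<kappa> * \<tau>))"
  proof -
    have "\<kappa> * f y + A1 * b \<le> (1 + \<delta>) * (\<kappa> * \<tau>)"
      using A1 mult_left_mono[OF \<tau>(2) less_imp_le[OF kappa_pos]] by (simp add: algebra_simps)
    then have "\<theta>\<^sup>2 / 2 * (\<kappa> * f y + A1 * b) \<le> \<theta>\<^sup>2 / 2 * ((1 + \<delta>) * (\<kappa> * \<tau>))"
      by (intro mult_left_mono) auto
    also have "\<dots> = \<theta> * w * ((1 + \<delta>) / 2)"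
      unfolding \<theta>\<kappa>[symmetric] by (simp add: power2_eq_square)
    also have "\<dots> \<le> \<theta> * w * ((1 + 3 * \<delta>) / 2)"
      using \<delta> \<theta> w by (intro mult_left_mono) auto
    finally have q: "\<theta>\<^sup>2 / 2 * (\<kappa> * f y + A1 * b) \<le> \<theta> * w * ((1 + 3 * \<delta>) / 2)" .
    have "\<theta> * (f y - \<delta> * w) \<le> \<theta> * (f y - A2 * b\<^sup>2)" using A2 \<theta> by auto
    with q have "- \<theta> * (f y - A2 * b\<^sup>2) + \<theta>\<^sup>2 / 2 * (\<kappa> * f y + A1 * b)
        \<le> - \<theta> * (f y - \<delta> * w) + \<theta> * w * ((1 + 3 * \<delta>) / 2)" by simp
    then have "?bd * (- \<theta> * (f y - A2 * b\<^sup>2) + \<theta>\<^sup>2 / 2 * (\<kappa> * f y + A1 * b))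
        \<le> ?bd * (- \<theta> * (f y - \<delta> * w) + \<theta> * w * ((1 + 3 * \<delta>) / 2))"
      using b by (intro mult_left_mono) auto
    with mgl have "m \<le> ?bd * (- \<theta> * (f y - \<delta> * w) + \<theta> * w * ((1 + 3 * \<delta>) / 2))" by linarith
    then have "real n * m \<le> real n * (?bd * (- \<theta> * (f y - \<delta> * w) + \<theta> * w * ((1 + 3 * \<delta>) / 2)))"
      by (intro mult_left_mono) auto
    then have "real n * m + \<theta> * u \<le> - (1 - 5 * \<delta>) * (real n * ?bd * (\<theta> * w) / 2)"
      unfolding u_def by (simp add: field_simps)
    moreover have "real n * ?bd * (\<theta> * w) / 2 = real n * ?bd * w\<^sup>2 / (2 * \<kappa> * \<tau>)"
      by (simp add: \<theta>_def power2_eq_square)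
    ultimately show ?thesis by simp
  qed
  have ev: "{\<omega> \<in> space M. est n b y \<omega> \<le> f y - w} = {\<omega> \<in> space M. exp (- \<theta> * u) \<le> exp (- \<theta> * sumK n b y \<omega>)}"
  proof -
    have "est n b y \<omega> \<le> f y - w \<longleftrightarrow> sumK n b y \<omega> \<le> u" for \<omega>
      using nb by (simp add: est_def u_def pos_divide_le_eq mult.commute)
    then show ?thesis using \<theta> by simp
  qed
  have "integrable M (\<lambda>\<omega>. exp (- \<theta> * sumK n b y \<omega>))" by (rule integrable_exp_sumK)
  then have "prob {\<omega> \<in> space M. est n b y \<omega> \<le> f y - w} \<le> expectation (\<lambda>\<omega>. exp (- \<theta> * sumK n b y \<omega>)) / exp (- \<theta> * u)"
    unfolding ev
    by (rule integral_Markov_inequality_measure[where A="space M"]) (use integrable_exp_sumK in auto)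
  also have "expectation (\<lambda>\<omega>. exp (- \<theta> * sumK n b y \<omega>)) = (1 + m) ^ n"
    unfolding m_def by (rule mgf_sumK[OF b])
  also have "(1 + m) ^ n / exp (- \<theta> * u) \<le> exp (real n * m) / exp (- \<theta> * u)"
  proof (rule divide_right_mono)
    \<comment> \<open>Here m may be negative, so monotonicity of the power needs 1 + m \<ge> 0. The
      formula for the sum with a single summand exhibits 1 + m as the mean of a positive
      variable.\<close>
    have "0 \<le> expectation (\<lambda>\<omega>. exp (- \<theta> * sumK 1 b y \<omega>))" by (intro Bochner_Integration.integral_nonneg) auto
    also have "\<dots> = 1 + m" using mgf_sumK[OF b, of "- \<theta>" 1] by (simp add: m_def)
    finally show "(1 + m) ^ n \<le> exp (real n * m)"
      unfolding exp_of_nat_mult by (intro power_mono) auto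
  qed simp
  also have "\<dots> = exp (real n * m + \<theta> * u)" by (simp add: exp_add exp_minus field_simps)
  also have "\<dots> \<le> exp (- (1 - 5 * \<delta>) * (real n * ?bd * w\<^sup>2 / (2 * \<kappa> * \<tau>)))"
    using exponent by simp
  finally show ?thesis .
qed

section \<open>Densities in the point, averaging over balls, and the pointwise lower bound\<close>

lemma meanK_nonneg: "0 \<le> meanK b y"
  unfolding meanK_def by (intro Bochner_Integration.integral_nonneg mult_nonneg_nonneg K_nonneg f_nonneg)

lemma meanK_le: "meanK b y \<le> F"
proof -
  have "meanK b y \<le> (LINT z|lborel. F * K z)"
    unfolding meanK_def
  proof (rule integral_mono[OF integrable_Kf])
    show "K z * f (y - b *\<^sub>R z) \<le> F * K z" for z
      using mult_left_mono[OF f_le K_nonneg] by (simp add: mult.commute)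
  qed (use K_int in auto)
  then show ?thesis using K_one by simp
qed

lemma nn_integral_f: "(\<integral>\<^sup>+x. f x \<partial>lborel) = 1"
  using distributed_nn_integral[OF distr[of 1], of "\<lambda>_. 1"] by (simp add: emeasure_space_1)

text \<open>\<open>meanK b\<close> is the density of X + b Z, where Z has density K and is
  independent of X.\<close>

lemma nn_integral_meanK: "(\<integral>\<^sup>+y. meanK b y \<partial>lborel) = 1"
proof -
  have "(\<integral>\<^sup>+y. meanK b y \<partial>lborel) = (\<integral>\<^sup>+y. \<integral>\<^sup>+z. K z * f (y - b *\<^sub>R z) \<partial>lborel \<partial>lborel)"
  proof (rule nn_integral_cong)
    show "ennreal (meanK b y) = (\<integral>\<^sup>+z. K z * f (y - b *\<^sub>R z) \<partial>lborel)" for y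
      unfolding meanK_def
      by (subst nn_integral_eq_integral) (auto intro!: integrable_Kf simp: K_nonneg f_nonneg)
  qed
  also have "\<dots> = (\<integral>\<^sup>+z. \<integral>\<^sup>+y. K z * f (y - b *\<^sub>R z) \<partial>lborel \<partial>lborel)"
    by (rule lborel_pair.Fubini') measurable
  also have "\<dots> = (\<integral>\<^sup>+z. K z * (\<integral>\<^sup>+y. f (y - b *\<^sub>R z) \<partial>lborel) \<partial>lborel)"
    by (simp add: ennreal_mult' K_nonneg f_nonneg nn_integral_cmult)
  also have "\<dots> = (\<integral>\<^sup>+z. K z * (\<integral>\<^sup>+y. f y \<partial>lborel) \<partial>lborel)"
  proof (rule nn_integral_cong, rule arg_cong2[where f="(*)", OF refl])
    fix z :: 'a
    have "(\<integral>\<^sup>+y. f y \<partial>lborel) = (\<integral>\<^sup>+y. f y \<partial>distr lborel borel ((+) (- (b *\<^sub>R z))))"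
      by (simp add: lborel_distr_plus)
    also have "\<dots> = (\<integral>\<^sup>+y. f (y - b *\<^sub>R z) \<partial>lborel)"
      by (subst nn_integral_distr) auto
    finally show "(\<integral>\<^sup>+y. f (y - b *\<^sub>R z) \<partial>lborel) = (\<integral>\<^sup>+y. f y \<partial>lborel)" by simp
  qed
  also have "\<dots> = 1"
    using nn_integral_eq_integral[OF K_int] K_nonneg K_one by (simp add: nn_integral_f)
  finally show ?thesis .
qed

lemma meanK_borel [measurable]: "meanK b \<in> borel_measurable borel"
  unfolding meanK_def[abs_def] by measurable

text \<open>If a bad event at a point forces a bad event on a whole ball around it, then averaging over
  the ball replaces a union bound over a grid, also on unbounded sets.\<close>

lemma ball_averaging:
  assumes E: "E \<in> events" and S: "S \<in> sets (M \<Otimes>\<^sub>M lborel)" and \<eta>: "0 < \<eta>"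
    and ball: "\<And>\<omega>. \<omega> \<in> E \<Longrightarrow> \<exists>x. \<forall>y\<in>ball x \<eta>. (\<omega>, y) \<in> S"
    and le: "\<And>y. ennreal (prob {\<omega> \<in> space M. (\<omega>, y) \<in> S}) \<le> g y"
  shows "ennreal (unit_ball_vol (real DIM('a)) * \<eta> ^ DIM('a)) * ennreal (prob E) \<le> (\<integral>\<^sup>+y. g y \<partial>(lborel :: 'a measure))"
proof -
  let ?v = "ennreal (unit_ball_vol (real DIM('a)) * \<eta> ^ DIM('a))"
  interpret pair_sigma_finite M "lborel :: 'a measure" ..
  have "?v * ennreal (prob E) = (\<integral>\<^sup>+\<omega>. ?v * indicator E \<omega> \<partial>M)"
    using E by (simp add: nn_integral_cmult_indicator emeasure_eq_measure)
  also have "\<dots> \<le> (\<integral>\<^sup>+\<omega>. emeasure lborel (Pair \<omega> -` S) \<partial>M)"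
  proof (intro nn_integral_mono)
    fix \<omega>
    show "?v * indicator E \<omega> \<le> emeasure lborel (Pair \<omega> -` S)"
    proof (cases "\<omega> \<in> E")
      case True
      then obtain x where x: "\<And>y. y \<in> ball x \<eta> \<Longrightarrow> (\<omega>, y) \<in> S" using ball by blast
      have "?v = emeasure lborel (ball x \<eta>)" using \<eta> by (simp add: emeasure_ball)
      also have "\<dots> \<le> emeasure lborel (Pair \<omega> -` S)"
        using x sets_Pair1[OF S] by (intro emeasure_mono) auto
      finally show ?thesis using True by simp
    qed simp
  qed
  also have "\<dots> = emeasure (M \<Otimes>\<^sub>M lborel) S"
    using S by (rule lborel.emeasure_pair_measure_alt[symmetric])
  also have "\<dots> = (\<integral>\<^sup>+y. emeasure M ((\<lambda>\<omega>. (\<omega>, y)) -` S) \<partial>lborel)"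
    using S by (rule emeasure_pair_measure_alt2)
  also have "\<dots> \<le> (\<integral>\<^sup>+y. g y \<partial>lborel)"
  proof (intro nn_integral_mono)
    fix y :: 'a
    have "(\<lambda>\<omega>. (\<omega>, y)) -` S = {\<omega> \<in> space M. (\<omega>, y) \<in> S}"
      using sets.sets_into_space[OF S] by (auto simp: space_pair_measure)
    then show "emeasure M ((\<lambda>\<omega>. (\<omega>, y)) -` S) \<le> g y"
      using le[of y] by (simp add: emeasure_eq_measure)
  qed
  finally show ?thesis .
qed

lemma est_holder:
  assumes "0 < b" "0 < n"
  shows "\<bar>est n b x \<omega> - est n b y \<omega>\<bar> \<le> L / b ^ DIM('a) * (dist x y / b) powr \<alpha>"
proof -
  have "\<bar>sumK n b x \<omega> - sumK n b y \<omega>\<bar> \<le> (\<Sum>j=1..n. \<bar>K ((x - X j \<omega>) /\<^sub>R b) - K ((y - X j \<omega>) /\<^sub>R b)\<bar>)"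
    unfolding sumK_def sum_subtractf[symmetric] by (rule sum_abs)
  also have "\<dots> \<le> (\<Sum>j=1..n. L * (dist x y / b) powr \<alpha>)"
  proof (intro sum_mono)
    fix j
    have "dist ((x - X j \<omega>) /\<^sub>R b) ((y - X j \<omega>) /\<^sub>R b) = dist x y / b"
      using assms by (simp add: dist_norm scaleR_diff_right[symmetric] divide_inverse mult.commute)
    with K_holder[of "(x - X j \<omega>) /\<^sub>R b" "(y - X j \<omega>) /\<^sub>R b"]
    show "\<bar>K ((x - X j \<omega>) /\<^sub>R b) - K ((y - X j \<omega>) /\<^sub>R b)\<bar> \<le> L * (dist x y / b) powr \<alpha>" by simp
  qed
  finally have "\<bar>sumK n b x \<omega> - sumK n b y \<omega>\<bar> \<le> real n * (L * (dist x y / b) powr \<alpha>)" by simp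
  moreover have "\<bar>est n b x \<omega> - est n b y \<omega>\<bar> = \<bar>sumK n b x \<omega> - sumK n b y \<omega>\<bar> / (real n * b ^ DIM('a))"
    using assms by (simp add: est_def diff_divide_distrib[symmetric])
  ultimately have "\<bar>est n b x \<omega> - est n b y \<omega>\<bar> \<le> real n * (L * (dist x y / b) powr \<alpha>) / (real n * b ^ DIM('a))"
    using assms by (simp only:) (intro divide_right_mono, auto)
  then show ?thesis using assms by simp
qed

text \<open>An instance of \<open>mgf_lower_bound\<close> for the centred and rescaled sum. Its
  parameters t range over [1, 3], whence the factor 3 in the condition on w B. The conditions on b^d
  make (1 + m)^n and exp(n m) agree up to exp(N \<delta>), with m the value of \<open>mg\<close> and
  N the normalised threshold.\<close>

lemma est_lower_bound:
  assumes b: "0 < b" and w: "0 < w" and f0: "0 < f x" and \<gamma>: "0 < \<gamma>" "\<gamma> \<le> 1"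
    and \<delta>: "\<delta> = \<gamma>\<^sup>2 / 136"
    and wB: "3 * w * B \<le> \<delta> * (\<kappa> * f x)" and A1: "A1 * b \<le> \<delta> * (\<kappa> * f x)" and A2: "A2 * b\<^sup>2 \<le> \<delta> * w"
    and bd: "36 * F\<^sup>2 * b ^ DIM('a) \<le> \<delta> * (\<kappa> * f x)" "6 * w * F * b ^ DIM('a) \<le> \<kappa> * f x"
    and big: "8 \<le> real n * b ^ DIM('a) * w\<^sup>2 / (\<kappa> * f x) * \<gamma>\<^sup>2"
  shows "exp (- (1 / 2 + 5 * \<gamma>) * (real n * b ^ DIM('a) * w\<^sup>2 / (\<kappa> * f x)))
    \<le> prob {\<omega> \<in> space M. f x + w < est n b x \<omega>}"
proof -
  let ?bd = "b ^ DIM('a)"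
  define N where "N = real n * ?bd * w\<^sup>2 / (\<kappa> * f x)"
  define \<theta> where "\<theta> = w / (\<kappa> * f x)"
  \<comment> \<open>This scaling turns the event into N < S and the cumulant function into N t^2 / 2
    up to the errors bounded below.\<close>
  define S where "S \<omega> = \<theta> * (sumK n b x \<omega> - real n * ?bd * f x)" for \<omega>
  have \<kappa>f: "0 < \<kappa> * f x" using kappa_pos f0 by simp
  have \<theta>: "0 < \<theta>" using w \<kappa>f by (simp add: \<theta>_def)
  have \<theta>\<kappa>: "\<theta> * (\<kappa> * f x) = w" using \<kappa>f by (auto simp: \<theta>_def)
  have N: "N = real n * ?bd * (\<theta> * w)" by (simp add: N_def \<theta>_def power2_eq_square)
  have n: "0 < n" using big by (cases n) auto
  have nb: "0 < real n * ?bd" using n b by simp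
  have N0: "0 < N" using nb w \<theta> by (simp add: N)
  have \<delta>01: "0 \<le> \<delta>" "\<delta> \<le> 1" unfolding \<delta> using \<gamma> power_le_one[of \<gamma> 2] by auto
  have eS: "expectation (\<lambda>\<omega>. exp (t * S \<omega>)) = (1 + mg (t * \<theta>) b x) ^ n * exp (- (t * \<theta> * (real n * ?bd * f x)))" for t
  proof -
    have "exp (t * S \<omega>) = exp (- (t * \<theta> * (real n * ?bd * f x))) * exp ((t * \<theta>) * sumK n b x \<omega>)" for \<omega>
      unfolding exp_add[symmetric] by (simp add: S_def algebra_simps)
    then show ?thesis using mgf_sumK[OF b] by simp
  qed
  have ev: "{\<omega> \<in> space M. f x + w < est n b x \<omega>} = {\<omega> \<in> space M. N < S \<omega>}"
  proof -
    have "f x + w < est n b x \<omega> \<longleftrightarrow> real n * ?bd * w < sumK n b x \<omega> - real n * ?bd * f x" for \<omega>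
      using nb by (simp add: est_def field_simps)
    also have "\<dots> \<omega> \<longleftrightarrow> N < S \<omega>" for \<omega>
      using mult_less_cancel_left_pos[OF \<theta>, of "real n * ?bd * w" "sumK n b x \<omega> - real n * ?bd * f x"]
      by (simp add: S_def N mult_ac)
    finally show ?thesis by auto
  qed
  {
    fix t :: real assume t: "1 \<le> t" "t \<le> 3"
    let ?m = "mg (t * \<theta>) b x"
    have t2: "t\<^sup>2 \<le> 9" using power_mono[OF t(2), of 2] t by simp
    have t\<theta>: "0 \<le> t * \<theta>" using t \<theta> by simp
    have "t * (\<theta> * B) \<le> 3 * (\<theta> * B)" using t \<theta> B_pos by (intro mult_right_mono) auto
    also have "\<dots> \<le> \<delta>" using wB \<kappa>f by (simp add: \<theta>_def field_simps)
    finally have t\<theta>B: "t * \<theta> * B \<le> \<delta>" by simp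
    then have t\<theta>1: "t * \<theta> * B \<le> 1" using \<delta>01 by simp
    note mgl = mg_le[OF b t\<theta> t\<theta>1, of x]
    have "\<kappa> * f x + A1 * b \<le> (1 + \<delta>) * (\<kappa> * f x)" using A1 by (simp add: algebra_simps)
    then have "(t * \<theta>)\<^sup>2 / 2 * (1 + t * \<theta> * B) * (\<kappa> * f x + A1 * b) \<le> (t * \<theta>)\<^sup>2 / 2 * (1 + \<delta>) * ((1 + \<delta>) * (\<kappa> * f x))"
      using t\<theta>B t\<theta> B_pos \<delta>01 kappa_pos f_nonneg b nonneg by (intro mult_mono mult_left_mono) auto
    also have "\<dots> = \<theta> * w * (t\<^sup>2 / 2 * (1 + \<delta>)\<^sup>2)"
      unfolding \<theta>\<kappa>[symmetric] by (simp add: power2_eq_square)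
    also have "\<dots> \<le> \<theta> * w * (t\<^sup>2 / 2 * (1 + 3 * \<delta>))"
      using \<delta>01 \<theta> w mult_left_mono[of \<delta> 1 \<delta>] by (intro mult_left_mono) (auto simp: power2_eq_square algebra_simps)
    \<comment> \<open>With t^2 \<le> 9 the term is 27 \<delta> / 2, rounded up to 14 \<delta>. The
      bias adds 3 \<delta>, and 17 \<delta> = \<gamma>^2 / 8 explains the constant 136 = 8 *
      17.\<close>
    also have "\<dots> \<le> \<theta> * w * (t\<^sup>2 / 2 + 14 * \<delta>)"
      using mult_right_mono[OF t2 \<delta>01(1)] \<delta>01 \<theta> w by (intro mult_left_mono) (auto simp: field_simps)
    finally have q: "(t * \<theta>)\<^sup>2 / 2 * (1 + t * \<theta> * B) * (\<kappa> * f x + A1 * b) \<le> \<theta> * w * (t\<^sup>2 / 2 + 14 * \<delta>)" .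
    have A2': "t * \<theta> * (A2 * b\<^sup>2) \<le> 3 * \<theta> * (\<delta> * w)"
      using mult_mono[OF mult_right_mono[OF t(2), of \<theta>] A2] t \<theta> nonneg by simp
    have "?m \<le> ?bd * (t * \<theta> * f x + \<theta> * w * (t\<^sup>2 / 2 + 17 * \<delta>))"
    proof (rule order_trans[OF mgl(1)], rule mult_left_mono)
      show "t * \<theta> * (f x + A2 * b\<^sup>2) + (t * \<theta>)\<^sup>2 / 2 * (1 + t * \<theta> * B) * (\<kappa> * f x + A1 * b)
          \<le> t * \<theta> * f x + \<theta> * w * (t\<^sup>2 / 2 + 17 * \<delta>)"
      proof -
        have "t * \<theta> * (f x + A2 * b\<^sup>2) = t * \<theta> * f x + t * \<theta> * (A2 * b\<^sup>2)"
          "\<theta> * w * (t\<^sup>2 / 2 + 17 * \<delta>) = \<theta> * w * (t\<^sup>2 / 2 + 14 * \<delta>) + 3 * \<theta> * (\<delta> * w)"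
          by (simp_all add: algebra_simps)
        with q A2' show ?thesis by linarith
      qed
    qed (use b in auto)
    then have "real n * ?m \<le> real n * (?bd * (t * \<theta> * f x + \<theta> * w * (t\<^sup>2 / 2 + 17 * \<delta>)))"
      by (intro mult_left_mono) auto
    also have "\<dots> = t * \<theta> * (real n * ?bd * f x) + N * (t\<^sup>2 / 2 + 17 * \<delta>)"
      by (simp add: N algebra_simps)
    finally have up: "real n * ?m - t * \<theta> * (real n * ?bd * f x) \<le> N * (t\<^sup>2 / 2 + \<gamma>\<^sup>2 / 8)"
      by (simp add: \<delta>)
    have m0: "0 \<le> ?m" by (rule mgl(4))
    have "(1 + ?m) ^ n \<le> exp (real n * ?m)"
      unfolding exp_of_nat_mult using m0 by (intro power_mono) auto
    then have "expectation (\<lambda>\<omega>. exp (t * S \<omega>)) \<le> exp (real n * ?m) * exp (- (t * \<theta> * (real n * ?bd * f x)))"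
      unfolding eS by (intro mult_right_mono) auto
    also have "\<dots> \<le> exp (N * (t\<^sup>2 / 2 + \<gamma>\<^sup>2 / 8))"
      unfolding exp_add[symmetric] using up by simp
    finally have U: "expectation (\<lambda>\<omega>. exp (t * S \<omega>)) \<le> exp (N * (t\<^sup>2 / 2 + \<gamma>\<^sup>2 / 8))" .
    have "(t * \<theta>)\<^sup>2 / 2 * (\<kappa> * f x - A1 * b) \<ge> (t * \<theta>)\<^sup>2 / 2 * ((1 - \<delta>) * (\<kappa> * f x))"
      using A1 by (intro mult_left_mono) (auto simp: algebra_simps)
    moreover have "(t * \<theta>)\<^sup>2 / 2 * ((1 - \<delta>) * (\<kappa> * f x)) = \<theta> * w * (t\<^sup>2 / 2 * (1 - \<delta>))"
      unfolding \<theta>\<kappa>[symmetric] by (simp add: power2_eq_square)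
    moreover have "\<theta> * w * (t\<^sup>2 / 2 * (1 - \<delta>)) \<ge> \<theta> * w * (t\<^sup>2 / 2 - 5 * \<delta>)"
      using mult_right_mono[OF t2 \<delta>01(1)] \<delta>01 \<theta> w by (intro mult_left_mono) (auto simp: field_simps)
    ultimately have q2: "\<theta> * w * (t\<^sup>2 / 2 - 5 * \<delta>) \<le> (t * \<theta>)\<^sup>2 / 2 * (\<kappa> * f x - A1 * b)" by linarith
    have "?bd * (t * \<theta> * f x + \<theta> * w * (t\<^sup>2 / 2 - 8 * \<delta>)) \<le> ?m"
    proof (rule order_trans[OF _ mgl(3)], rule mult_left_mono)
      show "t * \<theta> * f x + \<theta> * w * (t\<^sup>2 / 2 - 8 * \<delta>)
          \<le> t * \<theta> * (f x - A2 * b\<^sup>2) + (t * \<theta>)\<^sup>2 / 2 * (\<kappa> * f x - A1 * b)"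
      proof -
        have "t * \<theta> * (f x - A2 * b\<^sup>2) = t * \<theta> * f x - t * \<theta> * (A2 * b\<^sup>2)"
          "\<theta> * w * (t\<^sup>2 / 2 - 8 * \<delta>) = \<theta> * w * (t\<^sup>2 / 2 - 5 * \<delta>) - 3 * \<theta> * (\<delta> * w)"
          by (simp_all add: algebra_simps)
        with q2 A2' show ?thesis by linarith
      qed
    qed (use b in auto)
    then have "real n * (?bd * (t * \<theta> * f x + \<theta> * w * (t\<^sup>2 / 2 - 8 * \<delta>))) \<le> real n * ?m"
      by (intro mult_left_mono) auto
    then have lo1: "t * \<theta> * (real n * ?bd * f x) + N * (t\<^sup>2 / 2 - 8 * \<delta>) \<le> real n * ?m"
      by (simp add: N algebra_simps)
    have F0: "0 \<le> F" using f_nonneg f_le order_trans by blast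
    have "?m \<le> 2 * (t * \<theta>) * ?bd * meanK b x" by (rule mgl(2))
    also have "\<dots> \<le> 2 * (3 * \<theta>) * ?bd * F"
      using t \<theta> b F0 by (intro mult_mono meanK_le meanK_nonneg) auto
    finally have m6: "?m \<le> 6 * \<theta> * ?bd * F" by simp
    also have "6 * \<theta> * ?bd * F \<le> 1" using bd(2) \<kappa>f by (simp add: \<theta>_def field_simps)
    finally have m1: "?m \<le> 1" .
    have "real n * ?m\<^sup>2 \<le> real n * (6 * \<theta> * ?bd * F)\<^sup>2"
      using m6 m0 by (intro mult_left_mono power_mono) auto
    also have "\<dots> = real n * ?bd * \<theta>\<^sup>2 * (36 * F\<^sup>2 * ?bd)" by (simp add: power2_eq_square)
    also have "\<dots> \<le> real n * ?bd * \<theta>\<^sup>2 * (\<delta> * (\<kappa> * f x))"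
      using bd(1) b by (intro mult_left_mono) auto
    also have "\<dots> = N * \<delta>" unfolding N \<theta>\<kappa>[symmetric] by (simp add: power2_eq_square)
    finally have nm2: "real n * ?m\<^sup>2 \<le> N * \<delta>" .
    \<comment> \<open>The power (1 + m)^n has to be bounded from below here. The loss n m^2 is at
      most N \<delta>, so the lower estimate loses 5 + 3 + 1 = 9 times \<delta>, still within
      \<gamma>^2 / 8.\<close>
    have "ln (1 + ?m) \<ge> ?m - ?m\<^sup>2" using m0 m1 by (rule ln_one_plus_pos_lower_bound)
    then have "real n * (?m - ?m\<^sup>2) \<le> real n * ln (1 + ?m)" by (intro mult_left_mono) auto
    then have "exp (real n * (?m - ?m\<^sup>2)) \<le> exp (real n * ln (1 + ?m))" by simp
    also have "\<dots> = (1 + ?m) ^ n" using m0 by (simp add: exp_of_nat_mult)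
    finally have "exp (real n * (?m - ?m\<^sup>2)) * exp (- (t * \<theta> * (real n * ?bd * f x))) \<le> expectation (\<lambda>\<omega>. exp (t * S \<omega>))"
      unfolding eS by (intro mult_right_mono) auto
    moreover have "exp (N * (t\<^sup>2 / 2 - \<gamma>\<^sup>2 / 8)) \<le> exp (real n * (?m - ?m\<^sup>2)) * exp (- (t * \<theta> * (real n * ?bd * f x)))"
    proof -
      have "9 * \<delta> \<le> \<gamma>\<^sup>2 / 8" by (simp add: \<delta>)
      then have "N * (9 * \<delta>) \<le> N * (\<gamma>\<^sup>2 / 8)" using N0 by (intro mult_left_mono) auto
      then show ?thesis
        unfolding exp_add[symmetric] using lo1 nm2 by (simp add: algebra_simps)
    qed
    ultimately have Lo: "exp (N * (t\<^sup>2 / 2 - \<gamma>\<^sup>2 / 8)) \<le> expectation (\<lambda>\<omega>. exp (t * S \<omega>))" by linarith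
    note U Lo
  } note UL = this
  have "exp (- (1 / 2 + 5 * \<gamma>) * N) \<le> prob {\<omega> \<in> space M. N < S \<omega>}"
  proof (rule mgf_lower_bound[OF _ _ \<gamma>])
    show "integrable M (\<lambda>\<omega>. exp (t * S \<omega>))" for t
    proof -
      have "exp (t * S \<omega>) = exp (- (t * \<theta> * (real n * ?bd * f x))) * exp ((t * \<theta>) * sumK n b x \<omega>)" for \<omega>
        unfolding exp_add[symmetric] by (simp add: S_def algebra_simps)
      then show ?thesis by (simp add: integrable_exp_sumK)
    qed
  qed (use UL big in \<open>auto simp: N_def S_def[abs_def]\<close>)
  then show ?thesis unfolding ev by (simp add: N_def)
qed

end

section \<open>Deviation bounds uniform in the point\<close>

text \<open>An open condition that holds somewhere on C holds on a countable dense subset of C,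
  which turns the union over C into a countable one. The strict inequality in a failure of the band
  provides the openness.\<close>

lemma sets_Collect_bex_open:
  fixes C :: "'c::euclidean_space set"
  assumes op: "\<And>\<omega>. \<omega> \<in> space M \<Longrightarrow> open {x. P \<omega> x}"
    and meas: "\<And>x. x \<in> C \<Longrightarrow> {\<omega> \<in> space M. P \<omega> x} \<in> sets M"
  shows "{\<omega> \<in> space M. \<exists>x\<in>C. P \<omega> x} \<in> sets M"
proof -
  obtain D where D: "countable D" "D \<subseteq> C" "C \<subseteq> closure D" by (rule separable)
  have "(\<exists>x\<in>C. P \<omega> x) \<longleftrightarrow> (\<exists>x\<in>D. P \<omega> x)" if "\<omega> \<in> space M" for \<omega>
  proof
    assume "\<exists>x\<in>C. P \<omega> x"
    then have "{x. P \<omega> x} \<inter> closure D \<noteq> {}" using D by blast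
    then have "{x. P \<omega> x} \<inter> D \<noteq> {}" using open_Int_closure_eq_empty[OF op[OF that]] by blast
    then show "\<exists>x\<in>D. P \<omega> x" by blast
  qed (use D in blast)
  then have "{\<omega> \<in> space M. \<exists>x\<in>C. P \<omega> x} = (\<Union>x\<in>D. {\<omega> \<in> space M. P \<omega> x})" by blast
  also have "\<dots> \<in> sets M" using D meas by (intro sets.countable_UN') auto
  finally show ?thesis .
qed

context kde_model
begin

section \<open>Measurability of the failure event\<close>

lemma est_le: "0 < b \<Longrightarrow> 0 < n \<Longrightarrow> est n b x \<omega> \<le> B / b ^ DIM('a)"
proof -
  assume "0 < b" "0 < n"
  then have "1 / (real n * b ^ DIM('a)) * sumK n b x \<omega> \<le> 1 / (real n * b ^ DIM('a)) * (real n * B)"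
    by (intro mult_left_mono sumK_le) auto
  then show ?thesis using \<open>0 < n\<close> by (simp add: est_def)
qed

lemma est_nonneg: "0 < b \<Longrightarrow> 0 \<le> est n b x \<omega>"
  using sumK_nonneg by (simp add: est_def)

lemma est_bdd_above: "0 < b \<Longrightarrow> 0 < n \<Longrightarrow> bdd_above ((\<lambda>y. est n b y \<omega>) ` C)"
  by (rule bdd_aboveI2) (rule est_le)

lemma continuous_est: "continuous_on UNIV (\<lambda>x. est n b x \<omega>)"
  unfolding est_def sumK_def
  by (intro continuous_intros continuous_on_compose2[OF continuous_K]) auto

lemma SUP_est_borel [measurable]:
  assumes "0 < b" "0 < n" "C \<noteq> {}"
  shows "(\<lambda>\<omega>. SUP y\<in>C. est n b y \<omega>) \<in> borel_measurable M"
proof (rule borel_measurableI_greater)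
  fix c
  have "{\<omega> \<in> space M. c < (SUP y\<in>C. est n b y \<omega>)} = {\<omega> \<in> space M. \<exists>y\<in>C. c < est n b y \<omega>}"
    using less_cSUP_iff[OF assms(3) est_bdd_above[OF assms(1,2)]] by simp
  also have "\<dots> \<in> events"
    by (intro sets_Collect_bex_open open_Collect_less continuous_on_const continuous_est) simp
  finally show "{\<omega> \<in> space M. c < (SUP y\<in>C. est n b y \<omega>)} \<in> events" .
qed

definition trunc :: "nat \<Rightarrow> real \<Rightarrow> real \<Rightarrow> 'a set \<Rightarrow> 'b \<Rightarrow> 'a \<Rightarrow> real" where
  "trunc n h \<epsilon> C \<omega> x = max (est n h x \<omega>) (\<epsilon> * (SUP y\<in>C. est n h y \<omega>))"

text \<open>The event that the band fails, with \<rho> collecting the deterministic factors of the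
  half-width. The inequality is strict because the intervals of the band are closed.\<close>

definition miss :: "nat \<Rightarrow> real \<Rightarrow> real \<Rightarrow> real \<Rightarrow> real \<Rightarrow> 'a set \<Rightarrow> 'b set" where
  "miss n h b \<epsilon> \<rho> C =
    {\<omega> \<in> space M. \<exists>x\<in>C. \<rho> * sqrt (trunc n h \<epsilon> C \<omega> x) < \<bar>est n b x \<omega> - f x\<bar>}"

lemma miss_sets [measurable]:
  assumes "0 < h" "0 < n" "C \<noteq> {}"
  shows "miss n h b \<epsilon> \<rho> C \<in> events"
  unfolding miss_def
proof (rule sets_Collect_bex_open)
  show "open {x. \<rho> * sqrt (trunc n h \<epsilon> C \<omega> x) < \<bar>est n b x \<omega> - f x\<bar>}" for \<omega>
    unfolding trunc_def
    by (intro open_Collect_less continuous_intros continuous_est continuous_f)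
  show "{\<omega> \<in> space M. \<rho> * sqrt (trunc n h \<epsilon> C \<omega> x) < \<bar>est n b x \<omega> - f x\<bar>} \<in> events" for x
    using assms unfolding trunc_def by measurable
qed

lemma est_near:
  assumes "0 < b" "0 < n" "dist x y \<le> \<eta>"
  shows "\<bar>est n b x \<omega> - est n b y \<omega>\<bar> \<le> L / b ^ DIM('a) * (\<eta> / b) powr \<alpha>"
proof -
  have "(dist x y / b) powr \<alpha> \<le> (\<eta> / b) powr \<alpha>"
    using assms alpha_pos by (intro powr_mono2) (auto simp: divide_right_mono)
  then have "L / b ^ DIM('a) * (dist x y / b) powr \<alpha> \<le> L / b ^ DIM('a) * (\<eta> / b) powr \<alpha>"
    using assms nonneg by (intro mult_left_mono) auto
  with est_holder[OF assms(1,2), of x \<omega> y] show ?thesis by linarith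
qed

lemma nn_integral_density_combination:
  assumes "\<And>y. 0 \<le> g1 y" "\<And>y. 0 \<le> g2 y" "g1 \<in> borel_measurable lborel" "g2 \<in> borel_measurable lborel"
    and "(\<integral>\<^sup>+y. ennreal (g1 y) \<partial>(lborel::'a measure)) = 1" "(\<integral>\<^sup>+y. ennreal (g2 y) \<partial>(lborel::'a measure)) = 1"
    and "0 \<le> c1" "0 \<le> c2"
  shows "(\<integral>\<^sup>+y. ennreal (c1 * g1 y + c2 * g2 y) \<partial>(lborel::'a measure)) = ennreal (c1 + c2)"
proof -
  have "(\<integral>\<^sup>+y. ennreal (c1 * g1 y + c2 * g2 y) \<partial>(lborel::'a measure)) =
      (\<integral>\<^sup>+y. ennreal c1 * ennreal (g1 y) + ennreal c2 * ennreal (g2 y) \<partial>lborel)"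
    using assms by (simp add: ennreal_mult)
  also have "\<dots> = ennreal c1 * 1 + ennreal c2 * 1"
    using assms by (subst nn_integral_add) (auto simp: nn_integral_cmult)
  finally show ?thesis using assms by simp
qed

text \<open>Both \<open>meanK b\<close> and f integrate to 1 over the whole space, so the pointwise
  bound integrates to c1 + c2 whatever C is.\<close>

lemma ball_averaging_mean:
  assumes E: "E \<in> events" and S: "S \<in> sets (M \<Otimes>\<^sub>M lborel)" and \<eta>: "0 < \<eta>"
    and ball: "\<And>\<omega>. \<omega> \<in> E \<Longrightarrow> \<exists>x. \<forall>y\<in>ball x \<eta>. (\<omega>, y) \<in> S"
    and le: "\<And>y. prob {\<omega> \<in> space M. (\<omega>, y) \<in> S} \<le> c1 * meanK b y + c2 * f y"
    and c: "0 \<le> c1" "0 \<le> c2"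
  shows "prob E \<le> (c1 + c2) / (unit_ball_vol (real DIM('a)) * \<eta> ^ DIM('a))"
proof -
  let ?v = "unit_ball_vol (real DIM('a)) * \<eta> ^ DIM('a)"
  have v: "0 < ?v" using \<eta> by simp
  have "ennreal (?v * prob E) \<le> (\<integral>\<^sup>+y. ennreal (c1 * meanK b y + c2 * f y) \<partial>(lborel::'a measure))"
    unfolding ennreal_mult[OF less_imp_le[OF v] measure_nonneg]
    by (rule ball_averaging[OF E S \<eta> ball]) (auto intro!: ennreal_leI le)
  also have "\<dots> = ennreal (c1 + c2)"
    using c by (intro nn_integral_density_combination meanK_nonneg f_nonneg nn_integral_meanK nn_integral_f) auto
  finally have "?v * prob E \<le> c1 + c2" using c by (simp del: ennreal_plus)
  then show ?thesis using v by (simp add: field_simps)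
qed

text \<open>At a missed point either the band is too narrow, because the pilot estimate with
  bandwidth h falls short (rate W), or the centre deviates by nearly \<rho> times the root of the
  floored density (rate V). Either alternative persists on a ball of radius \<eta>, by
  \<open>c7\<close> and \<open>c8\<close>. The three prefactors belong to overshoots of the centre,
  undershoots of the centre, and the pilot estimate; they are divided by the volume of the
  ball.\<close>

lemma prob_miss_le:
  fixes \<delta> s \<epsilon> \<rho> h b \<eta> :: real and n :: nat
  defines "q \<equiv> 1 - \<delta>" and "d \<equiv> DIM('a)"
  defines "V \<equiv> real n * b ^ d * \<rho>\<^sup>2 / (2 * \<kappa>)"
    and "W \<equiv> (1 - 5 * \<delta>) * (real n * h ^ d * \<delta>\<^sup>2 * (\<epsilon> * s) / (4 * \<kappa>))"
  assumes n: "0 < n" and h: "0 < h" and b: "0 < b" and \<rho>: "0 < \<rho>" and \<epsilon>: "0 < \<epsilon>" "\<epsilon> \<le> 1"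
    and s: "0 < s" "\<And>x. x \<in> C \<Longrightarrow> f x \<le> s" and x0: "x0 \<in> C" "(1 - \<delta>) * s \<le> f x0"
    and \<delta>: "0 < \<delta>" "\<delta> \<le> 1 / 5" and \<eta>: "0 < \<eta>"
    and c1: "\<rho> * B \<le> \<delta> * \<kappa> * sqrt (\<epsilon> * s)"
    and c2: "A1 * b \<le> \<delta> * \<kappa> * (\<epsilon> * s)"
    and c3: "A2 * b\<^sup>2 \<le> \<delta> * q ^ 3 * (\<rho> * sqrt (\<epsilon> * s))"
    and c4: "1 \<le> 2 * q ^ 6 * V"
    and c5: "A1 * h \<le> \<delta> * \<kappa> * (\<epsilon> * s) / 2"
    and c6: "A2 * h\<^sup>2 \<le> \<delta>\<^sup>2 * (\<epsilon> * s) / 2"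
    and c7: "G * \<eta> + L / h ^ d * (\<eta> / h) powr \<alpha> \<le> q * \<delta> * (\<epsilon> * s) / 2"
    and c8: "G * \<eta> + L / b ^ d * (\<eta> / b) powr \<alpha> \<le> \<delta> * q\<^sup>2 * (\<rho> * sqrt (\<epsilon> * s))"
  shows "prob (miss n h b \<epsilon> \<rho> C) \<le> exp (- W) +
    ((4 * real n / B * b ^ d + 1 / (q ^ 3 * (\<rho> * sqrt (\<epsilon> * s)))) * exp (- (1 - 5 * \<delta>) * q ^ 6 * V)
      + 2 / (\<epsilon> * s) * exp (- W)) / (unit_ball_vol (real d) * \<eta> ^ d)"
proof -
  have q: "4 / 5 \<le> q" "q < 1" "0 < q" using \<delta> by (auto simp: q_def)
  have \<delta>1: "\<delta> \<le> 1" using \<delta> by simp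
  have es: "0 < \<epsilon> * s" using \<epsilon> s by simp
  have \<kappa>0: "\<kappa> \<noteq> 0" using kappa_pos by simp
  \<comment> \<open>The deterministic substitute for \<open>trunc\<close>: f raised to the floor
    \<epsilon> s.\<close>
  define \<tau> where "\<tau> y = max (f y) (\<epsilon> * s)" for y
  have \<tau>: "0 < \<tau> y" "f y \<le> \<tau> y" "\<epsilon> * s \<le> \<tau> y" for y using es by (auto simp: \<tau>_def)
  define w where "w y = q ^ 3 * (\<rho> * sqrt (\<tau> y))" for y
  have w2: "(w y)\<^sup>2 = q ^ 6 * \<rho>\<^sup>2 * \<tau> y" for y
    using \<tau>(1)[of y] by (simp add: w_def power_mult_distrib flip: power_mult)
  have wmin: "q ^ 3 * (\<rho> * sqrt (\<epsilon> * s)) \<le> w y" for y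
    unfolding w_def using \<tau>(3) q \<rho> by (intro mult_left_mono) auto
  have w0: "0 < w y" for y using \<tau>(1) q \<rho> by (simp add: w_def)
  have VV: "real n * b ^ d * (w y)\<^sup>2 / (2 * \<kappa> * \<tau> y) = q ^ 6 * V" for y
    using \<tau>(1)[of y] \<kappa>0 by (simp add: w2 V_def)
  have A1b: "A1 * b \<le> \<delta> * (\<kappa> * \<tau> y)" for y
  proof -
    have "\<delta> * \<kappa> * (\<epsilon> * s) \<le> \<delta> * \<kappa> * \<tau> y" using \<delta> kappa_pos \<tau> by (intro mult_left_mono) auto
    with c2 show ?thesis by simp
  qed
  have A2b: "A2 * b\<^sup>2 \<le> \<delta> * w y" for y
  proof -
    have "\<delta> * (q ^ 3 * (\<rho> * sqrt (\<epsilon> * s))) \<le> \<delta> * w y" using \<delta> wmin by (intro mult_left_mono) auto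
    with c3 show ?thesis by (simp add: mult_ac)
  qed
  define S1 where "S1 = {z \<in> space (M \<Otimes>\<^sub>M lborel). f (snd z) + w (snd z) \<le> (\<lambda>(\<omega>, y). est n b y \<omega>) z}"
  define S2 where "S2 = {z \<in> space (M \<Otimes>\<^sub>M lborel). (\<lambda>(\<omega>, y). est n b y \<omega>) z \<le> f (snd z) - w (snd z)}"
  \<comment> \<open>At the missed point itself the conditions are f \<ge> \<epsilon> s and an
    estimate below q^2 f. The weaker constants 1/2 and q leave room for the Lipschitz and Hoelder
    errors across the ball.\<close>
  define S3 where "S3 = {z \<in> space (M \<Otimes>\<^sub>M lborel). \<epsilon> * s / 2 \<le> f (snd z) \<and> (\<lambda>(\<omega>, y). est n h y \<omega>) z \<le> q * f (snd z)}"
  have [measurable]: "w \<in> borel_measurable borel" unfolding w_def[abs_def] \<tau>_def by measurable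
  have S [measurable]: "S1 \<in> sets (M \<Otimes>\<^sub>M lborel)" "S2 \<in> sets (M \<Otimes>\<^sub>M lborel)" "S3 \<in> sets (M \<Otimes>\<^sub>M lborel)"
    unfolding S1_def S2_def S3_def by measurable
  define e1 where "e1 = exp (- (1 - 5 * \<delta>) * q ^ 6 * V)"
  have P1: "prob {\<omega> \<in> space M. (\<omega>, y) \<in> S1} \<le> 4 * real n / B * b ^ d * e1 * meanK b y" for y
  proof -
    have "w y * B \<le> \<delta> * (\<kappa> * \<tau> y)"
    proof -
      have "w y * B \<le> 1 * (\<rho> * sqrt (\<tau> y)) * B"
        unfolding w_def using q \<rho> B_pos \<tau>(1)[of y] by (intro mult_right_mono power_le_one) auto
      also have "\<dots> = \<rho> * B * sqrt (\<tau> y)" by simp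
      also have "\<dots> \<le> \<delta> * \<kappa> * sqrt (\<epsilon> * s) * sqrt (\<tau> y)" using c1 \<tau>(1)[of y] by (intro mult_right_mono) auto
      also have "\<dots> \<le> \<delta> * \<kappa> * sqrt (\<tau> y) * sqrt (\<tau> y)"
        using \<tau>(1,3)[of y] \<delta> kappa_pos by (intro mult_right_mono mult_left_mono) auto
      also have "\<dots> = \<delta> * (\<kappa> * \<tau> y)" using \<tau>(1)[of y] by simp
      finally show ?thesis .
    qed
    moreover have "\<kappa> * \<tau> y \<le> real n * b ^ DIM('a) * (w y)\<^sup>2"
    proof -
      have "\<kappa> * \<tau> y * 1 \<le> \<kappa> * \<tau> y * (2 * q ^ 6 * V)" using kappa_pos \<tau>(1)[of y] c4 by (intro mult_left_mono) auto
      also have "\<dots> = real n * b ^ DIM('a) * (w y)\<^sup>2" using \<kappa>0 by (simp add: w2 V_def d_def)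
      finally show ?thesis by simp
    qed
    ultimately have "prob {\<omega> \<in> space M. f y + w y \<le> est n b y \<omega>} \<le>
        4 * real n / B * b ^ DIM('a) * meanK b y *
        exp (- (1 - 5 * \<delta>) * (real n * b ^ DIM('a) * (w y)\<^sup>2 / (2 * \<kappa> * \<tau> y)))"
      using b w0 \<tau> \<delta> \<delta>1 A1b A2b by (intro upper_tail) auto
    then show ?thesis unfolding VV[unfolded d_def] by (simp add: S1_def space_pair_measure e1_def d_def mult_ac)
  qed
  \<comment> \<open>The estimator is nonnegative, so the event is empty if f y < w y. Otherwise f y
    is at least the smallest value of w, and dividing by that value produces the integrable factor f
    y. In the bound for \<open>S3\<close> the condition \<epsilon> s / 2 \<le> f y does the
    same.\<close>
  have P2: "prob {\<omega> \<in> space M. (\<omega>, y) \<in> S2} \<le> 1 / (q ^ 3 * (\<rho> * sqrt (\<epsilon> * s))) * e1 * f y" for y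
  proof (cases "f y < w y")
    case True
    then have e: "{\<omega> \<in> space M. (\<omega>, y) \<in> S2} = {}"
      using less_le_trans[OF _ est_nonneg[OF b, of n y], of "f y - w y"] by (auto simp: S2_def not_le)
    show ?thesis using q \<rho> es f_nonneg unfolding e e1_def by simp
  next
    case False
    have "prob {\<omega> \<in> space M. est n b y \<omega> \<le> f y - w y} \<le>
        exp (- (1 - 5 * \<delta>) * (real n * b ^ DIM('a) * (w y)\<^sup>2 / (2 * \<kappa> * \<tau> y)))"
      using b n w0 \<tau> \<delta> \<delta>1 A1b A2b by (intro lower_tail) auto
    then have "prob {\<omega> \<in> space M. (\<omega>, y) \<in> S2} \<le> 1 * e1"
      unfolding VV[unfolded d_def] by (simp add: S2_def space_pair_measure e1_def mult_ac)
    also have "\<dots> \<le> (f y / (q ^ 3 * (\<rho> * sqrt (\<epsilon> * s)))) * e1"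
    proof (rule mult_right_mono)
      show "1 \<le> f y / (q ^ 3 * (\<rho> * sqrt (\<epsilon> * s)))"
        using False wmin[of y] q \<rho> es by (simp add: pos_le_divide_eq)
    qed (simp add: e1_def)
    finally show ?thesis by (simp add: mult_ac)
  qed
  have low: "prob {\<omega> \<in> space M. est n h y \<omega> \<le> q * f y} \<le> exp (- W)" if y: "\<epsilon> * s / 2 \<le> f y" for y
  proof -
    have fy: "0 < f y" using y es by simp
    have "A1 * h \<le> \<delta> * (\<kappa> * f y)"
    proof -
      have "\<delta> * \<kappa> * (\<epsilon> * s / 2) \<le> \<delta> * \<kappa> * f y" using \<delta> kappa_pos y by (intro mult_left_mono) auto
      with c5 show ?thesis by simp
    qed
    moreover have "A2 * h\<^sup>2 \<le> \<delta> * (\<delta> * f y)"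
    proof -
      have "\<delta>\<^sup>2 * (\<epsilon> * s / 2) \<le> \<delta>\<^sup>2 * f y" using y by (intro mult_left_mono) auto
      with c6 show ?thesis by (simp add: power2_eq_square)
    qed
    ultimately have "prob {\<omega> \<in> space M. est n h y \<omega> \<le> f y - \<delta> * f y} \<le>
        exp (- (1 - 5 * \<delta>) * (real n * h ^ DIM('a) * (\<delta> * f y)\<^sup>2 / (2 * \<kappa> * f y)))"
      using h n \<delta> \<delta>1 fy by (intro lower_tail) auto
    also have "real n * h ^ DIM('a) * (\<delta> * f y)\<^sup>2 / (2 * \<kappa> * f y) = real n * h ^ d * \<delta>\<^sup>2 / (2 * \<kappa>) * f y"
      using fy by (simp add: power2_eq_square d_def)
    also have "exp (- (1 - 5 * \<delta>) * (real n * h ^ d * \<delta>\<^sup>2 / (2 * \<kappa>) * f y)) \<le> exp (- W)"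
    proof -
      have "real n * h ^ d * \<delta>\<^sup>2 / (2 * \<kappa>) * (\<epsilon> * s / 2) \<le> real n * h ^ d * \<delta>\<^sup>2 / (2 * \<kappa>) * f y"
        using h kappa_pos y by (intro mult_left_mono) auto
      then have "(1 - 5 * \<delta>) * (real n * h ^ d * \<delta>\<^sup>2 / (2 * \<kappa>) * (\<epsilon> * s / 2)) \<le> (1 - 5 * \<delta>) * (real n * h ^ d * \<delta>\<^sup>2 / (2 * \<kappa>) * f y)"
        by (rule mult_left_mono) (use \<delta> in auto)
      moreover have "(1 - 5 * \<delta>) * (real n * h ^ d * \<delta>\<^sup>2 / (2 * \<kappa>) * (\<epsilon> * s / 2)) = W" by (simp add: W_def)
      ultimately show ?thesis unfolding exp_le_cancel_iff mult_minus_left by linarith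
    qed
    finally show ?thesis by (simp add: q_def algebra_simps)
  qed
  have P3: "prob {\<omega> \<in> space M. (\<omega>, y) \<in> S3} \<le> 2 / (\<epsilon> * s) * exp (- W) * f y" for y
  proof (cases "\<epsilon> * s / 2 \<le> f y")
    case False
    then show ?thesis using es f_nonneg by (simp add: S3_def)
  next
    case True
    then have "prob {\<omega> \<in> space M. (\<omega>, y) \<in> S3} \<le> 1 * exp (- W)"
      using low[OF True] by (simp add: S3_def space_pair_measure)
    also have "\<dots> \<le> 2 / (\<epsilon> * s) * f y * exp (- W)"
      using True es by (intro mult_right_mono) (auto simp: field_simps)
    finally show ?thesis by (simp add: mult_ac)
  qed
  \<comment> \<open>Outside \<open>A0\<close> the supremum of the pilot estimate is at least q^2 s,
    so the random floor of the truncation is at least q^2 \<epsilon> s. Only one point is involved,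
    hence no averaging.\<close>
  define A0 where "A0 = {\<omega> \<in> space M. est n h x0 \<omega> \<le> q * f x0}"
  have [measurable]: "A0 \<in> events" unfolding A0_def by measurable
  have PA0: "prob A0 \<le> exp (- W)"
  proof -
    have "\<epsilon> * s \<le> 1 * s" using \<epsilon> s by (intro mult_right_mono) auto
    moreover have "4 / 5 * s \<le> q * s" using q s by (intro mult_right_mono) auto
    ultimately have "\<epsilon> * s / 2 \<le> f x0" using x0(2) s(1) unfolding q_def[symmetric] by linarith
    then show ?thesis unfolding A0_def by (rule low)
  qed
  have C: "C \<noteq> {}" using x0 by auto
  have [measurable]: "miss n h b \<epsilon> \<rho> C \<in> events" using h n C by (rule miss_sets)
  define c1' where "c1' = 4 * real n / B * b ^ d * e1"
  define c2' where "c2' = 1 / (q ^ 3 * (\<rho> * sqrt (\<epsilon> * s))) * e1 + 2 / (\<epsilon> * s) * exp (- W)"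
  have "prob (miss n h b \<epsilon> \<rho> C - A0) \<le> (c1' + c2') / (unit_ball_vol (real DIM('a)) * \<eta> ^ DIM('a))"
  proof (rule ball_averaging_mean[where S="S1 \<union> S2 \<union> S3", OF _ _ \<eta>])
    show "0 \<le> c1'" "0 \<le> c2'" using B_pos b q \<rho> es by (auto simp: c1'_def c2'_def e1_def)
    fix y
    have eq: "{\<omega> \<in> space M. (\<omega>, y) \<in> S1 \<union> S2 \<union> S3} =
        {\<omega> \<in> space M. (\<omega>, y) \<in> S1} \<union> {\<omega> \<in> space M. (\<omega>, y) \<in> S2} \<union> {\<omega> \<in> space M. (\<omega>, y) \<in> S3}" by auto
    have [measurable]: "{\<omega> \<in> space M. (\<omega>, y) \<in> S1} \<in> events" "{\<omega> \<in> space M. (\<omega>, y) \<in> S2} \<in> events"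
        "{\<omega> \<in> space M. (\<omega>, y) \<in> S3} \<in> events"
      by measurable
    have "prob {\<omega> \<in> space M. (\<omega>, y) \<in> S1 \<union> S2 \<union> S3} \<le>
        prob ({\<omega> \<in> space M. (\<omega>, y) \<in> S1} \<union> {\<omega> \<in> space M. (\<omega>, y) \<in> S2}) + prob {\<omega> \<in> space M. (\<omega>, y) \<in> S3}"
      unfolding eq by (rule measure_Un_le) auto
    moreover have "prob ({\<omega> \<in> space M. (\<omega>, y) \<in> S1} \<union> {\<omega> \<in> space M. (\<omega>, y) \<in> S2}) \<le>
       prob {\<omega> \<in> space M. (\<omega>, y) \<in> S1} + prob {\<omega> \<in> space M. (\<omega>, y) \<in> S2}"
      by (rule measure_Un_le) auto
    ultimately show "prob {\<omega> \<in> space M. (\<omega>, y) \<in> S1 \<union> S2 \<union> S3} \<le> c1' * meanK b y + c2' * f y"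
      using P1[of y] P2[of y] P3[of y] unfolding c1'_def c2'_def distrib_right by linarith
  next
    fix \<omega> assume \<omega>: "\<omega> \<in> miss n h b \<epsilon> \<rho> C - A0"
    then have \<omega>M: "\<omega> \<in> space M" and A0: "q * f x0 < est n h x0 \<omega>"
      by (auto simp: miss_def A0_def)
    from \<omega> obtain x where x: "x \<in> C" "\<rho> * sqrt (trunc n h \<epsilon> C \<omega> x) < \<bar>est n b x \<omega> - f x\<bar>"
      by (auto simp: miss_def)
    have sup: "q\<^sup>2 * s \<le> (SUP y\<in>C. est n h y \<omega>)"
    proof -
      have "q\<^sup>2 * s \<le> q * f x0"
        using mult_left_mono[OF x0(2), of q] q by (simp add: power2_eq_square q_def)
      also have "\<dots> \<le> est n h x0 \<omega>" using A0 by simp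
      also have "\<dots> \<le> (SUP y\<in>C. est n h y \<omega>)" by (rule cSUP_upper[OF x0(1) est_bdd_above[OF h n]])
      finally show ?thesis .
    qed
    have G\<eta>: "0 \<le> G * \<eta>" using nonneg \<eta> by simp
    have Lh: "0 \<le> L / h ^ d * (\<eta> / h) powr \<alpha>" "0 \<le> L / b ^ d * (\<eta> / b) powr \<alpha>" using nonneg h b by auto
    have qd: "q * \<delta> * (\<epsilon> * s) \<le> \<delta> * (\<epsilon> * s)" "\<delta> * (\<epsilon> * s) \<le> \<epsilon> * s"
      using q \<delta> es mult_right_mono[of q 1 "\<delta> * (\<epsilon> * s)"] mult_right_mono[of \<delta> 1 "\<epsilon> * s"] by auto
    have fball: "\<bar>f x - f y\<bar> \<le> G * \<eta>" if "y \<in> ball x \<eta>" for y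
    proof -
      have "G * dist x y \<le> G * \<eta>" using that nonneg by (intro mult_left_mono) auto
      with f_lip[of x y] show ?thesis by linarith
    qed
    \<comment> \<open>If f x is above the floor and the pilot estimate far too low, the ball lies in
      \<open>S3\<close>. Otherwise \<open>trunc\<close> is at least q^2 \<tau> x, so the miss is a
      genuine deviation of the centre, and each point of the ball lies in \<open>S1\<close> or
      \<open>S2\<close>.\<close>
    have "\<forall>y\<in>ball x \<eta>. (\<omega>, y) \<in> S1 \<union> S2 \<union> S3"
    proof (cases "\<epsilon> * s \<le> f x \<and> est n h x \<omega> < q\<^sup>2 * f x")
      case True
      show ?thesis
      proof
        fix y assume y: "y \<in> ball x \<eta>"
        have 1: "\<epsilon> * s / 2 \<le> f y" using fball[OF y] True c7 Lh qd by linarith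
        have "est n h y \<omega> \<le> q\<^sup>2 * f x + L / h ^ d * (\<eta> / h) powr \<alpha>"
          using est_near[OF h n, of x y \<eta> \<omega>] y True by (auto simp: d_def)
        moreover have "q\<^sup>2 * f x \<le> q\<^sup>2 * (f y + G * \<eta>)" using fball[OF y] by (intro mult_left_mono) auto
        moreover have "q\<^sup>2 * (f y + G * \<eta>) \<le> q\<^sup>2 * f y + G * \<eta>"
          using q G\<eta> mult_right_mono[of "q\<^sup>2" 1 "G * \<eta>"] power_le_one[of q 2] by (simp add: distrib_left)
        moreover have "q * \<delta> * (\<epsilon> * s) / 2 \<le> q * \<delta> * f y"
          using 1 q \<delta> mult_left_mono[of "\<epsilon> * s / 2" "f y" "q * \<delta>"] by simp
        moreover have "q\<^sup>2 * f y + q * \<delta> * f y = q * f y" by (simp add: q_def power2_eq_square algebra_simps)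
        ultimately have "est n h y \<omega> \<le> q * f y" using c7 by linarith
        with 1 \<omega>M show "(\<omega>, y) \<in> S1 \<union> S2 \<union> S3" by (simp add: S3_def space_pair_measure)
      qed
    next
      case False
      have T: "q\<^sup>2 * \<tau> x \<le> trunc n h \<epsilon> C \<omega> x"
      proof (cases "\<epsilon> * s \<le> f x")
        case True
        then show ?thesis using False by (auto simp: trunc_def \<tau>_def)
      next
        case False
        then have "q\<^sup>2 * \<tau> x = \<epsilon> * (q\<^sup>2 * s)" by (simp add: \<tau>_def)
        also have "\<dots> \<le> \<epsilon> * (SUP y\<in>C. est n h y \<omega>)" using sup \<epsilon> by (intro mult_left_mono) auto
        also have "\<dots> \<le> trunc n h \<epsilon> C \<omega> x" by (simp add: trunc_def)
        finally show ?thesis .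
      qed
      show ?thesis
      proof
        fix y assume y: "y \<in> ball x \<eta>"
        have "\<tau> y - G * \<eta> \<le> \<tau> x" using fball[OF y] G\<eta> by (auto simp: \<tau>_def)
        moreover have "q\<^sup>2 * \<tau> y + G * \<eta> \<le> \<tau> y"
        proof -
          have "G * \<eta> \<le> \<delta> * (\<epsilon> * s)" using c7 Lh qd mult_pos_pos[OF \<delta>(1) es] by linarith
          also have "\<dots> \<le> \<delta> * \<tau> y" using \<delta> \<tau>(3)[of y] by (intro mult_left_mono) auto
          also have "\<dots> \<le> (1 - q\<^sup>2) * \<tau> y"
            using \<tau>(1)[of y] \<delta> mult_right_mono[of \<delta> 1 \<delta>]
            by (intro mult_right_mono) (auto simp: q_def power2_eq_square algebra_simps)
          finally show ?thesis by (simp add: algebra_simps)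
        qed
        ultimately have "q\<^sup>2 * \<tau> y \<le> \<tau> x" by linarith
        then have "q\<^sup>2 * (q\<^sup>2 * \<tau> y) \<le> q\<^sup>2 * \<tau> x" by (intro mult_left_mono) auto
        with T have "(q\<^sup>2)\<^sup>2 * \<tau> y \<le> trunc n h \<epsilon> C \<omega> x" by (simp add: power2_eq_square)
        then have "sqrt ((q\<^sup>2)\<^sup>2 * \<tau> y) \<le> sqrt (trunc n h \<epsilon> C \<omega> x)" by simp
        then have "q\<^sup>2 * sqrt (\<tau> y) \<le> sqrt (trunc n h \<epsilon> C \<omega> x)"
          unfolding real_sqrt_mult real_sqrt_abs by simp
        then have "\<rho> * (q\<^sup>2 * sqrt (\<tau> y)) \<le> \<rho> * sqrt (trunc n h \<epsilon> C \<omega> x)" using \<rho> by (intro mult_left_mono) auto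
        with x have dev: "q\<^sup>2 * (\<rho> * sqrt (\<tau> y)) \<le> \<bar>est n b x \<omega> - f x\<bar>" by (simp add: mult_ac)
        have "\<delta> * q\<^sup>2 * (\<rho> * sqrt (\<epsilon> * s)) \<le> \<delta> * q\<^sup>2 * (\<rho> * sqrt (\<tau> y))"
          using \<delta> \<rho> \<tau>(3)[of y] by (intro mult_left_mono) auto
        with c8 have "G * \<eta> + L / b ^ d * (\<eta> / b) powr \<alpha> \<le> \<delta> * q\<^sup>2 * (\<rho> * sqrt (\<tau> y))" by linarith
        moreover have "\<bar>est n b x \<omega> - est n b y \<omega>\<bar> \<le> L / b ^ d * (\<eta> / b) powr \<alpha>"
          using est_near[OF b n, of x y \<eta> \<omega>] y by (auto simp: d_def)
        moreover have "w y = q\<^sup>2 * (\<rho> * sqrt (\<tau> y)) - \<delta> * q\<^sup>2 * (\<rho> * sqrt (\<tau> y))"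
          by (simp add: w_def q_def power2_eq_square power3_eq_cube algebra_simps)
        ultimately have "w y \<le> \<bar>est n b y \<omega> - f y\<bar>" using dev fball[OF y] by linarith
        then have "f y + w y \<le> est n b y \<omega> \<or> est n b y \<omega> \<le> f y - w y" by linarith
        then show "(\<omega>, y) \<in> S1 \<union> S2 \<union> S3" using \<omega>M by (auto simp: S1_def S2_def space_pair_measure)
      qed
    qed
    then show "\<exists>x. \<forall>y\<in>ball x \<eta>. (\<omega>, y) \<in> S1 \<union> S2 \<union> S3" by blast
  qed measurable
  moreover have "prob (miss n h b \<epsilon> \<rho> C) \<le> prob (A0 \<union> (miss n h b \<epsilon> \<rho> C - A0))"
    by (intro finite_measure_mono) auto
  moreover have "prob (A0 \<union> (miss n h b \<epsilon> \<rho> C - A0)) \<le> prob A0 + prob (miss n h b \<epsilon> \<rho> C - A0)"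
    by (rule measure_Un_le) auto
  ultimately have "prob (miss n h b \<epsilon> \<rho> C) \<le> exp (- W) + (c1' + c2') / (unit_ball_vol (real d) * \<eta> ^ d)"
    using PA0 unfolding d_def by linarith
  also have "c1' + c2' = (4 * real n / B * b ^ d + 1 / (q ^ 3 * (\<rho> * sqrt (\<epsilon> * s)))) * e1 + 2 / (\<epsilon> * s) * exp (- W)"
    by (simp add: c1'_def c2'_def algebra_simps)
  finally show ?thesis unfolding e1_def .
qed

section \<open>Lower bound for the failure probability\<close>

lemma F_nonneg: "0 \<le> F"
  using f_nonneg f_le order_trans by blast

text \<open>Adding 10 w B / \<kappa> to F makes \<tau> large enough for \<open>upper_tail\<close>
  with \<delta> = 1/10, however large w is. The rate is not sharp, but any rate linear in n h^d is
  enough for the pilot estimate.\<close>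

lemma overshoot_le:
  fixes w h :: real and n :: nat
  defines "\<tau> \<equiv> F + 10 * w * B / \<kappa>"
  assumes h: "0 < h" and w: "0 < w" and A1: "A1 * h \<le> \<kappa> * \<tau> / 10" and A2: "A2 * h\<^sup>2 \<le> w / 10"
    and big: "\<kappa> * \<tau> \<le> real n * h ^ DIM('a) * w\<^sup>2"
  shows "prob {\<omega> \<in> space M. f y + w \<le> est n h y \<omega>} \<le>
    4 * real n / B * h ^ DIM('a) * exp (- (real n * h ^ DIM('a) * w\<^sup>2 / (4 * \<kappa> * \<tau>))) * meanK h y"
proof -
  have *: "0 < 10 * w * B / \<kappa>" using w B_pos kappa_pos by simp
  have \<tau>: "0 < \<tau>" "f y \<le> \<tau>" using * F_nonneg f_le[of y] unfolding \<tau>_def by linarith+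
  have "10 * w * B = \<kappa> * (10 * w * B / \<kappa>)" using kappa_pos by simp
  also have "\<dots> \<le> \<kappa> * \<tau>" using kappa_pos F_nonneg by (intro mult_left_mono) (auto simp: \<tau>_def)
  finally have "w * B \<le> 1 / 10 * (\<kappa> * \<tau>)" by simp
  then have "prob {\<omega> \<in> space M. f y + w \<le> est n h y \<omega>} \<le>
      4 * real n / B * h ^ DIM('a) * meanK h y *
      exp (- (1 - 5 * (1 / 10)) * (real n * h ^ DIM('a) * w\<^sup>2 / (2 * \<kappa> * \<tau>)))"
    using h w \<tau> A1 A2 big by (intro upper_tail) auto
  then show ?thesis by (simp add: mult_ac)
qed

text \<open>If the centre overshoots f x by w, the band misses at x unless \<open>trunc\<close>
  exceeds (1 + \<gamma>) f x. That requires an overshoot of the pilot estimate, either at x or of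
  its supremum; the last two terms bound these. The exponent is (1/2 + 5 \<gamma>) times 2 (1 +
  \<gamma>) V.\<close>

lemma prob_miss_ge:
  fixes \<gamma> \<epsilon> \<rho> h b \<eta> :: real and x and n :: nat
  defines "d \<equiv> DIM('a)" and "w \<equiv> \<rho> * sqrt ((1 + \<gamma>) * f x)" and "\<delta> \<equiv> \<gamma>\<^sup>2 / 136"
    and "\<tau>0 \<equiv> F + 10 * (\<gamma> * f x) * B / \<kappa>" and "\<tau>1 \<equiv> F + 10 * 1 * B / \<kappa>"
  defines "V \<equiv> real n * b ^ d * \<rho>\<^sup>2 / (2 * \<kappa>)"
  assumes n: "0 < n" and h: "0 < h" and b: "0 < b" and \<rho>: "0 < \<rho>" and \<epsilon>: "0 < \<epsilon>"
    and x: "x \<in> C" "0 < f x" and \<gamma>: "0 < \<gamma>" "\<gamma> \<le> 1" and \<eta>: "0 < \<eta>"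
    and eF: "\<epsilon> * (F + 2) \<le> (1 + \<gamma>) * f x"
    and wB: "3 * w * B \<le> \<delta> * (\<kappa> * f x)" and A1: "A1 * b \<le> \<delta> * (\<kappa> * f x)" and A2: "A2 * b\<^sup>2 \<le> \<delta> * w"
    and bd: "36 * F\<^sup>2 * b ^ d \<le> \<delta> * (\<kappa> * f x)" "6 * w * F * b ^ d \<le> \<kappa> * f x"
    and big: "8 \<le> 2 * V * \<gamma>\<^sup>2"
    and h0: "A1 * h \<le> \<kappa> * \<tau>0 / 10" "A2 * h\<^sup>2 \<le> (\<gamma> * f x) / 10" "\<kappa> * \<tau>0 \<le> real n * h ^ d * (\<gamma> * f x)\<^sup>2"
    and h1: "A1 * h \<le> \<kappa> * \<tau>1 / 10" "A2 * h\<^sup>2 \<le> 1 / 10" "\<kappa> * \<tau>1 \<le> real n * h ^ d * 1\<^sup>2"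
    and c: "L / h ^ d * (\<eta> / h) powr \<alpha> \<le> 1"
  shows "exp (- (1 + 10 * \<gamma>) * (1 + \<gamma>) * V) \<le> prob (miss n h b \<epsilon> \<rho> C)
     + 4 * real n / B * h ^ d * F * exp (- (real n * h ^ d * (\<gamma> * f x)\<^sup>2 / (4 * \<kappa> * \<tau>0)))
     + 4 * real n / B * h ^ d * exp (- (real n * h ^ d * 1\<^sup>2 / (4 * \<kappa> * \<tau>1))) / (unit_ball_vol (real d) * \<eta> ^ d)"
proof -
  have C: "C \<noteq> {}" using x by auto
  have [measurable]: "miss n h b \<epsilon> \<rho> C \<in> events" using h n C by (rule miss_sets)
  define E0 where "E0 = {\<omega> \<in> space M. f x + \<gamma> * f x \<le> est n h x \<omega>}"
  \<comment> \<open>Of the margin 2 above F, one unit pays for the Hoelder error on the ball and the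
    other is the deviation w = 1 in \<open>overshoot_le\<close>.\<close>
  define E1 where "E1 = {\<omega> \<in> space M. F + 2 < (SUP y\<in>C. est n h y \<omega>)}"
  have [measurable]: "E0 \<in> events" unfolding E0_def by measurable
  have [measurable]: "E1 \<in> events" using h n C unfolding E1_def by measurable
  have w0: "0 < w" using \<rho> \<gamma> x by (simp add: w_def)
  have w2: "w\<^sup>2 = \<rho>\<^sup>2 * (1 + \<gamma>) * f x" using \<gamma> x by (simp add: w_def power_mult_distrib)
  have N: "real n * b ^ d * w\<^sup>2 / (\<kappa> * f x) = 2 * (1 + \<gamma>) * V"
    using x kappa_pos by (simp add: w2 V_def field_simps)
  have V0: "0 < V" using n b \<rho> kappa_pos by (simp add: V_def)
  have "8 \<le> 1 * (2 * V * \<gamma>\<^sup>2)" using big by simp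
  also have "\<dots> \<le> (1 + \<gamma>) * (2 * V * \<gamma>\<^sup>2)" using V0 \<gamma> by (intro mult_right_mono) auto
  finally have "8 \<le> 2 * (1 + \<gamma>) * V * \<gamma>\<^sup>2" by (simp only: mult_ac)
  then have "exp (- (1 / 2 + 5 * \<gamma>) * (real n * b ^ DIM('a) * w\<^sup>2 / (\<kappa> * f x)))
      \<le> prob {\<omega> \<in> space M. f x + w < est n b x \<omega>}"
    using b w0 x \<gamma> wB A1 A2 bd N
    by (intro est_lower_bound[where \<delta>=\<delta>]) (auto simp: \<delta>_def d_def)
  also have "- (1 / 2 + 5 * \<gamma>) * (real n * b ^ DIM('a) * w\<^sup>2 / (\<kappa> * f x)) = - (1 + 10 * \<gamma>) * (1 + \<gamma>) * V"
    unfolding N[unfolded d_def] by (simp add: algebra_simps)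
  also have "prob {\<omega> \<in> space M. f x + w < est n b x \<omega>} \<le> prob (miss n h b \<epsilon> \<rho> C \<union> E0 \<union> E1)"
  proof (rule finite_measure_mono)
    show "{\<omega> \<in> space M. f x + w < est n b x \<omega>} \<subseteq> miss n h b \<epsilon> \<rho> C \<union> E0 \<union> E1"
    proof (safe, rule ccontr)
      fix \<omega> assume \<omega>: "\<omega> \<in> space M" "f x + w < est n b x \<omega>" "\<omega> \<notin> miss n h b \<epsilon> \<rho> C" "\<omega> \<notin> E1" "\<omega> \<notin> E0"
      have "\<epsilon> * (SUP y\<in>C. est n h y \<omega>) \<le> \<epsilon> * (F + 2)" using \<omega> \<epsilon> by (intro mult_left_mono) (auto simp: E1_def)
      with eF have "\<epsilon> * (SUP y\<in>C. est n h y \<omega>) \<le> (1 + \<gamma>) * f x" by linarith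
      moreover have "est n h x \<omega> \<le> (1 + \<gamma>) * f x" using \<omega> by (auto simp: E0_def algebra_simps)
      ultimately have "trunc n h \<epsilon> C \<omega> x \<le> (1 + \<gamma>) * f x" by (simp add: trunc_def)
      then have "\<rho> * sqrt (trunc n h \<epsilon> C \<omega> x) \<le> w" unfolding w_def using \<rho> by (intro mult_left_mono) auto
      with \<omega> have "\<rho> * sqrt (trunc n h \<epsilon> C \<omega> x) < \<bar>est n b x \<omega> - f x\<bar>" by linarith
      with \<omega> x show False by (auto simp: miss_def)
    qed
  qed measurable
  also have "\<dots> \<le> prob (miss n h b \<epsilon> \<rho> C \<union> E0) + prob E1"
    by (rule measure_Un_le) auto
  also have "prob (miss n h b \<epsilon> \<rho> C \<union> E0) \<le> prob (miss n h b \<epsilon> \<rho> C) + prob E0"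
    by (rule measure_Un_le) auto
  also have "prob E0 \<le> 4 * real n / B * h ^ d * F * exp (- (real n * h ^ d * (\<gamma> * f x)\<^sup>2 / (4 * \<kappa> * \<tau>0)))"
  proof -
    have "prob E0 \<le> 4 * real n / B * h ^ d * exp (- (real n * h ^ d * (\<gamma> * f x)\<^sup>2 / (4 * \<kappa> * \<tau>0))) * meanK h x"
      unfolding E0_def d_def \<tau>0_def
      using h \<gamma> x h0 by (intro overshoot_le) (auto simp: \<tau>0_def d_def)
    also have "\<dots> \<le> 4 * real n / B * h ^ d * exp (- (real n * h ^ d * (\<gamma> * f x)\<^sup>2 / (4 * \<kappa> * \<tau>0))) * F"
      using B_pos h by (intro mult_left_mono meanK_le) auto
    finally show ?thesis by (simp add: mult_ac)
  qed
  also have "prob E1 \<le> 4 * real n / B * h ^ d * exp (- (real n * h ^ d * 1\<^sup>2 / (4 * \<kappa> * \<tau>1))) / (unit_ball_vol (real d) * \<eta> ^ d)"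
  proof -
    define S where "S = {z \<in> space (M \<Otimes>\<^sub>M lborel). f (snd z) + 1 \<le> (\<lambda>(\<omega>, y). est n h y \<omega>) z}"
    have [measurable]: "S \<in> sets (M \<Otimes>\<^sub>M lborel)" unfolding S_def by measurable
    have "prob E1 \<le> (4 * real n / B * h ^ d * exp (- (real n * h ^ d * 1\<^sup>2 / (4 * \<kappa> * \<tau>1))) + 0) / (unit_ball_vol (real DIM('a)) * \<eta> ^ DIM('a))"
    proof (rule ball_averaging_mean[where S=S, OF _ _ \<eta>])
      fix y
      have "prob {\<omega> \<in> space M. f y + 1 \<le> est n h y \<omega>} \<le>
        4 * real n / B * h ^ d * exp (- (real n * h ^ d * 1\<^sup>2 / (4 * \<kappa> * \<tau>1))) * meanK h y"
        unfolding d_def \<tau>1_def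
        using h h1 by (intro overshoot_le) (auto simp: \<tau>1_def d_def)
      then show "prob {\<omega> \<in> space M. (\<omega>, y) \<in> S} \<le>
        4 * real n / B * h ^ d * exp (- (real n * h ^ d * 1\<^sup>2 / (4 * \<kappa> * \<tau>1))) * meanK h y + 0 * f y"
        by (simp add: S_def space_pair_measure)
    next
      fix \<omega> assume "\<omega> \<in> E1"
      then have \<omega>: "\<omega> \<in> space M" "F + 2 < (SUP y\<in>C. est n h y \<omega>)" by (auto simp: E1_def)
      then obtain z where z: "z \<in> C" "F + 2 < est n h z \<omega>"
        using less_cSUP_iff[OF C est_bdd_above[OF h n]] by auto
      have "(\<omega>, y) \<in> S" if y: "y \<in> ball z \<eta>" for y
      proof -
        have "\<bar>est n h z \<omega> - est n h y \<omega>\<bar> \<le> 1"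
          using est_near[OF h n, of z y \<eta> \<omega>] y c by (auto simp: d_def)
        then have "f y + 1 \<le> est n h y \<omega>" using z f_le[of y] by linarith
        then show ?thesis using \<omega> by (simp add: S_def space_pair_measure)
      qed
      then show "\<exists>z. \<forall>y\<in>ball z \<eta>. (\<omega>, y) \<in> S" by blast
    next
      show "S \<in> sets (M \<Otimes>\<^sub>M lborel)" by measurable
    qed (use B_pos h in auto)
    then show ?thesis by (simp add: d_def)
  qed
  finally show ?thesis by linarith
qed

end

section \<open>Logarithmic asymptotics\<close>

lemma eventually_mult_le_if_ratio_tendsto_0:
  fixes x y :: "nat \<Rightarrow> real"
  assumes "(\<lambda>n. x n / y n) \<longlonglongrightarrow> 0" "eventually (\<lambda>n. 0 < y n) sequentially" "0 < c"
  shows "eventually (\<lambda>n. k * x n \<le> c * y n) sequentially"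
proof -
  have "(\<lambda>n. k * (x n / y n)) \<longlonglongrightarrow> 0" using tendsto_mult_right_zero[OF assms(1)] by simp
  then have "eventually (\<lambda>n. k * (x n / y n) < c) sequentially" using assms(3) by (rule order_tendstoD)
  with assms(2) show ?thesis
    by eventually_elim (simp add: field_simps)
qed

text \<open>Growth of V beyond log n is what absorbs every polynomial prefactor, including the
  inverse volume of the averaging balls.\<close>

lemma eventually_powr_le_exp:
  fixes V :: "nat \<Rightarrow> real"
  assumes "filterlim (\<lambda>n. V n / ln (real n)) at_top sequentially" "0 < c"
  shows "eventually (\<lambda>n. k * real n powr p \<le> exp (c * V n)) sequentially"
proof -
  have "eventually (\<lambda>n. \<bar>p + 1\<bar> / c \<le> V n / ln (real n)) sequentially"
    using assms(1) by (auto simp: filterlim_at_top)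
  moreover have "eventually (\<lambda>n. 2 \<le> n) sequentially" by (rule eventually_ge_at_top)
  moreover have "eventually (\<lambda>n. k \<le> real n) sequentially"
    using filterlim_real_sequentially by (auto simp: filterlim_at_top)
  ultimately show ?thesis
  proof eventually_elim
    case (elim n)
    have l: "0 < ln (real n)" using elim by simp
    have "(p + 1) * ln (real n) \<le> \<bar>p + 1\<bar> * ln (real n)" using l by (intro mult_right_mono) auto
    also have "\<dots> \<le> c * V n" using elim l assms(2) by (simp add: field_simps)
    finally have "exp ((p + 1) * ln (real n)) \<le> exp (c * V n)" by simp
    moreover have "k * real n powr p \<le> real n * real n powr p" using elim by (intro mult_right_mono) auto
    moreover have "real n * real n powr p = exp ((p + 1) * ln (real n))"
      using elim by (simp add: powr_def exp_add distrib_right)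
    ultimately show ?case by linarith
  qed
qed

text \<open>The orders of growth behind the two finite-sample bounds, without the power form of the
  bandwidths. \<open>V_lim\<close> pays for polynomial prefactors, \<open>h_V\<close> makes errors
  of the pilot estimate negligible, \<open>b2_lim\<close> does so for the bias, and
  \<open>poly\<close> keeps the thresholds above 1/n, so that balls of polynomially small radius
  suffice. The lower bound is obtained at z.\<close>

locale kde_band_asymptotics = kde_model M X f K F G B A1 A2 \<kappa> L \<alpha>
  for M :: "'b measure" and X :: "nat \<Rightarrow> 'b \<Rightarrow> 'a::euclidean_space" and f K F G B A1 A2 \<kappa> L \<alpha> +
  fixes h b \<epsilon> \<rho> V :: "nat \<Rightarrow> real" and C :: "'a set" and z :: 'a
  assumes z: "z \<in> C" "0 < f z"
    and V_def: "\<And>n. V n = real n * b n ^ DIM('a) * (\<rho> n)\<^sup>2 / (2 * \<kappa>)"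
    and pos: "eventually (\<lambda>n. 0 < \<rho> n \<and> 0 < \<epsilon> n \<and> \<epsilon> n \<le> 1) sequentially"
    and h_bounds: "eventually (\<lambda>n. 1 / real n \<le> h n \<and> h n \<le> 1) sequentially"
    and b_bounds: "eventually (\<lambda>n. 1 / real n \<le> b n \<and> b n \<le> 1) sequentially"
    and poly: "eventually (\<lambda>n. 1 / real n \<le> \<epsilon> n \<and> 1 / real n \<le> \<rho> n * sqrt (\<epsilon> n)) sequentially"
    and \<epsilon>_lim: "\<epsilon> \<longlonglongrightarrow> 0"
    and \<rho>_lim: "(\<lambda>n. \<rho> n / sqrt (\<epsilon> n)) \<longlonglongrightarrow> 0"
    and b_lim: "(\<lambda>n. b n / \<epsilon> n) \<longlonglongrightarrow> 0" and h_lim: "(\<lambda>n. h n / \<epsilon> n) \<longlonglongrightarrow> 0"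
    and b2_lim: "(\<lambda>n. (b n)\<^sup>2 / (\<rho> n * sqrt (\<epsilon> n))) \<longlonglongrightarrow> 0"
    and V_lim: "filterlim (\<lambda>n. V n / ln (real n)) at_top sequentially"
    and h_V: "filterlim (\<lambda>n. real n * h n ^ DIM('a) * \<epsilon> n / V n) at_top sequentially"
begin

text \<open>Exponent of the ball radius n^(-p). Even for a bandwidth as small as 1/n the Hoelder
  error is of order n^d times n^((1 - p) \<alpha>), and this p makes it at most n^(-3); p \<ge> 3
  does the same for the Lipschitz error of f. Thresholds are at least of order 1/n, so n^(-3) is
  negligible.\<close>

definition p :: real where "p = 3 + (DIM('a) + \<alpha> + 3) / \<alpha>"

definition \<eta> :: "nat \<Rightarrow> real" where "\<eta> n = real n powr (- p)"

lemma eta_ratio: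
  assumes "1 \<le> n"
  shows "real n / \<eta> n ^ DIM('a) = real n powr (1 + p * DIM('a))"
proof -
  have "\<eta> n ^ DIM('a) = real n powr (- (p * DIM('a)))"
    using assms by (simp add: \<eta>_def powr_power mult.commute)
  then have "real n / \<eta> n ^ DIM('a) = real n powr 1 / real n powr (- (p * DIM('a)))" using assms by simp
  also have "\<dots> = real n powr (1 + p * DIM('a))" by (subst powr_diff[symmetric]) simp
  finally show ?thesis .
qed

lemma holder_err_le:
  assumes n: "1 \<le> n" and h: "1 / real n \<le> c"
  shows "L / c ^ DIM('a) * (\<eta> n / c) powr \<alpha> \<le> L * real n powr (- 3)" and "\<eta> n \<le> real n powr (- 3)"
proof -
  have n0: "0 < real n" "1 \<le> real n" using n by auto
  have c: "0 < c" using h n0 by (meson divide_pos_pos less_le_trans zero_less_one)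
  have ic: "1 / c \<le> real n" using h n0 c by (simp add: field_simps)
  have "(1 / c) ^ DIM('a) \<le> real n ^ DIM('a)" using ic c by (intro power_mono) auto
  moreover have "(\<eta> n / c) powr \<alpha> \<le> (real n powr (1 - p)) powr \<alpha>"
  proof (intro powr_mono2)
    have "\<eta> n * (1 / c) \<le> real n powr (- p) * real n" unfolding \<eta>_def using ic by (rule mult_left_mono) auto
    also have "\<dots> = real n powr (1 - p)" using n0 by (simp add: powr_diff powr_minus field_simps)
    finally show "\<eta> n / c \<le> real n powr (1 - p)" by simp
  qed (use alpha_pos c in \<open>auto simp: \<eta>_def\<close>)
  ultimately have "(1 / c) ^ DIM('a) * (\<eta> n / c) powr \<alpha> \<le> real n ^ DIM('a) * (real n powr (1 - p)) powr \<alpha>"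
    using c by (intro mult_mono) auto
  also have "\<dots> = real n powr (DIM('a) + (1 - p) * \<alpha>)"
    using n0 by (simp add: powr_powr powr_add powr_realpow)
  also have "\<dots> \<le> real n powr (- 3)"
  proof (intro powr_mono)
    have "p * \<alpha> = 3 * \<alpha> + (DIM('a) + \<alpha> + 3)" using alpha_pos by (simp add: p_def field_simps)
    then show "DIM('a) + (1 - p) * \<alpha> \<le> - 3" using alpha_pos by (simp add: algebra_simps)
  qed (use n0 in auto)
  finally have "L * ((1 / c) ^ DIM('a) * (\<eta> n / c) powr \<alpha>) \<le> L * real n powr (- 3)"
    using nonneg by (intro mult_left_mono)
  then show "L / c ^ DIM('a) * (\<eta> n / c) powr \<alpha> \<le> L * real n powr (- 3)" by (simp add: power_divide)
  show "\<eta> n \<le> real n powr (- 3)"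
    unfolding \<eta>_def using n0 alpha_pos by (intro powr_mono) (auto simp: p_def)
qed

lemma eventually_err_le:
  assumes y: "eventually (\<lambda>n. 1 / real n \<le> y n) sequentially"
    and c: "eventually (\<lambda>n. 1 / real n \<le> c n) sequentially" and k: "0 < k"
  shows "eventually (\<lambda>n. G * \<eta> n + L / c n ^ DIM('a) * (\<eta> n / c n) powr \<alpha> \<le> k * y n) sequentially"
proof -
  have "(\<lambda>n. (G + L) * real n powr (- 2)) \<longlonglongrightarrow> (G + L) * 0"
    by (intro tendsto_intros tendsto_neg_powr filterlim_real_sequentially) auto
  then have "eventually (\<lambda>n. (G + L) * real n powr (- 2) < k) sequentially"
    using k by (intro order_tendstoD) auto
  moreover have "eventually (\<lambda>n. 1 \<le> n) sequentially" by (rule eventually_ge_at_top)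
  ultimately show ?thesis using y c
  proof eventually_elim
    case (elim n)
    have n0: "0 < real n" using elim by simp
    have "G * \<eta> n \<le> G * real n powr (- 3)"
      using holder_err_le(2)[OF elim(2,4)] nonneg by (intro mult_left_mono) auto
    with holder_err_le(1)[OF elim(2,4)]
    have "G * \<eta> n + L / c n ^ DIM('a) * (\<eta> n / c n) powr \<alpha> \<le> (G + L) * real n powr (- 3)"
      by (simp add: distrib_right)
    also have "real n powr (- 3) = real n powr (- 2) * (1 / real n)"
      using n0 powr_add[of "real n" "- 2" "- 1"] by (simp add: powr_minus_divide)
    also have "(G + L) * (real n powr (- 2) * (1 / real n)) \<le> k * (1 / real n)"
      using elim(1) n0 by (simp add: divide_right_mono)
    also have "\<dots> \<le> k * y n" using k elim(3) by (intro mult_left_mono) auto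
    finally show ?case .
  qed
qed

lemma V_at_top: "filterlim V at_top sequentially"
proof (rule filterlim_at_top_mono[OF V_lim])
  have "eventually (\<lambda>n. 1 \<le> V n / ln (real n)) sequentially"
    using V_lim by (auto simp: filterlim_at_top)
  moreover have "eventually (\<lambda>n. 1 \<le> ln (real n)) sequentially"
    using filterlim_compose[OF ln_at_top filterlim_real_sequentially] by (auto simp: filterlim_at_top)
  ultimately show "eventually (\<lambda>n. V n / ln (real n) \<le> V n) sequentially"
  proof eventually_elim
    case (elim n)
    then have "0 \<le> V n" by (simp add: field_simps)
    with elim show ?case using frac_le[of "V n" "V n" 1 "ln (real n)"] by simp
  qed
qed

lemma eventually_V_ge: "eventually (\<lambda>n. c \<le> V n) sequentially"
  using V_at_top by (auto simp: filterlim_at_top)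

lemma eventually_V_le_h:
  assumes "0 < c"
  shows "eventually (\<lambda>n. V n \<le> c * (real n * h n ^ DIM('a) * \<epsilon> n)) sequentially"
proof -
  have "eventually (\<lambda>n. 1 / c \<le> real n * h n ^ DIM('a) * \<epsilon> n / V n) sequentially"
    using h_V by (auto simp: filterlim_at_top)
  with eventually_V_ge[of 1] show ?thesis
    by eventually_elim (use assms in \<open>simp add: field_simps\<close>)
qed

text \<open>The loss 12 \<delta> is made up of 5 \<delta> from the tail bounds, 6 \<delta> from q^6
  by Bernoulli's inequality, and \<delta> for the polynomial prefactor.\<close>

lemma eventually_prob_miss_le:
  assumes \<delta>: "0 < \<delta>" "\<delta> < 1 / 5"
  shows "eventually (\<lambda>n. prob (miss n (h n) (b n) (\<epsilon> n) (\<rho> n) C) \<le> exp (- (1 - 12 * \<delta>) * V n)) sequentially"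
proof -
  define s where "s = (SUP x\<in>C. f x)"
  have C: "C \<noteq> {}" using z by auto
  have bdd: "bdd_above (f ` C)" by (rule bdd_aboveI2) (rule f_le)
  have fs: "f x \<le> s" if "x \<in> C" for x unfolding s_def using that bdd by (rule cSUP_upper)
  have s: "0 < s" using fs[OF z(1)] z(2) by simp
  then have "(1 - \<delta>) * s < s" using \<delta> by simp
  \<comment> \<open>A near-maximiser works for every C, whether or not the supremum is
    attained.\<close>
  then obtain x0 where x0: "x0 \<in> C" "(1 - \<delta>) * s < f x0"
    unfolding s_def using less_cSUP_iff[OF C bdd] by blast
  define q where "q = 1 - \<delta>"
  have q: "0 < q" "q < 1" using \<delta> by (auto simp: q_def)
  define v where "v = unit_ball_vol (real DIM('a))"
  have v: "0 < v" by (simp add: v_def)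
  have rs: "0 < sqrt s" using s by simp
  have 1: "eventually (\<lambda>n. B * \<rho> n \<le> \<delta> * \<kappa> * sqrt s * sqrt (\<epsilon> n)) sequentially"
    by (rule eventually_mult_le_if_ratio_tendsto_0[OF \<rho>_lim])
       (use pos \<delta> kappa_pos rs in \<open>auto elim: eventually_mono\<close>)
  have 2: "eventually (\<lambda>n. A1 * b n \<le> \<delta> * \<kappa> * s * \<epsilon> n) sequentially"
    by (rule eventually_mult_le_if_ratio_tendsto_0[OF b_lim])
       (use pos \<delta> kappa_pos s in \<open>auto elim: eventually_mono\<close>)
  have 3: "eventually (\<lambda>n. A2 * (b n)\<^sup>2 \<le> \<delta> * q ^ 3 * sqrt s * (\<rho> n * sqrt (\<epsilon> n))) sequentially"
    by (rule eventually_mult_le_if_ratio_tendsto_0[OF b2_lim])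
       (use pos \<delta> q rs in \<open>auto elim: eventually_mono\<close>)
  have 4: "eventually (\<lambda>n. 1 / (2 * q ^ 6) \<le> V n) sequentially" by (rule eventually_V_ge)
  have 5: "eventually (\<lambda>n. A1 * h n \<le> (\<delta> * \<kappa> * s / 2) * \<epsilon> n) sequentially"
    by (rule eventually_mult_le_if_ratio_tendsto_0[OF h_lim])
       (use pos \<delta> kappa_pos s in \<open>auto elim: eventually_mono\<close>)
  \<comment> \<open>Stated for h instead of h^2, which is smaller because h \<le> 1; so the limit of
    h / \<epsilon> covers it.\<close>
  have 6: "eventually (\<lambda>n. A2 * h n \<le> (\<delta>\<^sup>2 * s / 2) * \<epsilon> n) sequentially"
    by (rule eventually_mult_le_if_ratio_tendsto_0[OF h_lim])
       (use pos \<delta> s in \<open>auto elim: eventually_mono\<close>)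
  have 7: "eventually (\<lambda>n. G * \<eta> n + L / h n ^ DIM('a) * (\<eta> n / h n) powr \<alpha> \<le> (q * \<delta> * s / 2) * \<epsilon> n) sequentially"
    by (rule eventually_err_le)
       (use poly h_bounds q \<delta> s in \<open>auto elim: eventually_mono\<close>)
  have 8: "eventually (\<lambda>n. G * \<eta> n + L / b n ^ DIM('a) * (\<eta> n / b n) powr \<alpha>
      \<le> (\<delta> * q\<^sup>2 * sqrt s) * (\<rho> n * sqrt (\<epsilon> n))) sequentially"
    by (rule eventually_err_le)
       (use poly b_bounds q \<delta> rs in \<open>auto elim: eventually_mono\<close>)
  have 9: "eventually (\<lambda>n. V n \<le> ((1 - 5 * \<delta>) * \<delta>\<^sup>2 * s / (4 * \<kappa>)) * (real n * h n ^ DIM('a) * \<epsilon> n)) sequentially"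
    using \<delta> s kappa_pos by (intro eventually_V_le_h) auto
  \<comment> \<open>The coefficients of the three prefactors once b^d is bounded by 1, and
    1/\<epsilon> and 1/(\<rho> sqrt \<epsilon>) by n.\<close>
  define k where "k = (4 / B + 1 / (q ^ 3 * sqrt s) + 2 / s) / v"
  have k0: "0 \<le> k" unfolding k_def using B_pos q rs s v by auto
  have 10: "eventually (\<lambda>n. (1 + k) * real n powr (1 + p * DIM('a)) \<le> exp (\<delta> * V n)) sequentially"
    by (rule eventually_powr_le_exp[OF V_lim \<delta>(1)])
  have 11: "eventually (\<lambda>n. 1 \<le> n) sequentially" by (rule eventually_ge_at_top)
  show ?thesis
    using 1 2 3 4 5 6 7 8 9 10 11 pos h_bounds b_bounds poly
  proof eventually_elim
    case (elim n)
    have n0: "0 < real n" "1 \<le> real n" "0 < n" using elim(11) by auto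
    have hb: "0 < h n" "0 < b n" using elim(13,14) n0 by (meson divide_pos_pos less_le_trans zero_less_one)+
    have es: "sqrt (\<epsilon> n * s) = sqrt s * sqrt (\<epsilon> n)" by (simp add: real_sqrt_mult)
    define W where "W = (1 - 5 * \<delta>) * (real n * h n ^ DIM('a) * \<delta>\<^sup>2 * (\<epsilon> n * s) / (4 * \<kappa>))"
    define e where "e = exp (- (1 - 5 * \<delta>) * q ^ 6 * V n)"
    have V0: "0 \<le> V n" using elim(4) q by (auto intro: order_trans[rotated])
    have q6: "(1 - 5 * \<delta>) * q ^ 6 \<le> 1"
      using \<delta> q mult_mono[of "1 - 5 * \<delta>" 1 "q ^ 6" 1] power_le_one[of q 6] by simp
    have VW: "V n \<le> W" using elim(9) by (simp add: W_def mult_ac)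
    have W: "exp (- W) \<le> e"
      unfolding e_def exp_le_cancel_iff mult_minus_left using VW mult_right_mono[OF q6 V0] by linarith
    have "prob (miss n (h n) (b n) (\<epsilon> n) (\<rho> n) C) \<le> exp (- W) +
      ((4 * real n / B * b n ^ DIM('a) + 1 / (q ^ 3 * (\<rho> n * sqrt (\<epsilon> n * s)))) * e
      + 2 / (\<epsilon> n * s) * exp (- W)) / (v * \<eta> n ^ DIM('a))"
      unfolding W_def e_def q_def v_def V_def
    proof (rule prob_miss_le)
      show "A2 * (h n)\<^sup>2 \<le> \<delta>\<^sup>2 * (\<epsilon> n * s) / 2"
      proof -
        have "(h n)\<^sup>2 \<le> h n" using hb elim(13) by (simp add: power2_eq_square mult_left_le)
        then have "A2 * (h n)\<^sup>2 \<le> A2 * h n" using nonneg by (intro mult_left_mono) auto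
        with elim(6) show ?thesis by (simp add: mult_ac)
      qed
      show "1 \<le> 2 * (1 - \<delta>) ^ 6 * (real n * b n ^ DIM('a) * (\<rho> n)\<^sup>2 / (2 * \<kappa>))"
        using elim(4) q unfolding V_def q_def by (simp add: field_simps)
      show "\<rho> n * B \<le> \<delta> * \<kappa> * sqrt (\<epsilon> n * s)" unfolding es using elim(1) by (simp add: mult_ac)
      show "A1 * b n \<le> \<delta> * \<kappa> * (\<epsilon> n * s)" using elim(2) by (simp add: mult_ac)
      show "A2 * (b n)\<^sup>2 \<le> \<delta> * (1 - \<delta>) ^ 3 * (\<rho> n * sqrt (\<epsilon> n * s))"
        unfolding es using elim(3) by (simp add: q_def mult_ac)
      show "A1 * h n \<le> \<delta> * \<kappa> * (\<epsilon> n * s) / 2" using elim(5) by (simp add: mult_ac)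
      show "G * \<eta> n + L / h n ^ DIM('a) * (\<eta> n / h n) powr \<alpha> \<le> (1 - \<delta>) * \<delta> * (\<epsilon> n * s) / 2"
        using elim(7) by (simp add: q_def mult_ac)
      show "G * \<eta> n + L / b n ^ DIM('a) * (\<eta> n / b n) powr \<alpha> \<le> \<delta> * (1 - \<delta>)\<^sup>2 * (\<rho> n * sqrt (\<epsilon> n * s))"
        unfolding es using elim(8) by (simp add: q_def mult_ac)
      show "0 < \<eta> n" using n0 by (simp add: \<eta>_def)
    qed (use n0 hb elim x0 fs s \<delta> in \<open>auto simp: less_imp_le\<close>)
    also have "\<dots> \<le> 1 * e + ((4 / B * real n + 1 / (q ^ 3 * sqrt s) * real n) * e + (2 / s * real n) * e) / (v * \<eta> n ^ DIM('a))"
    proof -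
      have i1: "4 * real n / B * b n ^ DIM('a) \<le> 4 / B * real n"
        using B_pos n0 power_le_one[of "b n" "DIM('a)"] hb elim(14) by (simp add: divide_right_mono mult_left_le)
      have inv: "1 / (\<rho> n * sqrt (\<epsilon> n)) \<le> real n" "1 / \<epsilon> n \<le> real n"
        using elim(15,12) n0 by (auto simp: field_simps)
      have "1 / (q ^ 3 * (\<rho> n * sqrt (\<epsilon> n * s))) = 1 / (q ^ 3 * sqrt s) * (1 / (\<rho> n * sqrt (\<epsilon> n)))"
        unfolding es by simp
      also have "\<dots> \<le> 1 / (q ^ 3 * sqrt s) * real n"
        using q rs inv by (intro mult_left_mono) auto
      finally have i2: "1 / (q ^ 3 * (\<rho> n * sqrt (\<epsilon> n * s))) \<le> 1 / (q ^ 3 * sqrt s) * real n" .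
      have "2 / (\<epsilon> n * s) = 2 / s * (1 / \<epsilon> n)" by (simp add: mult_ac)
      also have "\<dots> \<le> 2 / s * real n" using s inv by (intro mult_left_mono) auto
      finally have i3: "2 / (\<epsilon> n * s) \<le> 2 / s * real n" .
      have "(4 * real n / B * b n ^ DIM('a) + 1 / (q ^ 3 * (\<rho> n * sqrt (\<epsilon> n * s)))) * e
          \<le> (4 / B * real n + 1 / (q ^ 3 * sqrt s) * real n) * e"
        by (rule mult_right_mono[OF add_mono[OF i1 i2]]) (simp add: e_def)
      moreover have "2 / (\<epsilon> n * s) * exp (- W) \<le> (2 / s * real n) * e"
        using i3 W s n0 by (intro mult_mono) auto
      ultimately show ?thesis
        using W v by (intro add_mono divide_right_mono) (auto simp: \<eta>_def)
    qed
    also have "\<dots> = (1 + k * (real n / \<eta> n ^ DIM('a))) * e"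
      using v by (simp add: k_def field_simps)
    also have "real n / \<eta> n ^ DIM('a) = real n powr (1 + p * DIM('a))"
      using elim(11) by (rule eta_ratio)
    also have "(1 + k * real n powr (1 + p * DIM('a))) * e \<le> exp (\<delta> * V n) * e"
    proof (rule mult_right_mono)
      have "0 \<le> 1 + p * DIM('a)" using alpha_pos by (simp add: p_def)
      then have "1 \<le> real n powr (1 + p * DIM('a))" using n0 by (intro ge_one_powr_ge_zero) auto
      with elim(10) show "1 + k * real n powr (1 + p * DIM('a)) \<le> exp (\<delta> * V n)" by (simp add: distrib_right)
    qed (simp add: e_def)
    also have "\<dots> = exp (- ((1 - 5 * \<delta>) * q ^ 6 - \<delta>) * V n)"
      by (simp add: e_def algebra_simps flip: exp_add)
    also have "\<dots> \<le> exp (- (1 - 12 * \<delta>) * V n)"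
    proof -
      have "1 + real 6 * (- \<delta>) \<le> (1 + (- \<delta>)) ^ 6" using \<delta> by (intro Bernoulli_inequality) auto
      then have "1 - 6 * \<delta> \<le> q ^ 6" by (simp add: q_def)
      then have "(1 - 5 * \<delta>) * (1 - 6 * \<delta>) \<le> (1 - 5 * \<delta>) * q ^ 6" using \<delta> by (intro mult_left_mono) auto
      moreover have "(1 - 5 * \<delta>) * (1 - 6 * \<delta>) = 1 - 11 * \<delta> + 30 * \<delta>\<^sup>2" by (simp add: power2_eq_square algebra_simps)
      ultimately have "1 - 12 * \<delta> \<le> (1 - 5 * \<delta>) * q ^ 6 - \<delta>"
        using zero_le_power2[of \<delta>] by linarith
      then have "(1 - 12 * \<delta>) * V n \<le> ((1 - 5 * \<delta>) * q ^ 6 - \<delta>) * V n" using V0 by (rule mult_right_mono)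
      then show ?thesis unfolding exp_le_cancel_iff mult_minus_left by linarith
    qed
    finally show ?case .
  qed
qed

lemma eventually_prob_miss_ge:
  assumes \<gamma>: "0 < \<gamma>" "\<gamma> \<le> 1"
  shows "eventually (\<lambda>n. exp (- (1 + 22 * \<gamma>) * V n) \<le> prob (miss n (h n) (b n) (\<epsilon> n) (\<rho> n) C)) sequentially"
proof -
  define \<delta> where "\<delta> = \<gamma>\<^sup>2 / 136"
  define w where "w n = \<rho> n * sqrt ((1 + \<gamma>) * f z)" for n
  define \<tau>0 where "\<tau>0 = F + 10 * (\<gamma> * f z) * B / \<kappa>"
  define \<tau>1 where "\<tau>1 = F + 10 * 1 * B / \<kappa>"
  define v where "v = unit_ball_vol (real DIM('a))"
  have v: "0 < v" by (simp add: v_def)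
  have \<delta>: "0 < \<delta>" using \<gamma> by (simp add: \<delta>_def)
  have \<tau>: "0 < \<tau>0" "0 < \<tau>1" unfolding \<tau>0_def \<tau>1_def
    using F_nonneg B_pos kappa_pos \<gamma> z by (auto intro!: add_nonneg_pos)
  have \<kappa>f: "0 < \<delta> * (\<kappa> * f z)" using \<delta> kappa_pos z by simp
  have s0: "0 < sqrt ((1 + \<gamma>) * f z)" using \<gamma> z by simp
  have sqrt_lim: "(\<lambda>n. sqrt (\<epsilon> n)) \<longlonglongrightarrow> 0" using tendsto_real_sqrt[OF \<epsilon>_lim] by simp
  have \<rho>0: "\<rho> \<longlonglongrightarrow> 0"
  proof (rule Lim_transform_eventually)
    show "(\<lambda>n. \<rho> n / sqrt (\<epsilon> n) * sqrt (\<epsilon> n)) \<longlonglongrightarrow> 0" using tendsto_mult[OF \<rho>_lim sqrt_lim] by simp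
  qed (use pos in \<open>auto elim!: eventually_mono\<close>)
  have b0: "b \<longlonglongrightarrow> 0"
  proof (rule Lim_transform_eventually)
    show "(\<lambda>n. b n / \<epsilon> n * \<epsilon> n) \<longlonglongrightarrow> 0" using tendsto_mult[OF b_lim \<epsilon>_lim] by simp
  qed (use pos in \<open>auto elim!: eventually_mono\<close>)
  have h0: "h \<longlonglongrightarrow> 0"
  proof (rule Lim_transform_eventually)
    show "(\<lambda>n. h n / \<epsilon> n * \<epsilon> n) \<longlonglongrightarrow> 0" using tendsto_mult[OF h_lim \<epsilon>_lim] by simp
  qed (use pos in \<open>auto elim!: eventually_mono\<close>)
  have b20: "(\<lambda>n. (b n)\<^sup>2 / \<rho> n) \<longlonglongrightarrow> 0"
  proof (rule Lim_transform_eventually)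
    show "(\<lambda>n. (b n)\<^sup>2 / (\<rho> n * sqrt (\<epsilon> n)) * sqrt (\<epsilon> n)) \<longlonglongrightarrow> 0" using tendsto_mult[OF b2_lim sqrt_lim] by simp
  qed (use pos in \<open>auto elim!: eventually_mono\<close>)
  have small: "eventually (\<lambda>n. k * x n \<le> c) sequentially" if "x \<longlonglongrightarrow> 0" "0 < c" for x and k c :: real
    using eventually_mult_le_if_ratio_tendsto_0[of x "\<lambda>_. 1" c k] that by simp
  have 1: "eventually (\<lambda>n. (F + 2) * \<epsilon> n \<le> (1 + \<gamma>) * f z) sequentially"
    using \<epsilon>_lim by (rule small) (use \<gamma> z in auto)
  have 2: "eventually (\<lambda>n. (3 * sqrt ((1 + \<gamma>) * f z) * B) * \<rho> n \<le> \<delta> * (\<kappa> * f z)) sequentially"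
    using \<rho>0 \<kappa>f by (rule small)
  have 3: "eventually (\<lambda>n. A1 * b n \<le> \<delta> * (\<kappa> * f z)) sequentially"
    using b0 \<kappa>f by (rule small)
  have 4: "eventually (\<lambda>n. A2 * (b n)\<^sup>2 \<le> \<delta> * sqrt ((1 + \<gamma>) * f z) * \<rho> n) sequentially"
    by (rule eventually_mult_le_if_ratio_tendsto_0[OF b20])
       (use pos \<delta> s0 in \<open>auto elim: eventually_mono\<close>)
  have 5: "eventually (\<lambda>n. 36 * F\<^sup>2 * b n \<le> \<delta> * (\<kappa> * f z)) sequentially"
    using b0 \<kappa>f by (rule small)
  have 6: "eventually (\<lambda>n. (6 * sqrt ((1 + \<gamma>) * f z) * F) * \<rho> n \<le> \<kappa> * f z) sequentially"
    using \<rho>0 by (rule small) (use kappa_pos z in auto)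
  have 7: "eventually (\<lambda>n. A1 * h n \<le> \<kappa> * \<tau>0 / 10) sequentially" "eventually (\<lambda>n. A1 * h n \<le> \<kappa> * \<tau>1 / 10) sequentially"
    by (rule small[OF h0]; use kappa_pos \<tau> in auto)+
  have 8: "eventually (\<lambda>n. A2 * h n \<le> \<gamma> * f z / 10) sequentially" "eventually (\<lambda>n. A2 * h n \<le> 1 / 10) sequentially"
    by (rule small[OF h0]; use \<gamma> z in auto)+
  have nh: "eventually (\<lambda>n. V n \<le> c * (real n * h n ^ DIM('a))) sequentially" if "0 < c" for c
    using eventually_V_le_h[OF that] pos h_bounds
  proof eventually_elim
    case (elim n)
    have "0 \<le> h n" using elim(3) by (meson divide_nonneg_nonneg of_nat_0_le_iff order_trans zero_le_one)
    then have "c * (real n * h n ^ DIM('a)) * \<epsilon> n \<le> c * (real n * h n ^ DIM('a)) * 1"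
      using elim that by (intro mult_left_mono) auto
    with elim show ?case by (simp add: mult_ac)
  qed
  define c0 where "c0 = (\<gamma> * f z)\<^sup>2 / (4 * \<kappa> * \<tau>0)"
  define c1 where "c1 = 1 / (4 * \<kappa> * \<tau>1)"
  have c: "0 < c0" "0 < c1" using \<gamma> z kappa_pos \<tau> by (auto simp: c0_def c1_def)
  \<comment> \<open>\<open>c0\<close> and \<open>c1\<close> times n h^d are the exponents of the two
    pilot overshoots. Being at least 24 V they leave exp(- 23 V) after the prefactors are paid with
    exp V, and this is smaller by exp(- V) than the main term, whose exponent is at most 22
    V.\<close>
  have 9: "eventually (\<lambda>n. V n \<le> c0 / 24 * (real n * h n ^ DIM('a))) sequentially"
    "eventually (\<lambda>n. V n \<le> c1 / 24 * (real n * h n ^ DIM('a))) sequentially"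
    by (rule nh; use c in simp)+
  have 10: "eventually (\<lambda>n. 1 \<le> V n) sequentially" "eventually (\<lambda>n. 4 / \<gamma>\<^sup>2 \<le> V n) sequentially"
      "eventually (\<lambda>n. 2 / \<gamma> \<le> V n) sequentially" "eventually (\<lambda>n. 3 \<le> V n) sequentially"
    by (rule eventually_V_ge)+
  have 11: "eventually (\<lambda>n. L * real n powr (- 3) \<le> 1) sequentially"
    by (rule small) (auto intro!: tendsto_neg_powr filterlim_real_sequentially)
  have 12: "eventually (\<lambda>n. (4 / B * F) * real n powr 1 \<le> exp (1 * V n)) sequentially"
    "eventually (\<lambda>n. (4 / B / v) * real n powr (1 + p * DIM('a)) \<le> exp (1 * V n)) sequentially"
    by (rule eventually_powr_le_exp[OF V_lim]; simp)+
  have 13: "eventually (\<lambda>n. 1 \<le> n) sequentially" by (rule eventually_ge_at_top)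
  show ?thesis
    using 1 2 3 4 5 6 7 8 9 10 11 12 13 pos h_bounds b_bounds
  proof eventually_elim
    case (elim n)
    have n0: "0 < real n" "1 \<le> real n" "0 < n" using elim(20) by auto
    have hb: "0 < h n" "0 < b n" "h n \<le> 1" "b n \<le> 1"
      using elim(22,23) n0 by (meson divide_pos_pos less_le_trans zero_less_one)+
    have bd1: "b n ^ DIM('a) \<le> b n" "b n ^ DIM('a) \<le> 1" "h n ^ DIM('a) \<le> 1"
      using hb power_decreasing[of 1 "DIM('a)" "b n"] by (auto simp: power_le_one DIM_positive Suc_leI)
    have h2: "A2 * (h n)\<^sup>2 \<le> A2 * h n"
      using hb nonneg by (intro mult_left_mono) (auto simp: power2_eq_square mult_left_le)
    have V0: "0 < V n" using elim(13) by simp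
    define N where "N = real n * h n ^ DIM('a)"
    have N: "24 * V n \<le> c0 * N" "24 * V n \<le> c1 * N" "0 \<le> N" using elim(11,12) hb by (auto simp: N_def)
    have "exp (- (1 + 10 * \<gamma>) * (1 + \<gamma>) * V n) \<le> prob (miss n (h n) (b n) (\<epsilon> n) (\<rho> n) C)
     + 4 * real n / B * h n ^ DIM('a) * F * exp (- (real n * h n ^ DIM('a) * (\<gamma> * f z)\<^sup>2 / (4 * \<kappa> * \<tau>0)))
     + 4 * real n / B * h n ^ DIM('a) * exp (- (real n * h n ^ DIM('a) * 1\<^sup>2 / (4 * \<kappa> * \<tau>1))) / (v * \<eta> n ^ DIM('a))"
      unfolding v_def V_def \<tau>0_def \<tau>1_def
    proof (rule prob_miss_ge)
      show "3 * (\<rho> n * sqrt ((1 + \<gamma>) * f z)) * B \<le> \<gamma>\<^sup>2 / 136 * (\<kappa> * f z)"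
        using elim(2) by (simp add: \<delta>_def mult_ac)
      show "A2 * (b n)\<^sup>2 \<le> \<gamma>\<^sup>2 / 136 * (\<rho> n * sqrt ((1 + \<gamma>) * f z))"
        using elim(4) by (simp add: \<delta>_def mult_ac)
      show "A1 * b n \<le> \<gamma>\<^sup>2 / 136 * (\<kappa> * f z)" using elim(3) by (simp add: \<delta>_def)
      have "36 * F\<^sup>2 * b n ^ DIM('a) \<le> 36 * F\<^sup>2 * b n" using bd1 by (intro mult_left_mono) auto
      then show "36 * F\<^sup>2 * b n ^ DIM('a) \<le> \<gamma>\<^sup>2 / 136 * (\<kappa> * f z)" using elim(5) by (simp add: \<delta>_def)
      have "6 * (\<rho> n * sqrt ((1 + \<gamma>) * f z)) * F * b n ^ DIM('a) \<le> 6 * (\<rho> n * sqrt ((1 + \<gamma>) * f z)) * F * 1"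
        using bd1 elim(21) s0 F_nonneg by (intro mult_left_mono) auto
      then show "6 * (\<rho> n * sqrt ((1 + \<gamma>) * f z)) * F * b n ^ DIM('a) \<le> \<kappa> * f z" using elim(6) by (simp add: mult_ac)
      have "8 \<le> 2 * V n * \<gamma>\<^sup>2" using elim(14) \<gamma> by (simp add: field_simps)
      then show "8 \<le> 2 * (real n * b n ^ DIM('a) * (\<rho> n)\<^sup>2 / (2 * \<kappa>)) * \<gamma>\<^sup>2" unfolding V_def .
      show "\<epsilon> n * (F + 2) \<le> (1 + \<gamma>) * f z" using elim(1) by (simp add: mult.commute)
      show "A2 * (h n)\<^sup>2 \<le> \<gamma> * f z / 10" "A2 * (h n)\<^sup>2 \<le> 1 / 10" using elim(9,10) h2 by auto
      show "A1 * h n \<le> \<kappa> * (F + 10 * (\<gamma> * f z) * B / \<kappa>) / 10" "A1 * h n \<le> \<kappa> * (F + 10 * 1 * B / \<kappa>) / 10"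
        using elim(7,8) by (simp_all add: \<tau>0_def \<tau>1_def)
      have "1 / 4 \<le> c0 * N" "1 / 4 \<le> c1 * N" using N elim(13) by linarith+
      then show "\<kappa> * (F + 10 * (\<gamma> * f z) * B / \<kappa>) \<le> real n * h n ^ DIM('a) * (\<gamma> * f z)\<^sup>2"
        "\<kappa> * (F + 10 * 1 * B / \<kappa>) \<le> real n * h n ^ DIM('a) * 1\<^sup>2"
        unfolding \<tau>0_def[symmetric] \<tau>1_def[symmetric] N_def[symmetric] c0_def c1_def
        using kappa_pos \<tau> by (simp_all add: field_simps)
      show "L / h n ^ DIM('a) * (\<eta> n / h n) powr \<alpha> \<le> 1"
        using holder_err_le(1)[OF elim(20), of "h n"] elim(17,22) by linarith
      show "0 < \<eta> n" using n0 by (simp add: \<eta>_def)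
    qed (use n0 hb elim(21) z \<gamma> in auto)
    also have "4 * real n / B * h n ^ DIM('a) * F * exp (- (real n * h n ^ DIM('a) * (\<gamma> * f z)\<^sup>2 / (4 * \<kappa> * \<tau>0))) \<le> exp (- 23 * V n)"
    proof -
      have "4 * real n / B * h n ^ DIM('a) * F * exp (- (real n * h n ^ DIM('a) * (\<gamma> * f z)\<^sup>2 / (4 * \<kappa> * \<tau>0)))
         = (4 * real n / B * F) * h n ^ DIM('a) * exp (- (c0 * N))"
        by (simp add: c0_def N_def)
      also have "\<dots> \<le> (4 * real n / B * F) * 1 * exp (- (24 * V n))"
        using B_pos F_nonneg n0 bd1 N hb by (intro mult_mono) auto
      also have "\<dots> \<le> exp (1 * V n) * exp (- (24 * V n))"
        using elim(18) by (intro mult_right_mono) (auto simp: mult_ac)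
      also have "\<dots> = exp (- 23 * V n)" by (simp flip: exp_add)
      finally show ?thesis .
    qed
    also have "4 * real n / B * h n ^ DIM('a) * exp (- (real n * h n ^ DIM('a) * 1\<^sup>2 / (4 * \<kappa> * \<tau>1))) / (v * \<eta> n ^ DIM('a)) \<le> exp (- 23 * V n)"
    proof -
      have "4 * real n / B * h n ^ DIM('a) * exp (- (real n * h n ^ DIM('a) * 1\<^sup>2 / (4 * \<kappa> * \<tau>1))) / (v * \<eta> n ^ DIM('a))
         = (4 / B / v * (real n / \<eta> n ^ DIM('a))) * h n ^ DIM('a) * exp (- (c1 * N))"
        by (simp add: c1_def N_def)
      also have "real n / \<eta> n ^ DIM('a) = real n powr (1 + p * DIM('a))"
        using elim(20) by (rule eta_ratio)
      also have "(4 / B / v * real n powr (1 + p * DIM('a))) * h n ^ DIM('a) * exp (- (c1 * N))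
         \<le> exp (1 * V n) * 1 * exp (- (24 * V n))"
        using elim(19) B_pos v bd1 N hb by (intro mult_mono) auto
      also have "\<dots> = exp (- 23 * V n)" by (simp flip: exp_add)
      finally show ?thesis .
    qed
    finally have main: "exp (- (1 + 10 * \<gamma>) * (1 + \<gamma>) * V n) \<le> prob (miss n (h n) (b n) (\<epsilon> n) (\<rho> n) C) + exp (- 23 * V n) + exp (- 23 * V n)"
      by linarith
    \<comment> \<open>Expanding (1 + 10 \<gamma>)(1 + \<gamma>) with \<gamma>^2 \<le> \<gamma> gives
      21 \<gamma>. The two error terms take at most half of E, and one further \<gamma> V pays for
      this factor 1/2.\<close>
    define E where "E = exp (- (1 + 21 * \<gamma>) * V n)"
    have g: "(1 + 10 * \<gamma>) * (1 + \<gamma>) \<le> 1 + 21 * \<gamma>" using \<gamma> mult_left_mono[of \<gamma> 1 \<gamma>] by (simp add: algebra_simps)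
    have "E \<le> exp (- (1 + 10 * \<gamma>) * (1 + \<gamma>) * V n)"
      unfolding E_def exp_le_cancel_iff mult_minus_left using mult_right_mono[OF g less_imp_le[OF V0]] by linarith
    moreover have "4 * exp (- 23 * V n) \<le> E"
    proof -
      have "4 \<le> exp (V n)" using exp_ge_add_one_self[of "V n"] elim(16) by linarith
      then have "4 * exp (- 23 * V n) \<le> exp (V n) * exp (- 23 * V n)" by (intro mult_right_mono) auto
      also have "\<dots> = exp (- 22 * V n)" by (simp flip: exp_add)
      also have "\<dots> \<le> E"
      proof -
        have "(1 + 21 * \<gamma>) * V n \<le> 22 * V n" using \<gamma> V0 by (intro mult_right_mono) auto
        then show ?thesis unfolding E_def exp_le_cancel_iff mult_minus_left by linarith
      qed
      finally show ?thesis .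
    qed
    ultimately have "E / 2 \<le> prob (miss n (h n) (b n) (\<epsilon> n) (\<rho> n) C)" using main by linarith
    moreover have "exp (- (1 + 22 * \<gamma>) * V n) \<le> E / 2"
    proof -
      have "2 \<le> \<gamma> * V n" using elim(15) \<gamma> by (simp add: field_simps)
      then have "2 \<le> exp (\<gamma> * V n)" using exp_ge_add_one_self[of "\<gamma> * V n"] by linarith
      then have "2 * exp (- (1 + 22 * \<gamma>) * V n) \<le> exp (\<gamma> * V n) * exp (- (1 + 22 * \<gamma>) * V n)" by (intro mult_right_mono) auto
      also have "\<dots> = E" by (simp add: E_def algebra_simps flip: exp_add)
      finally show ?thesis by simp
    qed
    ultimately show ?case by linarith
  qed
qed

theorem log_prob_miss_tendsto:
  "(\<lambda>n. 1 / V n * ln (prob (miss n (h n) (b n) (\<epsilon> n) (\<rho> n) C))) \<longlonglongrightarrow> -1"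
proof (rule tendstoI)
  fix e :: real assume e: "0 < e"
  define \<delta> where "\<delta> = min (1 / 10) (e / 24)"
  define \<gamma> where "\<gamma> = min 1 (e / 44)"
  have \<delta>: "0 < \<delta>" "\<delta> < 1 / 5" "12 * \<delta> < e" and \<gamma>: "0 < \<gamma>" "\<gamma> \<le> 1" "22 * \<gamma> < e"
    using e by (auto simp: \<delta>_def \<gamma>_def)
  show "eventually (\<lambda>n. dist (1 / V n * ln (prob (miss n (h n) (b n) (\<epsilon> n) (\<rho> n) C))) (- 1) < e) sequentially"
    using eventually_prob_miss_le[OF \<delta>(1,2)] eventually_prob_miss_ge[OF \<gamma>(1,2)] eventually_V_ge[of 1]
  proof eventually_elim
    case (elim n)
    let ?P = "prob (miss n (h n) (b n) (\<epsilon> n) (\<rho> n) C)"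
    \<comment> \<open>Positivity has to come from the lower bound: \<open>ln 0\<close> is 0, which
      would break the comparison of logarithms.\<close>
    have P0: "0 < ?P" using elim(2) exp_gt_zero less_le_trans by blast
    have "ln ?P \<le> - (1 - 12 * \<delta>) * V n" using elim(1) P0 ln_le_cancel_iff[OF P0, of "exp (- (1 - 12 * \<delta>) * V n)"] by simp
    moreover have "- (1 + 22 * \<gamma>) * V n \<le> ln ?P" using elim(2) P0 ln_ge_iff[OF P0] by blast
    ultimately have "1 / V n * ln ?P \<le> - (1 - 12 * \<delta>)" "- (1 + 22 * \<gamma>) \<le> 1 / V n * ln ?P"
      using elim(3) by (auto simp: field_simps)
    with \<delta> \<gamma> show ?case by (simp add: dist_real_def abs_less_iff)
  qed
qed

end

section \<open>Bias, variance and bandwidths\<close>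

text \<open>On a convex set and not only on the whole space, so that the Taylor estimate can apply
  it to a segment.\<close>

lemma gderiv_imp_lipschitz:
  fixes f :: "'a::euclidean_space \<Rightarrow> real"
  assumes S: "convex S" and "\<And>x. x \<in> S \<Longrightarrow> GDERIV f x :> Df x" and "\<And>x. x \<in> S \<Longrightarrow> norm (Df x) \<le> G"
    and xy: "x \<in> S" "y \<in> S"
  shows "\<bar>f x - f y\<bar> \<le> G * dist x y"
proof -
  have "norm (f x - f y) \<le> G * norm (x - y)"
  proof (rule differentiable_bound[OF S _ _ xy])
    fix u assume u: "u \<in> S"
    show "(f has_derivative (\<lambda>h. h \<bullet> Df u)) (at u within S)"
      using assms(2)[OF u] by (auto simp: gderiv_def intro: has_derivative_at_withinI)
    show "onorm (\<lambda>h. h \<bullet> Df u) \<le> G"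
    proof (rule order_trans[OF onorm_bound assms(3)[OF u]])
      show "norm (h \<bullet> Df u) \<le> norm (Df u) * norm h" for h
        using Cauchy_Schwarz_ineq2[of h "Df u"] by (simp add: mult.commute)
    qed simp
  qed
  then show ?thesis by (simp add: dist_norm)
qed

text \<open>Continuity of the second derivative is not assumed, so the integral form of the
  remainder is avoided: subtracting the linear map given by Df x leaves a function whose gradient on
  the segment is at most H times its length. This yields H in place of H / 2.\<close>

lemma gderiv_first_order_remainder:
  fixes f :: "'a::euclidean_space \<Rightarrow> real"
  assumes f: "\<And>x. GDERIV f x :> Df x" and Df: "\<And>x. (Df has_derivative D2f x) (at x)"
    and H: "\<And>x. onorm (D2f x) \<le> H"
  shows "\<bar>f y - f x - Df x \<bullet> (y - x)\<bar> \<le> H * (norm (y - x))\<^sup>2"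
proof -
  have lip: "norm (Df u - Df x) \<le> H * norm (u - x)" for u
    by (rule differentiable_bound[of UNIV Df D2f]) (use Df H in auto)
  have H0: "0 \<le> H" using H[of x] onorm_pos_le[OF has_derivative_bounded_linear[OF Df]] order_trans by blast
  have "\<bar>(f y - Df x \<bullet> y) - (f x - Df x \<bullet> x)\<bar> \<le> (H * norm (y - x)) * dist y x"
  proof (rule gderiv_imp_lipschitz[where S="closed_segment x y" and Df="\<lambda>u. Df u - Df x"])
    fix u assume u: "u \<in> closed_segment x y"
    have "((\<lambda>u. f u - Df x \<bullet> u) has_derivative (\<lambda>h. h \<bullet> Df u - Df x \<bullet> h)) (at u)"
      using f[of u] unfolding gderiv_def by (auto intro!: derivative_eq_intros)
    then show "GDERIV (\<lambda>u. f u - Df x \<bullet> u) u :> Df u - Df x"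
      by (simp add: gderiv_def inner_diff_right inner_commute)
    have "norm (u - x) \<le> norm (y - x)" using segment_bound(1)[OF u] by (simp add: norm_minus_commute)
    then have "H * norm (u - x) \<le> H * norm (y - x)" using H0 by (rule mult_left_mono)
    with lip[of u] show "norm (Df u - Df x) \<le> H * norm (y - x)" by simp
  qed auto
  then show ?thesis by (simp add: dist_norm power2_eq_square inner_diff_right algebra_simps)
qed

lemma kernel_bias_le:
  fixes f K :: "'a::euclidean_space \<Rightarrow> real"
  assumes K: "integrable lborel K" "(LINT z|lborel. K z) = 1" "\<And>z. 0 \<le> K z"
    and K1: "\<And>v. integrable lborel (\<lambda>z. (z \<bullet> v) * K z)" "\<And>v. (LINT z|lborel. (z \<bullet> v) * K z) = 0"
    and K2: "integrable lborel (\<lambda>z. (norm z)\<^sup>2 * K z)"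
    and f: "f \<in> borel_measurable borel" "\<And>x. 0 \<le> f x" "\<And>x. f x \<le> F"
    and rem: "\<And>x y. \<bar>f y - f x - Df x \<bullet> (y - x)\<bar> \<le> H * (norm (y - x))\<^sup>2"
  shows "\<bar>(LINT z|lborel. K z * f (x - b *\<^sub>R z)) - f x\<bar> \<le> H * (LINT z|lborel. (norm z)\<^sup>2 * K z) * b\<^sup>2"
proof -
  have [measurable]: "f \<in> borel_measurable borel" "K \<in> borel_measurable borel" using f(1) K(1) by auto
  have iKf: "integrable lborel (\<lambda>z. K z * f (x - b *\<^sub>R z))"
  proof (rule Bochner_Integration.integrable_bound[of _ "\<lambda>z. F * K z"])
    show "AE z in lborel. norm (K z * f (x - b *\<^sub>R z)) \<le> norm (F * K z)"
    proof (intro AE_I2)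
      fix z
      have "K z * f (x - b *\<^sub>R z) \<le> K z * F" using K(3) f(3) by (intro mult_left_mono) auto
      also have "\<dots> \<le> norm (F * K z)" by (simp add: mult.commute)
      finally show "norm (K z * f (x - b *\<^sub>R z)) \<le> norm (F * K z)" using K(3) f(2) by simp
    qed
  qed (use K in auto)
  \<comment> \<open>The first order Taylor term is added back; it integrates to zero because K is
    centred, and what remains is of order b^2.\<close>
  define g where "g z = K z * f (x - b *\<^sub>R z) - f x * K z + b * ((z \<bullet> Df x) * K z)" for z
  have ig: "integrable lborel g" unfolding g_def using iKf K(1) K1(1) by auto
  have "integral\<^sup>L lborel g = (LINT z|lborel. K z * f (x - b *\<^sub>R z)) - f x"
    unfolding g_def using iKf K(1,2) K1 by simp
  moreover have "\<bar>integral\<^sup>L lborel g\<bar> \<le> (LINT z|lborel. H * b\<^sup>2 * ((norm z)\<^sup>2 * K z))"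
  proof (rule order_trans[OF integral_abs_bound integral_mono])
    fix z
    have "g z = K z * (f (x - b *\<^sub>R z) - f x - Df x \<bullet> ((x - b *\<^sub>R z) - x))"
      by (simp add: g_def inner_commute algebra_simps)
    then have "\<bar>g z\<bar> = K z * \<bar>f (x - b *\<^sub>R z) - f x - Df x \<bullet> ((x - b *\<^sub>R z) - x)\<bar>"
      using K(3) by (simp add: abs_mult)
    also have "\<dots> \<le> K z * (H * (norm ((x - b *\<^sub>R z) - x))\<^sup>2)"
      using K(3) rem by (intro mult_left_mono)
    also have "\<dots> = H * b\<^sup>2 * ((norm z)\<^sup>2 * K z)" by (simp add: power_mult_distrib)
    finally show "\<bar>g z\<bar> \<le> H * b\<^sup>2 * ((norm z)\<^sup>2 * K z)" .
  qed (use ig K2 in auto)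
  ultimately show ?thesis
    unfolding Bochner_Integration.integral_mult_right_zero by (simp only: mult_ac)
qed

text \<open>K^2 need not be centred, so there is no cancellation and only the Lipschitz bound for f
  is available. With K^2 \<le> B K it reduces to the first absolute moment of K.\<close>

lemma kernel_second_moment_le:
  fixes f K :: "'a::euclidean_space \<Rightarrow> real"
  assumes K: "integrable lborel K" "\<And>z. 0 \<le> K z" "\<And>z. K z \<le> B"
    and K1: "integrable lborel (\<lambda>z. norm z * K z)"
    and f: "f \<in> borel_measurable borel" "\<And>x. 0 \<le> f x" "\<And>x. f x \<le> F"
    and lip: "\<And>x y. \<bar>f x - f y\<bar> \<le> G * dist x y" and b: "0 < b" and G: "0 \<le> G"
  shows "\<bar>(LINT z|lborel. (K z)\<^sup>2 * f (x - b *\<^sub>R z)) - (LINT z|lborel. (K z)\<^sup>2) * f x\<bar>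
    \<le> G * B * (LINT z|lborel. norm z * K z) * b"
proof -
  have [measurable]: "f \<in> borel_measurable borel" "K \<in> borel_measurable borel" using f(1) K(1) by auto
  have K2: "(K z)\<^sup>2 \<le> B * K z" for z using mult_right_mono[OF K(3) K(2), of z z] by (simp add: power2_eq_square)
  have iK2: "integrable lborel (\<lambda>z. (K z)\<^sup>2)"
    by (rule Bochner_Integration.integrable_bound[of _ "\<lambda>z. B * K z"])
       (use K K2 in \<open>auto intro!: AE_I2 intro: order_trans[OF _ abs_ge_self]\<close>)
  have iKf: "integrable lborel (\<lambda>z. (K z)\<^sup>2 * f (x - b *\<^sub>R z))"
  proof (rule Bochner_Integration.integrable_bound[of _ "\<lambda>z. F * (K z)\<^sup>2"])
    show "AE z in lborel. norm ((K z)\<^sup>2 * f (x - b *\<^sub>R z)) \<le> norm (F * (K z)\<^sup>2)"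
    proof (intro AE_I2)
      fix z
      have "(K z)\<^sup>2 * f (x - b *\<^sub>R z) \<le> (K z)\<^sup>2 * F" using f(3) by (intro mult_left_mono) auto
      also have "\<dots> \<le> norm (F * (K z)\<^sup>2)" by (simp add: mult.commute mult_right_mono)
      finally show "norm ((K z)\<^sup>2 * f (x - b *\<^sub>R z)) \<le> norm (F * (K z)\<^sup>2)" using f(2) by (simp add: abs_mult)
    qed
  qed (use iK2 in auto)
  define g where "g z = (K z)\<^sup>2 * f (x - b *\<^sub>R z) - f x * (K z)\<^sup>2" for z
  have ig: "integrable lborel g" unfolding g_def using iKf iK2 by auto
  have "integral\<^sup>L lborel g = (LINT z|lborel. (K z)\<^sup>2 * f (x - b *\<^sub>R z)) - (LINT z|lborel. (K z)\<^sup>2) * f x"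
    unfolding g_def using iKf iK2 by simp
  moreover have "\<bar>integral\<^sup>L lborel g\<bar> \<le> (LINT z|lborel. (G * B * b) * (norm z * K z))"
  proof (rule order_trans[OF integral_abs_bound integral_mono])
    fix z
    have "\<bar>g z\<bar> = (K z)\<^sup>2 * \<bar>f (x - b *\<^sub>R z) - f x\<bar>"
    proof -
      have "g z = (K z)\<^sup>2 * (f (x - b *\<^sub>R z) - f x)" by (simp add: g_def algebra_simps)
      then show ?thesis by (simp add: abs_mult)
    qed
    also have "\<dots> \<le> (B * K z) * (G * (b * norm z))"
    proof (rule mult_mono[OF K2])
      show "\<bar>f (x - b *\<^sub>R z) - f x\<bar> \<le> G * (b * norm z)"
        using lip[of "x - b *\<^sub>R z" x] b by (simp add: dist_norm)
      show "0 \<le> B * K z" using K2[of z] zero_le_power2 order_trans by blast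
    qed simp
    also have "\<dots> = (G * B * b) * (norm z * K z)" by simp
    finally show "\<bar>g z\<bar> \<le> (G * B * b) * (norm z * K z)" .
  qed (use ig K1 in auto)
  ultimately show ?thesis
    unfolding Bochner_Integration.integral_mult_right_zero by (simp only: mult_ac)
qed

lemma integrable_norm_mult_of_power2:
  fixes K :: "'a::euclidean_space \<Rightarrow> real"
  assumes K: "integrable lborel K" "\<And>z. 0 \<le> K z" and K2: "integrable lborel (\<lambda>z. (norm z)\<^sup>2 * K z)"
  shows "integrable lborel (\<lambda>z. norm z * K z)"
proof (rule Bochner_Integration.integrable_bound[of _ "\<lambda>z. K z + (norm z)\<^sup>2 * K z"])
  have [measurable]: "K \<in> borel_measurable borel" using K(1) by auto
  show "(\<lambda>z. norm z * K z) \<in> borel_measurable lborel" by measurable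
  show "AE z in lborel. norm (norm z * K z) \<le> norm (K z + (norm z)\<^sup>2 * K z)"
  proof (intro AE_I2)
    fix z :: 'a
    have "norm z \<le> 1 + (norm z)\<^sup>2" using zero_le_power2[of "norm z - 1/2"]
      by (simp add: power2_eq_square algebra_simps)
    then have "norm z * K z \<le> (1 + (norm z)\<^sup>2) * K z" using K(2) by (rule mult_right_mono)
    then show "norm (norm z * K z) \<le> norm (K z + (norm z)\<^sup>2 * K z)"
      using K(2)[of z] by (simp add: distrib_right)
  qed
qed (use K K2 in auto)

text \<open>Since n h^d = n^(4 \<beta>), \<rho> is c n^(-2 \<beta>) (ln n)^(1/2), and V is a n^(d (a
  - \<beta>)) ln n. The facts are the conditions of \<open>kde_band_asymptotics\<close> for these
  sequences: \<beta> < a expresses the lower restriction on a, and the gap d (a - \<beta>) < 4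
  \<beta> the upper one.\<close>

lemma bandwidth_asymptotics:
  fixes a e d \<beta> c :: real
  defines "\<beta> \<equiv> (1 - a * d) / 4"
  assumes d: "1 \<le> d" and a: "1 / (d + 4) < a" "a < (d + 4) / (d * (d + 8))" and e: "0 < e" "e < 1" and c: "0 < c"
  shows "0 < \<beta>" "\<beta> < a" "a < 1" "\<beta> < 1" "2 * \<beta> < 1" "d * (a - \<beta>) < 4 * \<beta>"
    and "(\<lambda>n::nat. ln (real n) powr (- e)) \<longlonglongrightarrow> 0"
    and "(\<lambda>n::nat. (c * real n powr (- (2 * \<beta>)) * ln (real n) powr (1 / 2)) / ln (real n) powr (- (e / 2))) \<longlonglongrightarrow> 0"
    and "(\<lambda>n::nat. real n powr (- \<beta>) / ln (real n) powr (- e)) \<longlonglongrightarrow> 0"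
    and "(\<lambda>n::nat. real n powr (- a) / ln (real n) powr (- e)) \<longlonglongrightarrow> 0"
    and "(\<lambda>n::nat. real n powr (- (2 * \<beta>)) /
           ((c * real n powr (- (2 * \<beta>)) * ln (real n) powr (1 / 2)) * ln (real n) powr (- (e / 2)))) \<longlonglongrightarrow> 0"
    and "filterlim (\<lambda>n::nat. real n powr (d * (a - \<beta>)) * (a * ln (real n)) / ln (real n)) at_top sequentially"
    and "filterlim (\<lambda>n::nat. real n powr (4 * \<beta>) * ln (real n) powr (- e) /
           (real n powr (d * (a - \<beta>)) * (a * ln (real n)))) at_top sequentially"
    and "eventually (\<lambda>n::nat. 1 / real n \<le> ln (real n) powr (- e)) sequentially"
    and "eventually (\<lambda>n::nat. 1 / real n \<le>
           (c * real n powr (- (2 * \<beta>)) * ln (real n) powr (1 / 2)) * ln (real n) powr (- (e / 2))) sequentially"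
proof -
  have d0: "0 < d * (d + 8)" "0 < d + 4" "0 < d" using d by auto
  have a0: "0 < a" using a(1) d0 by (meson divide_pos_pos less_trans zero_less_one)
  have a1: "a * (d * (d + 8)) < d + 4" using a(2) d0 by (simp add: pos_less_divide_eq)
  have a2: "1 < a * (d + 4)" using a(1) d0 by (simp add: pos_divide_less_eq)
  show b0: "0 < \<beta>"
  proof -
    have "(a * d) * (d + 8) < 1 * (d + 8)" using a1 by (simp add: mult_ac)
    then have "a * d < 1" by (rule mult_right_less_imp_less) (use d in auto)
    then show ?thesis by (simp add: \<beta>_def)
  qed
  have ad: "a * d < 1" using b0 by (simp add: \<beta>_def)
  have adp: "0 < a * d" using a0 d0 by simp
  show ba: "\<beta> < a" using a2 by (simp add: \<beta>_def algebra_simps)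
  show "a < 1" using ad mult_left_mono[OF d less_imp_le[OF a0]] by simp
  show "\<beta> < 1" "2 * \<beta> < 1" using adp by (auto simp: \<beta>_def)
  then have b2: "2 * \<beta> < 1" by simp
  \<comment> \<open>Multiplied by 4 and rearranged, this is a d (d + 8) < d + 4.\<close>
  show gap: "d * (a - \<beta>) < 4 * \<beta>"   proof -
    have "4 * (d * (a - \<beta>)) = 4 * (a * d) - d + a * d * d" "4 * (4 * \<beta>) = 4 - 4 * (a * d)"
      by (simp_all add: \<beta>_def field_simps)
    moreover have "a * d * d + 8 * (a * d) < d + 4" using a1 by (simp add: algebra_simps)
    ultimately show ?thesis by linarith
  qed
  define g where "g = d * (a - \<beta>)"
  have g: "0 < g" "g < 4 * \<beta>" using ba d0 gap by (auto simp: g_def)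
  show "(\<lambda>n::nat. ln (real n) powr (- e)) \<longlonglongrightarrow> 0" using e by real_asymp
  show "(\<lambda>n::nat. (c * real n powr (- (2 * \<beta>)) * ln (real n) powr (1 / 2)) / ln (real n) powr (- (e / 2))) \<longlonglongrightarrow> 0"
    using e b0 c by real_asymp
  show "(\<lambda>n::nat. real n powr (- \<beta>) / ln (real n) powr (- e)) \<longlonglongrightarrow> 0" using e b0 by real_asymp
  show "(\<lambda>n::nat. real n powr (- a) / ln (real n) powr (- e)) \<longlonglongrightarrow> 0" using e a0 by real_asymp
  show "(\<lambda>n::nat. real n powr (- (2 * \<beta>)) /
           ((c * real n powr (- (2 * \<beta>)) * ln (real n) powr (1 / 2)) * ln (real n) powr (- (e / 2)))) \<longlonglongrightarrow> 0"
    using e b0 c by real_asymp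
  show "filterlim (\<lambda>n::nat. real n powr (d * (a - \<beta>)) * (a * ln (real n)) / ln (real n)) at_top sequentially"
    unfolding g_def[symmetric] using g a0 by real_asymp
  show "filterlim (\<lambda>n::nat. real n powr (4 * \<beta>) * ln (real n) powr (- e) /
           (real n powr (d * (a - \<beta>)) * (a * ln (real n)))) at_top sequentially"
    unfolding g_def[symmetric] using g a0 b0 e by real_asymp
  show "eventually (\<lambda>n::nat. 1 / real n \<le> ln (real n) powr (- e)) sequentially" using e by real_asymp
  show "eventually (\<lambda>n::nat. 1 / real n \<le>
           (c * real n powr (- (2 * \<beta>)) * ln (real n) powr (1 / 2)) * ln (real n) powr (- (e / 2))) sequentially"
    using e b0 b2 c by real_asymp
qed

theorem mainTheorem7:
  fixes M :: "'b measure"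
    and X :: "nat \<Rightarrow> 'b \<Rightarrow> real ^ 'd"
    and f K :: "real ^ 'd \<Rightarrow> real"
    and Df :: "real ^ 'd \<Rightarrow> real ^ 'd"
    and D2f :: "real ^ 'd \<Rightarrow> real ^ 'd \<Rightarrow> real ^ 'd"
    and C :: "(real ^ 'd) set"
    and a e d :: real
    and h hs \<epsilon> :: "nat \<Rightarrow> real"
  assumes "prob_space M"
    and "prob_space.indep_vars M (\<lambda>_. borel) X {1..}"
    and "\<And>j. j \<ge> 1 \<Longrightarrow> distributed M lborel (X j) (\<lambda>x. ennreal (f x))"
    and "\<And>x. f x \<ge> 0" and "bounded (range f)"
    and "(K \<longlongrightarrow> 0) at_infinity"
    and i: "bounded (range K)" "\<And>z. K z \<ge> 0"
      "integrable lborel K" "(LINT z|lborel. K z) = 1"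
      "\<And>j. (LINT z|lborel. z $ j * K z) = 0"
      "integrable lborel (\<lambda>z. (norm z)\<^sup>2 * \<bar>K z\<bar>)"
    and ii: "holder_continuous K" "covering_number_condition K"
    and iii: "\<And>x. GDERIV f x :> Df x" "\<And>x. (Df has_derivative D2f x) (at x)"
      "bdd_above (range (\<lambda>x. norm (Df x)))" "bdd_above (range (\<lambda>x. onorm (D2f x)))"
    and iv: "(compact C \<and> (\<exists>x\<in>C. f x \<noteq> 0)) \<or>
      (C = UNIV \<and> (\<exists>q>0. bounded (range (\<lambda>z. norm z powr q * f z))))"
    and d: "d = real CARD('d)"
    and a: "a \<in> {1 / (d + 4) <..< (d + 4) / (d * (d + 8))}"
    and e: "e \<in> {0<..<1}"
    and h: "\<And>n. n \<ge> 3 \<Longrightarrow> h n = real n powr (- a)"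
    and hs: "\<And>n. n \<ge> 3 \<Longrightarrow> hs n = real n powr (- ((1 - a * d) / 4))"
    and eps: "\<And>n. n \<ge> 3 \<Longrightarrow> \<epsilon> n = (ln (real n)) powr (- e)"
  shows "(\<lambda>n. h n ^ CARD('d) / (hs n ^ CARD('d) * ln (1 / h n)) *
            ln (measure M {\<omega> \<in> space M. \<exists>x\<in>C. f x \<notin> conf_interval K X C h hs \<epsilon> n \<omega> x}))
          \<longlonglongrightarrow> -1"
proof -
  have Pr: "prob_space M" by fact
  obtain B where B: "0 < B" "\<And>z. \<bar>K z\<bar> \<le> B" using i(1) by (auto simp: bounded_pos)
  obtain F where F: "\<And>z. \<bar>f z\<bar> \<le> F" using \<open>bounded (range f)\<close> by (auto simp: bounded_pos)
  obtain \<alpha> L0 where holder: "0 < \<alpha>" "\<And>x y. \<bar>K x - K y\<bar> \<le> L0 * dist x y powr \<alpha>"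
    using ii(1) unfolding holder_continuous_def by blast
  obtain G where G: "\<And>x. norm (Df x) \<le> G" using iii(3) by (auto simp: bdd_above_def)
  obtain H where H: "\<And>x. onorm (D2f x) \<le> H" using iii(4) by (auto simp: bdd_above_def)
  have G0: "0 \<le> G" using G[of 0] norm_ge_zero order_trans by blast
  have H0: "0 \<le> H" using H[of 0] onorm_pos_le[OF has_derivative_bounded_linear[OF iii(2)]] order_trans by blast
  have f_lip: "\<bar>f x - f y\<bar> \<le> G * dist x y" for x y
    by (rule gderiv_imp_lipschitz[of UNIV f Df]) (use iii(1) G in auto)
  have rem: "\<bar>f y - f x - Df x \<bullet> (y - x)\<bar> \<le> H * (norm (y - x))\<^sup>2" for x y
    by (rule gderiv_first_order_remainder[OF iii(1,2) H])
  have K2: "integrable lborel (\<lambda>z. (norm z)\<^sup>2 * K z)" using i(6) i(2) by simp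
  note K1 = integrable_norm_mult_of_power2[OF i(3,2) K2]
  have K_borel [measurable]: "K \<in> borel_measurable borel" using i(3) by auto
  have "continuous_on UNIV f"
    using iii(1) by (auto simp: gderiv_def intro!: continuous_at_imp_continuous_on has_derivative_continuous)
  then have f_borel: "f \<in> borel_measurable borel" by (rule borel_measurable_continuous_onI)
  \<comment> \<open>A vanishing integral does not entail integrability, as the integral of a
    non-integrable function is 0. Integrability of the coordinates comes from the second
    moment.\<close>
  have coord: "integrable lborel (\<lambda>z. z $ j * K z)" for j
  proof (rule Bochner_Integration.integrable_bound[OF K1])
    show "AE z in lborel. norm (z $ j * K z) \<le> norm (norm z * K z)"
      using component_le_norm_cart i(2) by (intro AE_I2) (auto simp: abs_mult intro!: mult_right_mono)
  qed measurable
  have inner_eq: "(z \<bullet> v) * K z = (\<Sum>j\<in>UNIV. v $ j * (z $ j * K z))" for z v :: "real ^ 'd"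
    by (simp add: inner_vec_def sum_distrib_left mult_ac)
  have K1v: "integrable lborel (\<lambda>z. (z \<bullet> v) * K z)" "(LINT z|lborel. (z \<bullet> v) * K z) = 0" for v :: "real ^ 'd"
    unfolding inner_eq using coord i(5) by auto
  define \<kappa> where "\<kappa> = (LINT z|lborel. (K z)\<^sup>2)"
  have KK: "(K z)\<^sup>2 \<le> B * K z" for z
    using mult_right_mono[of "K z" B "K z"] B(2)[of z] i(2)[of z] by (simp add: power2_eq_square)
  have iK2: "integrable lborel (\<lambda>z. (K z)\<^sup>2)"
    by (rule Bochner_Integration.integrable_bound[of _ "\<lambda>z. B * K z"])
       (use i(3) KK in \<open>auto intro!: AE_I2 intro: order_trans[OF _ abs_ge_self]\<close>)
  have \<kappa>0: "0 < \<kappa>"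
  proof (rule ccontr)
    assume "\<not> 0 < \<kappa>"
    moreover have "0 \<le> \<kappa>" unfolding \<kappa>_def by (intro Bochner_Integration.integral_nonneg) auto
    ultimately have "\<kappa> = 0" by linarith
    then have "(LINT z|lborel. (K z)\<^sup>2) = 0" by (simp only: \<kappa>_def)
    then have "AE z in lborel. (K z)\<^sup>2 = 0" using iK2 by (subst (asm) integral_nonneg_eq_0_iff_AE) auto
    then have "AE z in lborel. K z = 0" by simp
    then have "(LINT z|lborel. K z) = 0" using integral_eq_zero_AE by blast
    then show False using i(4) by simp
  qed
  define A2 where "A2 = H * (LINT z|lborel. (norm z)\<^sup>2 * K z)"
  define A1 where "A1 = G * B * (LINT z|lborel. norm z * K z)"
  have A0: "0 \<le> A1" "0 \<le> A2"
    unfolding A1_def A2_def using G0 H0 B i(2) by (auto intro!: mult_nonneg_nonneg Bochner_Integration.integral_nonneg)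
  \<comment> \<open>The definition of Hoelder continuity puts no sign on its constant, hence the
    absolute value.\<close>
  interpret kde_model M X f K F G B A1 A2 \<kappa> "\<bar>L0\<bar>" \<alpha>
  proof (intro kde_model.intro[OF Pr] kde_model_axioms.intro)
    show "prob_space.indep_vars M (\<lambda>_. borel) X {1..}" by fact
    show "distributed M lborel (X j) (\<lambda>x. ennreal (f x))" if "j \<ge> 1" for j using assms(3) that .
    show "0 \<le> f x" for x by fact
    show "f x \<le> F" for x using F[of x] by simp
    show "\<bar>f x - f y\<bar> \<le> G * dist x y" for x y by (rule f_lip)
    show "0 \<le> K z" for z by (rule i(2))
    show "K z \<le> B" for z using B(2)[of z] by simp
    show "\<bar>K x - K y\<bar> \<le> \<bar>L0\<bar> * dist x y powr \<alpha>" for x y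
      using holder(2)[of x y] mult_right_mono[OF abs_ge_self[of L0], of "dist x y powr \<alpha>"] by simp
    show "\<bar>(LINT z|lborel. K z * f (x - b *\<^sub>R z)) - f x\<bar> \<le> A2 * b\<^sup>2" if "0 < b" for b x
      unfolding A2_def
      by (rule kernel_bias_le[where F=F and Df=Df]) (use i K1v K2 f_borel assms(4) F rem abs_le_D1 in auto)
    show "\<bar>(LINT z|lborel. (K z)\<^sup>2 * f (x - b *\<^sub>R z)) - \<kappa> * f x\<bar> \<le> A1 * b" if "0 < b" for b x
      unfolding A1_def \<kappa>_def
      by (rule kernel_second_moment_le[where F=F])
         (use i B K1 f_borel assms(4) F f_lip G0 that abs_le_D1 in auto)
  qed (use B holder i \<kappa>0 G0 A0 in auto)
  \<comment> \<open>If C is the whole space, such a point exists because f integrates to 1.\<close>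
  have "\<exists>z\<in>C. f z \<noteq> 0"
  proof (cases "compact C \<and> (\<exists>x\<in>C. f x \<noteq> 0)")
    case False
    then have "C = UNIV" using iv by auto
    moreover have "\<exists>z. f z \<noteq> 0" using nn_integral_f by (rule_tac ccontr) simp
    ultimately show ?thesis by blast
  qed auto
  then obtain z where z: "z \<in> C" "0 < f z" using f_nonneg less_eq_real_def by metis
  define \<beta> where "\<beta> = (1 - a * d) / 4"
  \<comment> \<open>With ln(1/h) = a ln n and n h^d = n^(4 \<beta>), this c turns c n^(-2 \<beta>)
    (ln n)^(1/2) into the root of 2 \<kappa> ln(1/h) / (n h^d).\<close>
  define c where "c = sqrt (2 * \<kappa> * a)"
  have d1: "1 \<le> d" unfolding d by simp
  have "0 < 1 / (d + 4)" using d1 by simp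
  also have "1 / (d + 4) < a" using a by simp
  finally have a0: "0 < a" .
  have c0: "0 < c" using \<kappa>0 a0 by (simp add: c_def)
  have as: "1 \<le> d" "1 / (d + 4) < a" "a < (d + 4) / (d * (d + 8))" "0 < e" "e < 1" "0 < c"
    using d1 a e c0 by auto
  note asym = bandwidth_asymptotics[OF as, folded \<beta>_def]
  have dim: "DIM(real ^ 'd) = CARD('d)" by simp
  define \<rho> where "\<rho> n = c * real n powr (- (2 * \<beta>)) * ln (real n) powr (1 / 2)" for n :: nat
  define V where "V n = real n * hs n ^ DIM(real ^ 'd) * (\<rho> n)\<^sup>2 / (2 * \<kappa>)" for n
  have l0: "0 < ln (real n)" if "3 \<le> n" for n :: nat using that by simp
  have hp: "h n ^ CARD('d) = real n powr (- (a * d))" "hs n ^ CARD('d) = real n powr (- (\<beta> * d))"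
    "ln (1 / h n) = a * ln (real n)" "0 < h n" if "3 \<le> n" for n
    using that by (auto simp: h hs d powr_power ln_div ln_powr \<beta>_def mult_ac)
  have nh: "real n * h n ^ CARD('d) = real n powr (4 * \<beta>)" if "3 \<le> n" for n
  proof -
    have "real n * h n ^ CARD('d) = real n powr 1 * real n powr (- (a * d))" using that by (simp add: hp)
    also have "\<dots> = real n powr (4 * \<beta>)" by (subst powr_add[symmetric]) (simp add: \<beta>_def diff_divide_distrib)
    finally show ?thesis .
  qed
  have V: "V n = real n powr (d * (a - \<beta>)) * (a * ln (real n))" if "3 \<le> n" for n
  proof -
    have "(\<rho> n)\<^sup>2 = (2 * \<kappa> * a) * real n powr (- (4 * \<beta>)) * ln (real n)"
      using that \<kappa>0 a0 l0[OF that] by (simp add: \<rho>_def c_def power_mult_distrib powr_power)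
    then have "V n = a * ln (real n) * (real n powr 1 * real n powr (- (\<beta> * d)) * real n powr (- (4 * \<beta>)))"
      using that \<kappa>0 by (simp add: V_def hp)
    also have "real n powr 1 * real n powr (- (\<beta> * d)) * real n powr (- (4 * \<beta>)) = real n powr (d * (a - \<beta>))"
      unfolding powr_add[symmetric] by (rule arg_cong[where f="\<lambda>x. real n powr x"]) (simp add: \<beta>_def field_simps)
    finally show ?thesis by simp
  qed
  have sqrt_eps: "sqrt (\<epsilon> n) = ln (real n) powr (- (e / 2))" if "3 \<le> n" for n
    using that l0[OF that] by (simp add: eps powr_half_sqrt[symmetric] powr_powr)
  have ev3: "eventually (\<lambda>n. 3 \<le> n) sequentially" by (rule eventually_ge_at_top)
  have ev3I: "(\<And>n. 3 \<le> n \<Longrightarrow> P n) \<Longrightarrow> eventually P sequentially" for P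
    using ev3 by (rule eventually_mono)
  have bnd: "1 / real n \<le> real n powr (- t) \<and> real n powr (- t) \<le> 1" if "3 \<le> n" "0 < t" "t < 1" for n :: nat and t
  proof
    have "real n powr (- 1) \<le> real n powr (- t)" using that by (intro powr_mono) auto
    then show "1 / real n \<le> real n powr (- t)" using that by (simp add: powr_minus_divide)
    have "real n powr (- t) \<le> real n powr 0" using that by (intro powr_mono) auto
    then show "real n powr (- t) \<le> 1" using that by simp
  qed
  have eps_lim: "\<epsilon> \<longlonglongrightarrow> 0"
    by (rule Lim_transform_eventually[OF asym(7) ev3I]) (simp add: eps)
  interpret kde_band_asymptotics M X f K F G B A1 A2 \<kappa> "\<bar>L0\<bar>" \<alpha> h hs \<epsilon> \<rho> V C z
  proof (intro kde_band_asymptotics.intro[OF kde_model_axioms] kde_band_asymptotics_axioms.intro)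
    show "z \<in> C" "0 < f z" by fact+
    show "V n = real n * hs n ^ DIM(real ^ 'd) * (\<rho> n)\<^sup>2 / (2 * \<kappa>)" for n by (rule V_def)
    show "eventually (\<lambda>n. 0 < \<rho> n \<and> 0 < \<epsilon> n \<and> \<epsilon> n \<le> 1) sequentially"
      using ev3 order_tendstoD(2)[OF eps_lim zero_less_one]
      by eventually_elim (use c0 l0 in \<open>auto simp: \<rho>_def eps\<close>)
    show "eventually (\<lambda>n. 1 / real n \<le> h n \<and> h n \<le> 1) sequentially"
      by (rule ev3I) (use bnd[OF _ a0 asym(3)] in \<open>simp add: h\<close>)
    show "eventually (\<lambda>n. 1 / real n \<le> hs n \<and> hs n \<le> 1) sequentially"
      by (rule ev3I) (use bnd[OF _ asym(1,4)] in \<open>simp add: hs \<beta>_def\<close>)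
    show "eventually (\<lambda>n. 1 / real n \<le> \<epsilon> n \<and> 1 / real n \<le> \<rho> n * sqrt (\<epsilon> n)) sequentially"
      using ev3 asym(14,15) by eventually_elim (simp add: sqrt_eps \<rho>_def, simp add: eps)
    show "\<epsilon> \<longlonglongrightarrow> 0" by (rule eps_lim)
    show "(\<lambda>n. \<rho> n / sqrt (\<epsilon> n)) \<longlonglongrightarrow> 0"
      by (rule Lim_transform_eventually[OF asym(8) ev3I]) (simp add: sqrt_eps \<rho>_def)
    show "(\<lambda>n. hs n / \<epsilon> n) \<longlonglongrightarrow> 0"
      by (rule Lim_transform_eventually[OF asym(9) ev3I]) (simp add: hs eps \<beta>_def)
    show "(\<lambda>n. h n / \<epsilon> n) \<longlonglongrightarrow> 0"
      by (rule Lim_transform_eventually[OF asym(10) ev3I]) (simp add: h eps)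
    show "(\<lambda>n. (hs n)\<^sup>2 / (\<rho> n * sqrt (\<epsilon> n))) \<longlonglongrightarrow> 0"
    proof (rule Lim_transform_eventually[OF asym(11) ev3I])
      fix n :: nat assume n: "3 \<le> n"
      then have "(hs n)\<^sup>2 = real n powr (- (2 * \<beta>))" by (simp add: hs powr_power flip: \<beta>_def)
      then show "real n powr (- (2 * \<beta>)) / (c * real n powr (- (2 * \<beta>)) * ln (real n) powr (1 / 2) * ln (real n) powr (- (e / 2)))
          = (hs n)\<^sup>2 / (\<rho> n * sqrt (\<epsilon> n))"
        using n by (simp add: sqrt_eps \<rho>_def)
    qed
    show "filterlim (\<lambda>n. V n / ln (real n)) at_top sequentially"
      using asym(12) by (rule filterlim_cong[OF refl refl, THEN iffD1, rotated]) (rule ev3I, simp add: V)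
    show "filterlim (\<lambda>n. real n * h n ^ DIM(real ^ 'd) * \<epsilon> n / V n) at_top sequentially"
      using asym(13) by (rule filterlim_cong[OF refl refl, THEN iffD1, rotated])
        (rule ev3I, simp only: V dim nh eps)
  qed
  have "measure M {\<omega> \<in> space M. \<exists>x\<in>C. f x \<notin> conf_interval K X C h hs \<epsilon> n \<omega> x} = prob (miss n (h n) (hs n) (\<epsilon> n) (\<rho> n) C)"
    if n: "3 \<le> n" for n
  proof (rule arg_cong[where f="measure M"])
    have kde: "kde K X g n \<omega> x = est n (g n) x \<omega>" for g \<omega> x
      by (simp add: kde_def est_def sumK_def)
    have "f x \<notin> conf_interval K X C h hs \<epsilon> n \<omega> x \<longleftrightarrow> \<rho> n * sqrt (trunc n (h n) (\<epsilon> n) C \<omega> x) < \<bar>est n (hs n) x \<omega> - f x\<bar>" for \<omega> x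
    proof -
      have T: "truncate_below (\<epsilon> n) C (kde K X h n \<omega>) x = trunc n (h n) (\<epsilon> n) C \<omega> x"
        by (auto simp: truncate_below_def trunc_def kde)
      have r: "sqrt (t * \<kappa>) / sqrt (real n * h n ^ DIM(real ^ 'd)) * sqrt (ln (1 / h n)) * sqrt 2 = \<rho> n * sqrt t" for t
      proof -
        have "sqrt (real n * h n ^ DIM(real ^ 'd)) = real n powr (2 * \<beta>)"
          unfolding dim nh[OF n] by (simp add: powr_half_sqrt[symmetric] powr_powr)
        moreover have "ln (real n) powr (1 / 2) = sqrt (ln (real n))" using l0[OF n] by (simp add: powr_half_sqrt)
        moreover have "ln (1 / h n) = a * ln (real n)" by (rule hp(3)[OF n])
        moreover have "real n powr (- (2 * \<beta>)) = 1 / real n powr (2 * \<beta>)" by (rule powr_minus_divide)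
        ultimately show ?thesis by (simp add: \<rho>_def c_def real_sqrt_mult)
      qed
      show ?thesis
        unfolding conf_interval_def Let_def T \<kappa>_def[symmetric] r kde by (auto simp: not_le abs_if)
    qed
    then show "{\<omega> \<in> space M. \<exists>x\<in>C. f x \<notin> conf_interval K X C h hs \<epsilon> n \<omega> x} = miss n (h n) (hs n) (\<epsilon> n) (\<rho> n) C"
      by (simp add: miss_def)
  qed
  moreover have "h n ^ CARD('d) / (hs n ^ CARD('d) * ln (1 / h n)) = 1 / V n" if n: "3 \<le> n" for n
  proof -
    have "real n powr (- (a * d)) / real n powr (- (\<beta> * d)) = real n powr (- (a * d) - - (\<beta> * d))"
      by (rule powr_diff[symmetric])
    also have "- (a * d) - - (\<beta> * d) = - (d * (a - \<beta>))" by (simp add: algebra_simps)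
    also have "real n powr (- (d * (a - \<beta>))) = 1 / real n powr (d * (a - \<beta>))" by (rule powr_minus_divide)
    finally have "h n ^ CARD('d) / hs n ^ CARD('d) = 1 / real n powr (d * (a - \<beta>))" by (simp only: hp[OF n])
    then show ?thesis by (simp only: V[OF n] hp(3)[OF n] flip: divide_divide_eq_left)
  qed
  ultimately show ?thesis
    by (intro Lim_transform_eventually[OF log_prob_miss_tendsto ev3I]) simp
qed

end
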